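(* Let $N\in\mathbb{N}$, $\mu\in\mathbb{R}$, and let $u:\mathbb{S}^N\to\mathbb{R}$ and $v:\mathbb{R}^N\to\mathbb{R}$ be such that $v=\iota(u)$. Then $u$ is a weak solution of $$\mathscr{P}^{\log}_gu=\tfrac4Nu\ln|u|+\mu u\ \text{ on }\mathbb{S}^N,\qquad u\in\mathbb{H}(\mathbb{S}^N),$$ if and only if $v$ is a weak solution of $$L_\Delta v=\tfrac4Nv\ln|v|+\mu v\ \text{ in }\mathbb{R}^N,\qquad v\in D^{log}(\mathbb{R}^N).$$
   Context: $\mathbb{S}^N\subset\mathbb{R}^{N+1}$ is the unit sphere with round metric $g$ and volume element $dV_g$; $|z-\zeta|$ is the Euclidean distance in $\mathbb{R}^{N+1}$. Let $\psi=\Gamma'/\Gamma$, $c_N=\pi^{-N/2}\Gamma(\tfrac N2)$, $A_N=2\psi(\tfrac N2)$, $\rho_N=2\ln2+\psi(\tfrac N2)-\gamma$, $\gamma=-\Gamma'(1)$. Convention: $t\ln|t|=0$ at $t=0$. Stereographic projection: $\sigma(z',z_{N+1})=\frac{z'}{1+z_{N+1}}$ on $\mathbb{S}^N\setminus\{-e_{N+1}\}$, $\sigma^{-1}(x)=\left(\frac{2x}{1+|x|^2},\frac{1-|x|^2}{1+|x|^2}\right)$; $\phi(x)=\frac{2}{1+|x|^2}$; $\iota(u)(x)=\phi(x)^{N/2}u(\sigma^{-1}(x))$. $\mathbb{H}(\mathbb{S}^N)=\{u\in L^2(\mathbb{S}^N):\|u\|_{\mathbb{H}(\mathbb{S}^N)}<\infty\}$,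 where $$\|u\|_{\mathbb{H}(\mathbb{S}^N)}^2=\frac{c_N}{2}\int_{\mathbb{S}^N}\int_{\mathbb{S}^N}\frac{(u(z)-u(\zeta))^2}{|z-\zeta|^N}\,dV_g(z)\,dV_g(\zeta)+\kappa\int_{\mathbb{S}^N}u^2\,dV_g$$ and $\kappa>\max\{2(\psi(\tfrac N2)-\psi(\tfrac N4)),A_N,1\}$ is a fixed constant. $u\in\mathbb{H}(\mathbb{S}^N)$ is a weak solution of the first equation if for all $\varphi\in\mathbb{H}(\mathbb{S}^N)$ $$\frac{c_N}{2}\int_{\mathbb{S}^N}\int_{\mathbb{S}^N}\frac{(u(z)-u(\zeta))(\varphi(z)-\varphi(\zeta))}{|z-\zeta|^N}\,dV_g(z)\,dV_g(\zeta)+A_N\int_{\mathbb{S}^N}u\varphi\,dV_g=\int_{\mathbb{S}^N}\left(\tfrac4Nu\ln|u|+\mu u\right)\varphi\,dV_g.$$ Set $\mathcal{E}(v_1,v_2)=\frac{c_N}{2}\int_{\mathbb{R}^N}\int_{B_1(x)}\frac{(v_1(x)-v_1(y))(v_2(x)-v_2(y))}{|x-y|^N}\,dy\,dx$, $\|v\|^2=\mathcal{E}(v,v)+\int_{\mathbb{R}^N}v(x)^2\ln(e+|x|^2)\,dx$, $D^{log}(\mathbb{R}^N)=\{v\in L^2(\mathbb{R}^N):\|v\|<\infty\}$, and $$\mathcal{E}_L(v_1,v_2)=\mathcal{E}(v_1,v_2)-c_N\iint_{|x-y|\ge1}\frac{v_1(x)v_2(y)}{|x-y|^N}\,dx\,dy+\rho_N\int_{\mathbb{R}^N}v_1v_2\,dx,$$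 the bilinear form associated with the logarithmic Laplacian $L_\Delta$. $v\in D^{log}(\mathbb{R}^N)$ is a weak solution of the second equation if $$\mathcal{E}_L(v,\vartheta)=\int_{\mathbb{R}^N}\left(\tfrac4N\ln|v|+\mu\right)v\vartheta\,dx\qquad\text{for all }\vartheta\in D^{log}(\mathbb{R}^N).$$ *)

theory Defs
  imports "HOL-Analysis.Analysis"
begin

text \<open>
  The dimension is N = \<open>CARD('n)\<close>. Points of \<open>\<real>\<^sup>N\<^sup>+\<^sup>1\<close> are pairs \<open>(z', z\<^sub>N\<^sub>+\<^sub>1)\<close> of type
  \<open>real^'n \<times> real\<close>, whose norm is the Euclidean one, so the sphere is \<open>sphere 0 1\<close>. A function on
  the sphere is represented by a function on the ambient space; only its values on the sphere
  are used.
\<close>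

subsection \<open>Constants\<close>

definition cN :: "nat \<Rightarrow> real" where
  "cN N = pi powr (- (real N / 2)) * Gamma (real N / 2)"

definition AN :: "nat \<Rightarrow> real" where
  "AN N = 2 * Digamma (real N / 2)"

definition rhoN :: "nat \<Rightarrow> real" where
  "rhoN N = 2 * ln 2 + Digamma (real N / 2) - euler_mascheroni"

lemma Digamma_eq_deriv_Gamma:
  "Digamma x = deriv Gamma x / Gamma x" if "x > 0" for x :: real
proof -
  have "(Gamma has_field_derivative Gamma x * Digamma x) (at x)"
    using that by (intro has_field_derivative_Gamma) (auto elim!: nonpos_Ints_cases)
  then show ?thesis
    using Gamma_real_pos[OF that] by (simp add: DERIV_imp_deriv)
qed

lemma euler_mascheroni_eq_deriv_Gamma: "euler_mascheroni = - deriv Gamma (1::real)"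
  using Digamma_eq_deriv_Gamma[of 1] by (simp add: Digamma_1)

subsection \<open>Stereographic projection\<close>

definition stereo :: "(real^'n) \<times> real \<Rightarrow> real^'n" where
  "stereo z = (1 / (1 + snd z)) *\<^sub>R fst z"

definition stereo_inv :: "real^'n \<Rightarrow> (real^'n) \<times> real" where
  "stereo_inv x = ((2 / (1 + (norm x)\<^sup>2)) *\<^sub>R x, (1 - (norm x)\<^sup>2) / (1 + (norm x)\<^sup>2))"

definition conf_factor :: "real^'n \<Rightarrow> real" where
  "conf_factor x = 2 / (1 + (norm x)\<^sup>2)"

definition iota :: "((real^'n) \<times> real \<Rightarrow> real) \<Rightarrow> real^'n \<Rightarrow> real" where
  "iota u x = conf_factor x powr (real CARD('n) / 2) * u (stereo_inv x)"

lemma norm_sq_pos: "1 + (norm x)\<^sup>2 > 0"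
  by (simp add: add_pos_nonneg)

lemma stereo_inv_in_sphere: "stereo_inv x \<in> sphere 0 1 - {(0, -1)}"
proof -
  have p: "1 + (norm x)\<^sup>2 > 0" by (rule norm_sq_pos)
  have "(norm (stereo_inv x))\<^sup>2 = (2 * norm x / (1 + (norm x)\<^sup>2))\<^sup>2
      + ((1 - (norm x)\<^sup>2) / (1 + (norm x)\<^sup>2))\<^sup>2"
    using p by (simp add: stereo_inv_def norm_prod_def power_divide)
  also have "\<dots> = ((2 * norm x)\<^sup>2 + (1 - (norm x)\<^sup>2)\<^sup>2) / (1 + (norm x)\<^sup>2)\<^sup>2"
    by (simp add: power_divide add_divide_distrib)
  also have "(2 * norm x)\<^sup>2 + (1 - (norm x)\<^sup>2)\<^sup>2 = (1 + (norm x)\<^sup>2)\<^sup>2"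
    by (simp add: power2_eq_square algebra_simps)
  finally have "(norm (stereo_inv x))\<^sup>2 = 1" using p by simp
  then have "norm (stereo_inv x) = 1"
    by (metis norm_ge_zero one_power2 power2_eq_iff_nonneg zero_le_one)
  moreover have "snd (stereo_inv x) \<noteq> -1"
    using p by (simp add: stereo_inv_def field_simps)
  ultimately show ?thesis by auto
qed

lemma stereo_stereo_inv: "stereo (stereo_inv x) = x"
proof -
  have p: "1 + (norm x)\<^sup>2 > 0" by (rule norm_sq_pos)
  have "1 + (1 - (norm x)\<^sup>2) / (1 + (norm x)\<^sup>2) = 2 / (1 + (norm x)\<^sup>2)"
    using p by (simp add: field_simps)
  then have "stereo (stereo_inv x) = ((1 + (norm x)\<^sup>2) / 2 * (2 / (1 + (norm x)\<^sup>2))) *\<^sub>R x"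
    by (simp add: stereo_def stereo_inv_def del: times_divide_eq_left times_divide_eq_right)
  moreover have "(1 + (norm x)\<^sup>2) / 2 * (2 / (1 + (norm x)\<^sup>2)) = 1"
    using p by simp
  ultimately show ?thesis by (simp only: scaleR_one)
qed

lemma stereo_inv_stereo:
  assumes "z \<in> sphere 0 1 - {(0, -1)}"
  shows "stereo_inv (stereo z) = z"
proof -
  obtain a t where z: "z = (a, t)" by (cases z)
  have n: "(norm a)\<^sup>2 + t\<^sup>2 = 1"
    using assms by (simp add: z norm_prod_def)
  have t: "1 + t \<noteq> 0"
  proof
    assume "1 + t = 0"
    then have "t = -1" by simp
    with n have "a = 0" by simp
    with \<open>t = -1\<close> assms show False by (simp add: z)
  qed
  have a: "(norm a)\<^sup>2 = (1 - t) * (1 + t)"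
    using n by (simp add: power2_eq_square algebra_simps)
  have s: "(norm (stereo z))\<^sup>2 = (1 - t) / (1 + t)"
    using t a by (simp add: z stereo_def power_divide power2_eq_square[of "1 + t"])
  have "1 + (norm (stereo z))\<^sup>2 = 2 / (1 + t)" "1 - (norm (stereo z))\<^sup>2 = 2 * t / (1 + t)"
    unfolding s using t by (simp_all add: field_simps)
  then show ?thesis using t by (simp add: stereo_inv_def z stereo_def)
qed

subsection \<open>Round metric and volume element\<close>

text \<open>
  The coefficients \<open>g\<^sub>i\<^sub>j = \<langle>\<partial>\<^sub>i F, \<partial>\<^sub>j F\<rangle>\<close> of the metric induced from the Euclidean inner product,
  in the parametrization F. For \<open>F = stereo_inv\<close> this is the round metric in stereographic
  coordinates. Its Riemannian volume element is \<open>sqrt (det g\<^sub>i\<^sub>j) dx\<close>; the chart misses only the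
  south pole, a null set. The measure is completed, so that measurability on the sphere
  is Lebesgue measurability, as on \<open>\<real>\<^sup>N\<close>.
\<close>

definition induced_metric ::
    "(real^'n \<Rightarrow> 'b::real_inner) \<Rightarrow> real^'n \<Rightarrow> real^'n^'n" where
  "induced_metric F x = (\<chi> i j. frechet_derivative F (at x) (axis i 1)
                              \<bullet> frechet_derivative F (at x) (axis j 1))"

definition sphere_vol :: "((real^'n) \<times> real) measure" where
  "sphere_vol = completion
     (distr (density lborel (\<lambda>x. ennreal (sqrt (det (induced_metric stereo_inv x)))))
        (restrict_space borel (sphere 0 1)) stereo_inv)"

subsection \<open>The equation on the sphere\<close>

text \<open>
  Squared norms are taken with values in \<open>[0,\<infinity>]\<close>. On the diagonal the kernels below are 0
  (division by zero), which affects only a null set.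
\<close>

definition H_norm_sq :: "real \<Rightarrow> ((real^'n) \<times> real \<Rightarrow> real) \<Rightarrow> ennreal" where
  "H_norm_sq \<kappa> u =
     ennreal (cN CARD('n) / 2) *
       (\<integral>\<^sup>+z. (\<integral>\<^sup>+\<zeta>. ennreal ((u z - u \<zeta>)\<^sup>2 / norm (z - \<zeta>) ^ CARD('n)) \<partial>sphere_vol) \<partial>sphere_vol)
     + ennreal \<kappa> * (\<integral>\<^sup>+z. ennreal ((u z)\<^sup>2) \<partial>sphere_vol)"

definition H_sphere :: "real \<Rightarrow> ((real^'n) \<times> real \<Rightarrow> real) set" where
  "H_sphere \<kappa> = {u \<in> borel_measurable sphere_vol.
      (\<integral>\<^sup>+z. ennreal ((u z)\<^sup>2) \<partial>sphere_vol) < \<infinity> \<and> H_norm_sq \<kappa> u < \<infinity>}"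

definition P_form ::
    "((real^'n) \<times> real \<Rightarrow> real) \<Rightarrow> ((real^'n) \<times> real \<Rightarrow> real) \<Rightarrow> real" where
  "P_form u w =
     cN CARD('n) / 2 *
       (\<integral>z. (\<integral>\<zeta>. (u z - u \<zeta>) * (w z - w \<zeta>) / norm (z - \<zeta>) ^ CARD('n) \<partial>sphere_vol) \<partial>sphere_vol)
     + AN CARD('n) * (\<integral>z. u z * w z \<partial>sphere_vol)"

text \<open>
  The Bochner integral of a non-integrable function is 0, so the weak formulations state
  explicitly that the right-hand side is an integrable function; \<open>t ln |t|\<close> is 0 at \<open>t = 0\<close>.
\<close>

definition weak_solution_sphere :: "real \<Rightarrow> real \<Rightarrow> ((real^'n) \<times> real \<Rightarrow> real) \<Rightarrow> bool" where
  "weak_solution_sphere \<kappa> \<mu> u \<longleftrightarrow>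
     u \<in> H_sphere \<kappa> \<and>
     (\<forall>w \<in> H_sphere \<kappa>.
        integrable sphere_vol (\<lambda>z. (4 / real CARD('n) * u z * ln \<bar>u z\<bar> + \<mu> * u z) * w z) \<and>
        P_form u w =
          (\<integral>z. (4 / real CARD('n) * u z * ln \<bar>u z\<bar> + \<mu> * u z) * w z \<partial>sphere_vol))"

subsection \<open>The equation on Euclidean space\<close>

definition E_form :: "(real^'n \<Rightarrow> real) \<Rightarrow> (real^'n \<Rightarrow> real) \<Rightarrow> real" where
  "E_form v w = cN CARD('n) / 2 *
     (\<integral>x. (\<integral>y\<in>ball x 1. (v x - v y) * (w x - w y) / norm (x - y) ^ CARD('n) \<partial>lebesgue) \<partial>lebesgue)"

definition D_norm_sq :: "(real^'n \<Rightarrow> real) \<Rightarrow> ennreal" where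
  "D_norm_sq v =
     ennreal (cN CARD('n) / 2) *
       (\<integral>\<^sup>+x. (\<integral>\<^sup>+y\<in>ball x 1. ennreal ((v x - v y)\<^sup>2 / norm (x - y) ^ CARD('n)) \<partial>lebesgue) \<partial>lebesgue)
     + (\<integral>\<^sup>+x. ennreal ((v x)\<^sup>2 * ln (exp 1 + (norm x)\<^sup>2)) \<partial>lebesgue)"

definition D_log :: "(real^'n \<Rightarrow> real) set" where
  "D_log = {v \<in> borel_measurable lebesgue.
      (\<integral>\<^sup>+x. ennreal ((v x)\<^sup>2) \<partial>lebesgue) < \<infinity> \<and> D_norm_sq v < \<infinity>}"

definition EL_form :: "(real^'n \<Rightarrow> real) \<Rightarrow> (real^'n \<Rightarrow> real) \<Rightarrow> real" where
  "EL_form v w =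
     E_form v w
     - cN CARD('n) *
       (\<integral>(x, y)\<in>{(x, y). norm (x - y) \<ge> 1}.
          v x * w y / norm (x - y) ^ CARD('n) \<partial>(lebesgue \<Otimes>\<^sub>M lebesgue))
     + rhoN CARD('n) * (\<integral>x. v x * w x \<partial>lebesgue)"

definition weak_solution_Rn :: "real \<Rightarrow> (real^'n \<Rightarrow> real) \<Rightarrow> bool" where
  "weak_solution_Rn \<mu> v \<longleftrightarrow>
     v \<in> D_log \<and>
     (\<forall>w \<in> D_log.
        integrable lebesgue (\<lambda>x. (4 / real CARD('n) * ln \<bar>v x\<bar> + \<mu>) * v x * w x) \<and>
        EL_form v w =
          (\<integral>x. (4 / real CARD('n) * ln \<bar>v x\<bar> + \<mu>) * v x * w x \<partial>lebesgue))"

end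

theory Submission
  imports Defs
begin

text \<open>
  In stereographic coordinates \<open>\<bar>\<sigma>\<^sup>-\<^sup>1 x - \<sigma>\<^sup>-\<^sup>1 y\<bar>\<^sup>2 = \<phi> x \<phi> y \<bar>x - y\<bar>\<^sup>2\<close> and \<open>dV = \<phi>\<^sup>N dx\<close>. With \<open>b = \<phi>\<^sup>N\<^sup>/\<^sup>2\<close>,
  expanding the product in the form on the sphere gives the form of the logarithmic Laplacian plus
  the term \<open>\<integral> v w K\<close>, where \<open>K x = c\<^sub>N \<integral> (b y / b x - 1\<^bsub>\<bar>x - y\<bar> < 1\<^esub>) / \<bar>x - y\<bar>\<^sup>N dy\<close>. An inversion
  centred at \<open>x\<close> turns this integrand into \<open>(\<bar>k + a\<bar>\<^sup>2 + c\<^sup>2)\<^sup>-\<^sup>N\<^sup>/\<^sup>2 - 1\<^bsub>\<bar>k\<bar> > 1\<^esub> \<bar>k\<bar>\<^sup>-\<^sup>N\<close> with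
  \<open>c = \<phi> x / 2\<close> and \<open>a = c x\<close>. The translation by \<open>a\<close> does not change the integral, and the radial
  integral is elementary: \<open>K = \<rho>\<^sub>N - A\<^sub>N - 2 ln \<phi>\<close>. The term \<open>2 ln \<phi>\<close> cancels against the one produced by
  \<open>ln \<bar>u\<bar> = ln \<bar>v\<bar> - N/2 ln \<phi>\<close> in the nonlinearity. The two energy spaces correspond to each other by a
  logarithmic Hardy inequality at the south pole.
\<close>

subsection \<open>Inversion and radial integrals\<close>

text \<open>The expansion of the form on the sphere can be integrated term by term only if each
  piece is integrable. Since \<open>\<integral> |bubble_kernel x y| dy\<close> grows at most like
  \<open>log_weight x\<close>, the diagonal pieces are controlled by the integral of
  \<open>v^2 * log_weight\<close>, and they dominate the far pieces. In \<open>D_log\<close> this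
  weight is part of the norm, but in \<open>H_sphere\<close> it is not: there only the square
  integral and the Gagliardo energy are given. This is why a Hardy inequality is required. With the
  weight at hand, \<open>conf_form\<close> and \<open>near_form\<close> differ by integrable terms,
  so that one energy is finite exactly when the other is, and the term with \<open>ln \<phi>\<close>
  can be moved between the two sides of the equation without affecting integrability. The two halves
  of the integrand of \<open>K\<close> are not integrable at \<open>y = x\<close> separately.
  Inversion moves this singularity to infinity, where a translation alters the integrand only by a
  term with one more power of decay.\<close>

lemma nn_integral_lborel_affine:
  fixes F :: "'a::euclidean_space \<Rightarrow> ennreal"
  assumes [measurable]: "F \<in> borel_measurable borel" and c: "c \<noteq> 0"
  shows "(\<integral>\<^sup>+x. F x \<partial>lborel) = ennreal (\<bar>c\<bar> ^ DIM('a)) * (\<integral>\<^sup>+x. F (t + c *\<^sub>R x) \<partial>lborel)"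
  by (subst lborel_affine[OF c, of t])
     (simp add: nn_integral_density nn_integral_distr nn_integral_cmult)

lemma integrable_lborel_affine_iff:
  fixes F :: "'a::euclidean_space \<Rightarrow> real"
  assumes [measurable]: "F \<in> borel_measurable borel" and c: "c \<noteq> 0"
  shows "integrable lborel (\<lambda>x. F (t + c *\<^sub>R x)) \<longleftrightarrow> integrable lborel F"
  using c by (subst (2) lborel_affine[OF c, of t])
     (simp add: integrable_density integrable_distr_eq)

lemma integral_lborel_affine:
  fixes F :: "'a::euclidean_space \<Rightarrow> real"
  assumes [measurable]: "F \<in> borel_measurable borel" and c: "c \<noteq> 0"
  shows "(\<integral>x. F x \<partial>lborel) = \<bar>c\<bar> ^ DIM('a) * (\<integral>x. F (t + c *\<^sub>R x) \<partial>lborel)"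
  by (subst lborel_affine[OF c, of t])
     (simp add: integral_density integral_distr)

text \<open>Averaging over dilations: \<open>{t. 0 < t + ln (norm h) < 1}\<close> has length 1, and the
  substitution \<open>h = exp (-t) k\<close> leaves the measure \<open>dh / norm h ^ n\<close> invariant.\<close>

lemma nn_integral_dilation_average:
  fixes F :: "'a::euclidean_space \<Rightarrow> ennreal"
  assumes [measurable]: "F \<in> borel_measurable borel"
  shows "(\<integral>\<^sup>+h. F h * ennreal (1 / norm h ^ DIM('a)) \<partial>lborel) =
    (\<integral>\<^sup>+k. \<integral>\<^sup>+t. F (exp (- t) *\<^sub>R k) * indicator {0<..<1} (ln (norm k))
        * ennreal (1 / norm k ^ DIM('a)) \<partial>lborel \<partial>lborel)"
proof -
  have "(\<integral>\<^sup>+h. F h * ennreal (1 / norm h ^ DIM('a)) \<partial>lborel) =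
    (\<integral>\<^sup>+h. \<integral>\<^sup>+t. F h * ennreal (1 / norm h ^ DIM('a)) * indicator {0<..<1} (t + ln (norm h)) \<partial>lborel \<partial>(lborel :: 'a measure))"
  proof (rule nn_integral_cong)
    fix h :: 'a
    have "(\<integral>\<^sup>+t. indicator {0<..<1} (t + ln (norm h)) \<partial>lborel)
        = (\<integral>\<^sup>+t. indicator {- ln (norm h)<..<1 - ln (norm h)} t \<partial>(lborel :: real measure))"
      by (intro nn_integral_cong) (auto simp: indicator_def)
    also have "\<dots> = 1" by simp
    finally show "F h * ennreal (1 / norm h ^ DIM('a)) = (\<integral>\<^sup>+t. F h * ennreal (1 / norm h ^ DIM('a)) * indicator {0<..<1} (t + ln (norm h)) \<partial>lborel)"
      by (simp add: nn_integral_cmult)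
  qed
  also have "\<dots> = (\<integral>\<^sup>+t. \<integral>\<^sup>+h. F h * ennreal (1 / norm h ^ DIM('a)) * indicator {0<..<1} (t + ln (norm h)) \<partial>(lborel :: 'a measure) \<partial>lborel)"
    by (rule lborel_pair.Fubini') measurable
  also have "\<dots> = (\<integral>\<^sup>+t. \<integral>\<^sup>+k. F (exp (- t) *\<^sub>R k) * indicator {0<..<1} (ln (norm k))
        * ennreal (1 / norm k ^ DIM('a)) \<partial>lborel \<partial>lborel)"
  proof (rule nn_integral_cong)
    fix t :: real
    let ?c = "exp (- t)"
    have [measurable]: "(\<lambda>h::'a. indicator {0<..<1::real} (t + ln (norm h)) :: ennreal) \<in> borel_measurable borel"
      by (rule measurable_compose[where N=borel, OF _ borel_measurable_indicator]) simp_all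
    have "(\<integral>\<^sup>+h. F h * ennreal (1 / norm h ^ DIM('a)) * indicator {0<..<1} (t + ln (norm h)) \<partial>(lborel :: 'a measure)) =
      ennreal (\<bar>?c\<bar> ^ DIM('a)) * (\<integral>\<^sup>+k. F (0 + ?c *\<^sub>R k) * ennreal (1 / norm (0 + ?c *\<^sub>R k) ^ DIM('a)) * indicator {0<..<1} (t + ln (norm (0 + ?c *\<^sub>R k))) \<partial>lborel)"
      by (rule nn_integral_lborel_affine) simp_all
    also have "\<dots> = (\<integral>\<^sup>+k. ennreal (\<bar>?c\<bar> ^ DIM('a)) * (F (0 + ?c *\<^sub>R k) * ennreal (1 / norm (0 + ?c *\<^sub>R k) ^ DIM('a)) * indicator {0<..<1} (t + ln (norm (0 + ?c *\<^sub>R k)))) \<partial>lborel)"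
      by (rule nn_integral_cmult[symmetric]) measurable
    also have "\<dots> = (\<integral>\<^sup>+k. F (?c *\<^sub>R k) * indicator {0<..<1} (ln (norm k))
        * ennreal (1 / norm k ^ DIM('a)) \<partial>lborel)"
    proof (rule nn_integral_cong_AE)
      have "AE k in lborel. k \<noteq> (0 :: 'a)" by (rule AE_lborel_singleton)
      then show "AE k in lborel. ennreal (\<bar>?c\<bar> ^ DIM('a)) * (F (0 + ?c *\<^sub>R k) * ennreal (1 / norm (0 + ?c *\<^sub>R k) ^ DIM('a)) * indicator {0<..<1} (t + ln (norm (0 + ?c *\<^sub>R k)))) = F (?c *\<^sub>R k) * indicator {0<..<1} (ln (norm k)) * ennreal (1 / norm k ^ DIM('a))"
      proof eventually_elim
        case (elim k)
        have "ennreal (\<bar>?c\<bar> ^ DIM('a)) * ennreal (1 / norm (0 + ?c *\<^sub>R k) ^ DIM('a)) = ennreal (1 / norm k ^ DIM('a))"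
          using elim by (subst ennreal_mult[symmetric]) (auto simp: power_mult_distrib)
        moreover have "t + ln (norm (0 + ?c *\<^sub>R k)) = ln (norm k)"
          using elim by (simp add: ln_mult)
        moreover have "a * (b * c * d) = b * d * (a * c)" for a b c d :: ennreal
          by (simp only: mult_ac)
        ultimately show ?case by (simp only: add_0)
      qed
    qed
    finally show "(\<integral>\<^sup>+h. F h * ennreal (1 / norm h ^ DIM('a)) * indicator {0<..<1} (t + ln (norm h)) \<partial>(lborel :: 'a measure)) = \<dots>" .
  qed
  also have "\<dots> = (\<integral>\<^sup>+k. \<integral>\<^sup>+t. F (exp (- t) *\<^sub>R k) * indicator {0<..<1} (ln (norm k))
        * ennreal (1 / norm k ^ DIM('a)) \<partial>lborel \<partial>lborel)"
    by (rule lborel_pair.Fubini') measurable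
  finally show ?thesis .
qed

section \<open>Inversion in the unit sphere\<close>

definition inversion :: "'a::euclidean_space \<Rightarrow> 'a" where
  "inversion h = (1 / (norm h)\<^sup>2) *\<^sub>R h"

lemma borel_measurable_inversion [measurable]: "inversion \<in> borel_measurable borel"
  unfolding inversion_def by measurable

text \<open>No Jacobian is computed. After averaging over dilations, inversion acts along each ray
  as the reflection \<open>t\<close> to \<open>2 * ln (norm k) - t\<close> of the dilation
  parameter, which preserves Lebesgue measure on the line, while the weight depends on
  \<open>k\<close> only.\<close>

lemma nn_integral_inversion:
  fixes F :: "'a::euclidean_space \<Rightarrow> ennreal"
  assumes [measurable]: "F \<in> borel_measurable borel"
  shows "(\<integral>\<^sup>+h. F (inversion h) * ennreal (1 / norm h ^ DIM('a)) \<partial>lborel) =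
    (\<integral>\<^sup>+h. F h * ennreal (1 / norm h ^ DIM('a)) \<partial>lborel)"
proof -
  let ?w = "\<lambda>k::'a. indicator {0<..<1} (ln (norm k)) * ennreal (1 / norm k ^ DIM('a))"
  have "(\<integral>\<^sup>+t. F (inversion (exp (- t) *\<^sub>R k)) * ?w k \<partial>lborel) = (\<integral>\<^sup>+t. F (exp (- t) *\<^sub>R k) * ?w k \<partial>lborel)"
    if k: "k \<noteq> 0" for k :: 'a
  proof -
    have "inversion (exp (- (2 * ln (norm k) + - 1 * t)) *\<^sub>R k) = exp (- t) *\<^sub>R k" for t
    proof -
      define s where "s = exp (- (2 * ln (norm k) + - 1 * t))"
      have s: "s = exp t / (norm k)\<^sup>2"
        using k by (simp add: s_def exp_diff exp_double)
      have "1 / (norm (s *\<^sub>R k))\<^sup>2 * s = exp (- t)"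
        using k unfolding s by (simp add: power_mult_distrib power_divide power2_eq_square field_simps exp_minus)
      then show ?thesis unfolding inversion_def s_def[symmetric] by (simp only: scaleR_scaleR)
    qed
    then show ?thesis
      by (subst nn_integral_real_affine[where c="-1" and t="2 * ln (norm k)"]) simp_all
  qed
  then have *: "AE k in lborel. (\<integral>\<^sup>+t. F (inversion (exp (- t) *\<^sub>R k)) * ?w k \<partial>lborel) = (\<integral>\<^sup>+t. F (exp (- t) *\<^sub>R k) * ?w k \<partial>lborel)"
    using AE_lborel_singleton[of "0::'a"] by (rule_tac AE_mp) auto
  show ?thesis
    unfolding nn_integral_dilation_average[OF assms]
    by (subst nn_integral_dilation_average[of "\<lambda>h. F (inversion h)"])
       (use * in \<open>auto intro!: nn_integral_cong_AE simp: mult.assoc\<close>)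
qed

lemma distr_inversion:
  "distr (density lborel (\<lambda>h::'a::euclidean_space. ennreal (1 / norm h ^ DIM('a)))) borel inversion
     = density lborel (\<lambda>h. ennreal (1 / norm h ^ DIM('a)))" (is "?L = ?R")
proof (rule measure_eqI)
  fix A :: "'a set" assume "A \<in> sets ?L"
  then have [measurable]: "A \<in> sets borel" by simp
  have "emeasure ?L A = (\<integral>\<^sup>+h. indicator A (inversion h) * ennreal (1 / norm h ^ DIM('a)) \<partial>lborel)"
    using measurable_sets_borel[OF borel_measurable_inversion, of A]
    by (auto simp: emeasure_distr emeasure_density intro!: nn_integral_cong split: split_indicator)
  also have "\<dots> = emeasure ?R A"
    by (subst nn_integral_inversion) (auto simp: emeasure_density mult.commute)
  finally show "emeasure ?L A = emeasure ?R A" .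
qed simp

lemma integrable_inversion_iff:
  fixes F :: "'a::euclidean_space \<Rightarrow> real"
  assumes [measurable]: "F \<in> borel_measurable borel"
  shows "integrable lborel (\<lambda>h. F (inversion h) / norm h ^ DIM('a)) \<longleftrightarrow> integrable lborel (\<lambda>h. F h / norm h ^ DIM('a))"
proof -
  have "integrable (density lborel (\<lambda>h::'a. ennreal (1 / norm h ^ DIM('a)))) (\<lambda>h. F (inversion h))
    \<longleftrightarrow> integrable (density lborel (\<lambda>h::'a. ennreal (1 / norm h ^ DIM('a)))) F"
    by (subst (2) distr_inversion[symmetric]) (simp add: integrable_distr_eq)
  then show ?thesis by (simp add: integrable_density)
qed

lemma integral_inversion:
  fixes F :: "'a::euclidean_space \<Rightarrow> real"
  assumes [measurable]: "F \<in> borel_measurable borel"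
  shows "(\<integral>h. F (inversion h) / norm h ^ DIM('a) \<partial>lborel) = (\<integral>h. F h / norm h ^ DIM('a) \<partial>lborel)"
proof -
  have "(\<integral>h. F (inversion h) \<partial>density lborel (\<lambda>h::'a. ennreal (1 / norm h ^ DIM('a))))
    = (\<integral>h. F h \<partial>density lborel (\<lambda>h::'a. ennreal (1 / norm h ^ DIM('a))))"
    by (subst (2) distr_inversion[symmetric]) (simp add: integral_distr)
  then show ?thesis by (simp add: integral_density)
qed

text \<open>Polar coordinates without a surface measure: on the half-lines \<open>{..r}\<close>, an
  intersection-stable generator, one side is the volume of a ball and the other the integral of its
  derivative in \<open>r\<close>.\<close>

lemma distr_norm_lborel:
  "distr lborel borel (norm :: 'a::euclidean_space \<Rightarrow> real) =
     density lborel (\<lambda>r. ennreal (DIM('a) * unit_ball_vol DIM('a) * r ^ (DIM('a) - 1)) * indicator {0..} r)" (is "?L = ?R")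
proof (rule measure_eqI_generator_eq[where E="range atMost" and \<Omega>=UNIV and A="\<lambda>n. {..real n}"])
  show "Int_stable (range atMost :: real set set)"
    by (auto simp: Int_stable_def)
  show "sets ?L = sigma_sets UNIV (range atMost)" "sets ?R = sigma_sets UNIV (range atMost)"
    by (simp_all add: borel_eq_atMost)
  show "range (\<lambda>n. {..real n}) \<subseteq> range atMost" by auto
  show "(\<Union>n. {..real n}) = UNIV" using real_arch_simple by auto
  have ball: "emeasure ?L {..r} = ennreal (if r < 0 then 0 else unit_ball_vol DIM('a) * r ^ DIM('a))" for r
  proof -
    have "norm -` {..r} \<inter> space lborel = cball (0::'a) r" by auto
    then have "emeasure ?L {..r} = emeasure lborel (cball (0::'a) r)"
      by (subst emeasure_distr) auto
    then show ?thesis using emeasure_cball[of r "0::'a"] by (cases "r < 0") (auto simp: )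
  qed
  then show "emeasure ?L {..real n} \<noteq> \<infinity>" for n by simp
  fix X :: "real set" assume "X \<in> range atMost"
  then obtain r where X: "X = {..r}" by auto
  have "emeasure ?R {..r} = ennreal (if r < 0 then 0 else unit_ball_vol DIM('a) * r ^ DIM('a))"
  proof (cases "r < 0")
    case True
    then show ?thesis by (auto simp: emeasure_density nn_integral_0_iff_AE split: split_indicator)
  next
    case False
    have "emeasure ?R {..r} = (\<integral>\<^sup>+x. ennreal (DIM('a) * unit_ball_vol DIM('a) * x ^ (DIM('a) - 1)) * indicator {0..r} x \<partial>lborel)"
      by (auto simp: emeasure_density intro!: nn_integral_cong split: split_indicator)
    also have "\<dots> = ennreal (unit_ball_vol DIM('a) * r ^ DIM('a) - unit_ball_vol DIM('a) * 0 ^ DIM('a))"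
      using False by (intro nn_integral_FTC_Icc) (auto intro!: derivative_eq_intros simp: has_real_derivative_iff_has_vector_derivative[symmetric])
    finally show ?thesis using False by simp
  qed
  with ball show "emeasure ?L X = emeasure ?R X" unfolding X by simp
qed auto

lemma nn_integral_radial:
  assumes [measurable]: "g \<in> borel_measurable borel"
  shows "(\<integral>\<^sup>+x. g (norm (x::'a::euclidean_space)) \<partial>lborel) =
    (\<integral>\<^sup>+r. ennreal (DIM('a) * unit_ball_vol DIM('a) * r ^ (DIM('a) - 1)) * indicator {0..} r * g r \<partial>lborel)"
proof -
  have "(\<integral>\<^sup>+x. g (norm (x::'a)) \<partial>lborel) = (\<integral>\<^sup>+r. g r \<partial>distr lborel borel (norm :: 'a \<Rightarrow> real))"
    by (subst nn_integral_distr) auto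
  also have "\<dots> = (\<integral>\<^sup>+r. ennreal (DIM('a) * unit_ball_vol DIM('a) * r ^ (DIM('a) - 1)) * indicator {0..} r * g r \<partial>lborel)"
    unfolding distr_norm_lborel by (subst nn_integral_density) auto
  finally show ?thesis .
qed

lemma
  fixes g :: "real \<Rightarrow> real"
  assumes [measurable]: "g \<in> borel_measurable borel"
  shows integrable_radial_iff: "integrable lborel (\<lambda>x::'a::euclidean_space. g (norm x)) \<longleftrightarrow>
      integrable lborel (\<lambda>r. r ^ (DIM('a) - 1) * indicator {0..} r * g r)"
    and integral_radial: "(\<integral>x. g (norm (x::'a)) \<partial>lborel) =
      DIM('a) * unit_ball_vol DIM('a) * (\<integral>r. r ^ (DIM('a) - 1) * indicator {0..} r * g r \<partial>lborel)"
proof -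
  let ?c = "DIM('a) * unit_ball_vol DIM('a)"
  have c: "?c > 0" by simp
  have D: "distr lborel borel (norm :: 'a \<Rightarrow> real) = density lborel (\<lambda>r. ennreal (?c * r ^ (DIM('a) - 1) * indicator {0..} r))"
    unfolding distr_norm_lborel by (intro density_cong) (auto split: split_indicator)
  have nn: "AE r in lborel. 0 \<le> ?c * r ^ (DIM('a) - 1) * indicator {0..} (r::real)"
    using c by (auto split: split_indicator)
  have "integrable lborel (\<lambda>x::'a. g (norm x)) \<longleftrightarrow> integrable (distr lborel borel (norm :: 'a \<Rightarrow> real)) g"
    by (subst integrable_distr_eq) auto
  also have "\<dots> \<longleftrightarrow> integrable lborel (\<lambda>r. ?c * (r ^ (DIM('a) - 1) * indicator {0..} r * g r))"
    unfolding D using nn by (subst integrable_density) (auto simp: mult_ac)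
  finally show "integrable lborel (\<lambda>x::'a. g (norm x)) \<longleftrightarrow>
      integrable lborel (\<lambda>r. r ^ (DIM('a) - 1) * indicator {0..} r * g r)"
    using unit_ball_vol_pos[of "real DIM('a)"] by (simp add: less_imp_neq[THEN not_sym])
  have "(\<integral>x. g (norm (x::'a)) \<partial>lborel) = (\<integral>r. g r \<partial>distr lborel borel (norm :: 'a \<Rightarrow> real))"
    by (subst integral_distr) auto
  also have "\<dots> = (\<integral>r. ?c * (r ^ (DIM('a) - 1) * indicator {0..} r * g r) \<partial>lborel)"
    unfolding D using nn by (subst integral_density) (auto simp: mult_ac)
  finally show "(\<integral>x. g (norm (x::'a)) \<partial>lborel) = ?c * (\<integral>r. r ^ (DIM('a) - 1) * indicator {0..} r * g r \<partial>lborel)"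
    by simp
qed

subsection \<open>The radial bubble integral\<close>

text \<open>Induction on the dimension in steps of two, from \<open>arsinh\<close> for
  \<open>n = 1\<close> and a logarithm for \<open>n = 2\<close>. Passing from \<open>m\<close> to
  \<open>m + 2\<close> subtracts \<open>(r / sqrt (r^2 + c^2))^m / m\<close> from the primitive. Its
  limit \<open>1 / m\<close> matches the recursion \<psi>(m/2 + 1) = \<psi>(m/2) + 2/m, and the two
  starting values are \<psi>(1/2) and \<psi>(1). The limit of \<open>F r - ln r\<close> is the
  renormalised integral up to infinity.\<close>

lemma ex_bubble_primitive:
  assumes "n \<ge> 1" and c: "c > 0"
  shows "\<exists>F. F 0 = 0 \<and> (\<forall>r. DERIV F r :> r ^ (n - 1) / sqrt (r\<^sup>2 + c\<^sup>2) ^ n) \<and>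
    ((\<lambda>r. F r - ln r) \<longlongrightarrow> - (Digamma (real n / 2) + euler_mascheroni) / 2 - ln c) at_top"
  using assms(1)
proof (induction n rule: less_induct)
  case (less n)
  have pos: "r\<^sup>2 + c\<^sup>2 > 0" for r :: real using c by (simp add: add_nonneg_pos)
  have inv0: "((\<lambda>r::real. c\<^sup>2 / r\<^sup>2) \<longlongrightarrow> 0) at_top"
    by (rule tendsto_divide_0[OF tendsto_const]) (auto intro!: filterlim_at_top_imp_at_infinity filterlim_pow_at_top filterlim_ident)
  consider "n = 1" | "n = 2" | m where "n = m + 2" "m \<ge> 1"
    using less.prems by (metis One_nat_def Suc_1 add.commute add_2_eq_Suc' le_SucE le_add_diff_inverse2 not_less_eq_eq numeral_2_eq_2)
  then show ?case
  proof cases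
    case 1
    define F where "F r = arsinh (r / c)" for r :: real
    have "DERIV F r :> r ^ (n - 1) / sqrt (r\<^sup>2 + c\<^sup>2) ^ n" for r
    proof -
      have "sqrt ((r / c)\<^sup>2 + 1) = sqrt (r\<^sup>2 + c\<^sup>2) / c"
      proof -
        have "(r / c)\<^sup>2 + 1 = (r\<^sup>2 + c\<^sup>2) / c\<^sup>2" using c by (simp add: field_simps)
        then show ?thesis using c by (simp add: real_sqrt_divide)
      qed
      then show ?thesis
        unfolding F_def 1 using c
        by (intro DERIV_cong[OF DERIV_chain2[OF arsinh_real_has_field_derivative DERIV_cdivide[OF DERIV_ident]]]) auto
    qed
    moreover have "((\<lambda>r. F r - ln r) \<longlongrightarrow> - (Digamma (real n / 2) + euler_mascheroni) / 2 - ln c) at_top"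
    proof -
      have "((\<lambda>r. ln ((1 + sqrt (1 + c\<^sup>2 / r\<^sup>2)) / c)) \<longlongrightarrow> ln ((1 + sqrt (1 + 0)) / c)) at_top"
        using c by (intro tendsto_intros inv0) auto
      moreover have "\<forall>\<^sub>F r in at_top. ln ((1 + sqrt (1 + c\<^sup>2 / r\<^sup>2)) / c) = F r - ln r"
        using eventually_gt_at_top[of 0]
      proof eventually_elim
        case (elim r)
        have "sqrt (1 + c\<^sup>2 / r\<^sup>2) = sqrt (r\<^sup>2 + c\<^sup>2) / r"
        proof -
          have "1 + c\<^sup>2 / r\<^sup>2 = (r\<^sup>2 + c\<^sup>2) / r\<^sup>2" using elim by (simp add: field_simps)
          then show ?thesis using elim by (simp add: real_sqrt_divide)
        qed
        moreover have "r + sqrt (r\<^sup>2 + c\<^sup>2) > 0" using elim pos[of r] by (simp add: add_pos_pos)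
        moreover have "sqrt ((r / c)\<^sup>2 + 1) = sqrt (r\<^sup>2 + c\<^sup>2) / c"
        proof -
          have "(r / c)\<^sup>2 + 1 = (r\<^sup>2 + c\<^sup>2) / c\<^sup>2" using c by (simp add: field_simps)
          then show ?thesis using c by (simp add: real_sqrt_divide)
        qed
        moreover have "ln ((r + sqrt (r\<^sup>2 + c\<^sup>2)) / c) - ln r = ln ((r + sqrt (r\<^sup>2 + c\<^sup>2)) / c / r)"
          using elim c \<open>r + sqrt (r\<^sup>2 + c\<^sup>2) > 0\<close> by (subst ln_div[of "(r + sqrt (r\<^sup>2 + c\<^sup>2)) / c" r]) (auto intro!: divide_pos_pos)
        moreover have "(1 + sqrt (r\<^sup>2 + c\<^sup>2) / r) / c = (r + sqrt (r\<^sup>2 + c\<^sup>2)) / c / r"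
          using elim c by (simp add: field_simps)
        ultimately show ?case
          by (simp add: F_def arsinh_real_def add_divide_distrib)
      qed
      ultimately have "((\<lambda>r. F r - ln r) \<longlongrightarrow> ln ((1 + sqrt (1 + 0)) / c)) at_top"
        by (rule Lim_transform_eventually)
      then show ?thesis using c by (simp add: 1 Digamma_one_half ln_div)
    qed
    ultimately show ?thesis by (intro exI[of _ F]) (simp add: F_def[of 0])
  next
    case 2
    \<comment> \<open>The constant \<open>ln c\<close> normalises \<open>F 0 = 0\<close>.\<close>
    define F where "F r = ln (r\<^sup>2 + c\<^sup>2) / 2 - ln c" for r :: real
    have "DERIV F r :> r ^ (n - 1) / sqrt (r\<^sup>2 + c\<^sup>2) ^ n" for r
      unfolding F_def 2 using pos[of r] c by (auto intro!: derivative_eq_intros simp del: distrib_right_numeral)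
    moreover have "((\<lambda>r. F r - ln r) \<longlongrightarrow> - (Digamma (real n / 2) + euler_mascheroni) / 2 - ln c) at_top"
    proof -
      have "((\<lambda>r. ln (1 + c\<^sup>2 / r\<^sup>2) / 2 - ln c) \<longlongrightarrow> ln (1 + 0) / 2 - ln c) at_top"
        by (intro tendsto_intros inv0) auto
      moreover have "\<forall>\<^sub>F r in at_top. ln (1 + c\<^sup>2 / r\<^sup>2) / 2 - ln c = F r - ln r"
        using eventually_gt_at_top[of 0]
      proof eventually_elim
        case (elim r)
        have "1 + c\<^sup>2 / r\<^sup>2 = (r\<^sup>2 + c\<^sup>2) / r\<^sup>2" using elim by (simp add: field_simps)
        then show ?case using elim pos[of r] by (simp add: F_def ln_div ln_realpow)
      qed
      ultimately have "((\<lambda>r. F r - ln r) \<longlongrightarrow> ln (1 + 0) / 2 - ln c) at_top"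
        by (rule Lim_transform_eventually)
      then show ?thesis using c by (simp add: 2)
    qed
    ultimately show ?thesis using c by (intro exI[of _ F]) (simp add: F_def[of 0] ln_realpow)
  next
    case (3 m)
    then obtain F where F: "F 0 = 0" "\<And>r. DERIV F r :> r ^ (m - 1) / sqrt (r\<^sup>2 + c\<^sup>2) ^ m"
      "((\<lambda>r. F r - ln r) \<longlongrightarrow> - (Digamma (real m / 2) + euler_mascheroni) / 2 - ln c) at_top"
      using less.IH[of m] by auto
    define G where "G r = F r - (r / sqrt (r\<^sup>2 + c\<^sup>2)) ^ m / m" for r
    have "DERIV G r :> r ^ (n - 1) / sqrt (r\<^sup>2 + c\<^sup>2) ^ n" for r
    proof -
      define s where "s = sqrt (r\<^sup>2 + c\<^sup>2)"
      have s: "s > 0" "s\<^sup>2 = r\<^sup>2 + c\<^sup>2" using pos[of r] by (auto simp: s_def)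
      have 1: "DERIV (\<lambda>r. r / sqrt (r\<^sup>2 + c\<^sup>2)) r :> (s - r * (r / s)) / (s * s)"
        using pos[of r] unfolding s_def by (auto intro!: derivative_eq_intros simp: divide_simps)
      have 2: "(s - r * (r / s)) / (s * s) = c\<^sup>2 / s ^ 3"
        using s by (simp add: field_simps power2_eq_square power3_eq_cube)
      have "DERIV G r :> r ^ (m - 1) / s ^ m - (m * (c\<^sup>2 / s ^ 3 * (r / s) ^ (m - 1))) / m"
        unfolding G_def
        by (rule DERIV_cong[OF DERIV_diff[OF F(2) DERIV_cdivide[OF DERIV_power[OF 1[unfolded 2]]]]]) (simp add: s_def)
      moreover have "r ^ (m - 1) / s ^ m - (m * (c\<^sup>2 / s ^ 3 * (r / s) ^ (m - 1))) / m = r ^ (n - 1) / s ^ n"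
      proof -
        obtain k where k: "m = Suc k" using \<open>m \<ge> 1\<close> by (cases m) auto
        have "r ^ (m - 1) / s ^ m - (m * (c\<^sup>2 / s ^ 3 * (r / s) ^ (m - 1))) / m = r ^ k / s ^ Suc k - c\<^sup>2 * r ^ k / s ^ (k + 3)"
          by (simp add: k power_divide power_add)
        also have "\<dots> = r ^ k * (s\<^sup>2 - c\<^sup>2) / s ^ (k + 3)"
          using s(1) by (simp add: power_add power2_eq_square power3_eq_cube field_simps)
        also have "\<dots> = r ^ (n - 1) / s ^ n"
        proof -
          have "s\<^sup>2 - c\<^sup>2 = r\<^sup>2" using s by simp
          then show ?thesis
            by (simp only:) (simp add: k 3 power_add power2_eq_square power3_eq_cube mult_ac)
        qed
        finally show ?thesis .
      qed
      ultimately show ?thesis by (simp add: s_def)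
    qed
    moreover have "((\<lambda>r. G r - ln r) \<longlongrightarrow> - (Digamma (real n / 2) + euler_mascheroni) / 2 - ln c) at_top"
    proof -
      have "((\<lambda>r. 1 / sqrt (1 + c\<^sup>2 / r\<^sup>2)) \<longlongrightarrow> 1 / sqrt (1 + 0)) at_top"
        by (intro tendsto_intros inv0) auto
      moreover have "\<forall>\<^sub>F r in at_top. 1 / sqrt (1 + c\<^sup>2 / r\<^sup>2) = r / sqrt (r\<^sup>2 + c\<^sup>2)"
        using eventually_gt_at_top[of 0]
      proof eventually_elim
        case (elim r)
        have "1 + c\<^sup>2 / r\<^sup>2 = (r\<^sup>2 + c\<^sup>2) / r\<^sup>2" using elim by (simp add: field_simps)
        then show ?case using elim by (simp add: real_sqrt_divide)
      qed
      ultimately have L: "((\<lambda>r. r / sqrt (r\<^sup>2 + c\<^sup>2)) \<longlongrightarrow> 1 / sqrt (1 + 0)) at_top"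
        by (rule Lim_transform_eventually)
      have "((\<lambda>r. (F r - ln r) - (r / sqrt (r\<^sup>2 + c\<^sup>2)) ^ m / m) \<longlongrightarrow>
         (- (Digamma (real m / 2) + euler_mascheroni) / 2 - ln c) - (1 / sqrt (1 + 0)) ^ m / m) at_top"
        using \<open>m \<ge> 1\<close> by (intro tendsto_diff[OF F(3) tendsto_divide[OF tendsto_power[OF L] tendsto_const]]) auto
      have "Digamma (real n / 2) = Digamma (real m / 2) + 2 / m"
        using Digamma_plus1[of "real m / 2"] \<open>m \<ge> 1\<close> by (simp add: 3 add_divide_distrib add.commute)
      then have e1: "- (Digamma (real n / 2) + euler_mascheroni) / 2 - ln c =
          (- (Digamma (real m / 2) + euler_mascheroni) / 2 - ln c) - (1 / sqrt (1 + 0)) ^ m / m"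
        by (simp add: field_simps)
      have e2: "G r - ln r = (F r - ln r) - (r / sqrt (r\<^sup>2 + c\<^sup>2)) ^ m / m" for r
        by (simp add: G_def)
      show ?thesis unfolding e1 e2 by fact
    qed
    ultimately show ?thesis using F(1) \<open>m \<ge> 1\<close> by (intro exI[of _ G]) (simp add: G_def[of 0])
  qed
qed

text \<open>The two terms diverge separately at infinity, so the half-line is cut at 1. On
  \<open>{0..1}\<close> the integrand is nonnegative, on \<open>{1..}\<close> it is nonpositive, and
  on each piece the fundamental theorem for functions of one sign gives integrability together with
  the value. The contributions of \<open>F 1\<close> cancel.\<close>

lemma has_bochner_integral_bubble_radial:
  assumes n: "n \<ge> 1" and c: "c > 0"
  shows "has_bochner_integral lborel
    (\<lambda>r. r ^ (n - 1) * indicator {0..} r * (1 / sqrt (r\<^sup>2 + c\<^sup>2) ^ n - indicator {1<..} r / r ^ n))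
    (- (Digamma (real n / 2) + euler_mascheroni) / 2 - ln c)" (is "has_bochner_integral _ _ ?T")
proof -
  obtain F where F: "F 0 = 0" "\<And>r. DERIV F r :> r ^ (n - 1) / sqrt (r\<^sup>2 + c\<^sup>2) ^ n"
      "((\<lambda>r. F r - ln r) \<longlongrightarrow> ?T) at_top"
    using ex_bubble_primitive[OF assms] by auto
  let ?f = "\<lambda>r. r ^ (n - 1) / sqrt (r\<^sup>2 + c\<^sup>2) ^ n"
  have pos: "r\<^sup>2 + c\<^sup>2 > 0" for r :: real using c by (simp add: add_nonneg_pos)
  have inner: "has_bochner_integral lborel (\<lambda>r. ?f r * indicator {0..1} r) (F 1 - F 0)"
    using pos F(2) by (intro has_bochner_integral_FTC_Icc_nonneg) auto
  have nn: "1 / r - ?f r \<ge> 0" if "r \<ge> 1" for r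
  proof -
    have "r = sqrt (r\<^sup>2)" using that by simp
    also have "\<dots> \<le> sqrt (r\<^sup>2 + c\<^sup>2)" by (intro real_sqrt_le_mono) simp
    finally have "r ^ n \<le> sqrt (r\<^sup>2 + c\<^sup>2) ^ n" using that by (intro power_mono) auto
    moreover have "r ^ n = r * r ^ (n - 1)" using n by (cases n) auto
    ultimately show ?thesis using that pos[of r] by (simp add: divide_simps mult.commute)
  qed
  have dlim: "((\<lambda>r. ln r - F r) \<longlongrightarrow> - ?T) at_top"
    using tendsto_minus[OF F(3)] by simp
  have int: "(\<integral>\<^sup>+r. ennreal (1 / r - ?f r) * indicator {1..} r \<partial>lborel) = ennreal (- ?T - (ln 1 - F 1))"
    by (rule nn_integral_FTC_atLeast[OF _ _ nn dlim])
       (simp, (rule DERIV_diff[OF _ F(2)], auto intro!: derivative_eq_intros))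
  \<comment> \<open>The coercion \<open>ennreal\<close> truncates negative numbers to 0;
    monotonicity of \<open>ln r - F r\<close> rules this out.\<close>
  have le: "- ?T - (ln 1 - F 1) \<ge> 0"
  proof -
    have "ln 1 - F 1 \<le> ln r - F r" if "r \<ge> 1" for r
    proof (rule DERIV_nonneg_imp_nondecreasing[OF that])
      fix x :: real assume "1 \<le> x"
      then show "\<exists>y. ((\<lambda>r. ln r - F r) has_real_derivative y) (at x) \<and> 0 \<le> y"
        using nn[of x] by (intro exI[of _ "1 / x - ?f x"]) (auto intro!: DERIV_diff[OF _ F(2)[unfolded One_nat_def]] derivative_eq_intros)
    qed
    then have "ln 1 - F 1 \<le> - ?T"
      by (intro tendsto_lowerbound[OF dlim]) (auto intro: eventually_mono[OF eventually_ge_at_top[of 1]])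
    then show ?thesis by simp
  qed
  have outer: "has_bochner_integral lborel (\<lambda>r. (1 / r - ?f r) * indicator {1..} r) (- ?T - (ln 1 - F 1))"
  proof (rule has_bochner_integral_nn_integral)
    show "(\<integral>\<^sup>+ r. ennreal ((1 / r - ?f r) * indicator {1..} r) \<partial>lborel) = ennreal (- ?T - (ln 1 - F 1))"
      unfolding int[symmetric] by (intro nn_integral_cong) (auto split: split_indicator)
    show "AE r in lborel. 0 \<le> (1 / r - ?f r) * indicator {1..} r"
      using nn by (auto split: split_indicator)
  qed (use le in auto)
  have "has_bochner_integral lborel (\<lambda>r. ?f r * indicator {0..1} r - (1 / r - ?f r) * indicator {1..} r) ((F 1 - F 0) - (- ?T - (ln 1 - F 1)))"
    by (rule has_bochner_integral_diff[OF inner outer])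
  \<comment> \<open>The point 1 lies in both closed pieces, so the identity holds only almost
    everywhere.\<close>
  moreover have "AE r in lborel. ?f r * indicator {0..1} r - (1 / r - ?f r) * indicator {1..} r =
     r ^ (n - 1) * indicator {0..} r * (1 / sqrt (r\<^sup>2 + c\<^sup>2) ^ n - indicator {1<..} r / r ^ n)"
    using AE_lborel_singleton[of 1]
  proof eventually_elim
    case (elim r)
    have "r ^ n = r * r ^ (n - 1)" using n by (cases n) auto
    then show ?case using elim by (auto split: split_indicator simp: algebra_simps)
  qed
  ultimately show ?thesis
    by (subst (asm) has_bochner_integral_cong_AE) (simp_all add: F(1))
qed

lemma abs_power_diff_le:
  fixes p q M :: real
  assumes "0 \<le> p" "p \<le> M" "0 \<le> q" "q \<le> M"
  shows "\<bar>p ^ n - q ^ n\<bar> \<le> n * M ^ (n - 1) * \<bar>p - q\<bar>"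
proof (induction n)
  case (Suc n)
  have "p ^ Suc n - q ^ Suc n = p * (p ^ n - q ^ n) + q ^ n * (p - q)"
    by (simp add: algebra_simps)
  then have "\<bar>p ^ Suc n - q ^ Suc n\<bar> \<le> \<bar>p * (p ^ n - q ^ n)\<bar> + \<bar>q ^ n * (p - q)\<bar>"
    by (metis abs_triangle_ineq)
  also have "\<dots> = p * \<bar>p ^ n - q ^ n\<bar> + q ^ n * \<bar>p - q\<bar>"
    using assms by (simp add: abs_mult)
  also have "\<dots> \<le> M * (n * M ^ (n - 1) * \<bar>p - q\<bar>) + M ^ n * \<bar>p - q\<bar>"
    using assms Suc by (intro add_mono mult_mono power_mono) auto
  also have "\<dots> = Suc n * M ^ (Suc n - 1) * \<bar>p - q\<bar>"
    by (cases n) (simp_all add: algebra_simps)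
  finally show ?case .
qed simp

lemma integrable_inverse_plus_square:
  assumes c: "c > 0"
  shows "integrable lborel (\<lambda>r. indicator {0..} r / (r\<^sup>2 + c\<^sup>2) :: real)"
proof -
  have pos: "r\<^sup>2 + c\<^sup>2 > 0" for r :: real using c by (simp add: add_nonneg_pos)
  have "(\<integral>\<^sup>+r. ennreal (1 / (r\<^sup>2 + c\<^sup>2)) * indicator {0..} r \<partial>lborel) = ennreal (pi / 2 / c - arctan (0 / c) / c)"
  proof (rule nn_integral_FTC_atLeast)
    show "((\<lambda>r. arctan (r / c) / c) \<longlongrightarrow> pi / 2 / c) at_top"
      using c by (intro tendsto_intros filterlim_compose[OF tendsto_arctan_at_top])
        (auto simp: divide_inverse intro!: filterlim_at_top_mult_tendsto_pos[OF tendsto_const] filterlim_ident filterlim_tendsto_pos_mult_at_top)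
    show "DERIV (\<lambda>r. arctan (r / c) / c) r :> 1 / (r\<^sup>2 + c\<^sup>2)" for r
    proof -
      have "1 + (r / c)\<^sup>2 = (r\<^sup>2 + c\<^sup>2) / c\<^sup>2" using c by (simp add: field_simps)
      then have "inverse (1 + (r / c)\<^sup>2) * (1 / c) / c = 1 / (r\<^sup>2 + c\<^sup>2)"
        using c by (simp add: power2_eq_square)
      then show ?thesis
        using c by (intro DERIV_cong[OF DERIV_cdivide[OF DERIV_chain2[OF DERIV_arctan DERIV_cdivide[OF DERIV_ident]]]]) auto
    qed
  qed (use pos in \<open>auto simp: less_imp_le\<close>)
  then have "(\<integral>\<^sup>+r. ennreal (indicator {0..} r / (r\<^sup>2 + c\<^sup>2)) \<partial>lborel) < \<infinity>"
    by (subst (asm) nn_integral_cong[where v="\<lambda>r. ennreal (indicator {0..} r / (r\<^sup>2 + c\<^sup>2))"])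
       (auto split: split_indicator)
  then show ?thesis
    using pos by (intro integrableI_nonneg) (auto simp: less_imp_le)
qed

text \<open>One power beyond the critical exponent: with \<open>s = sqrt (r^2 + c^2)\<close> the
  radial density satisfies \<open>r^(n-1) \<le> s^(n-1)\<close>, which leaves
  \<open>1 / s^2\<close>.\<close>

lemma integrable_bubble_Suc:
  assumes c: "c > 0"
  shows "integrable lborel (\<lambda>k::'a::euclidean_space. 1 / sqrt ((norm k)\<^sup>2 + c\<^sup>2) ^ (DIM('a) + 1))"
proof (subst integrable_radial_iff[of "\<lambda>r. 1 / sqrt (r\<^sup>2 + c\<^sup>2) ^ (DIM('a) + 1)"], measurable)
  let ?n = "DIM('a)"
  show "integrable lborel (\<lambda>r. r ^ (?n - 1) * indicator {0..} r * (1 / sqrt (r\<^sup>2 + c\<^sup>2) ^ (?n + 1)))"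
  proof (rule Bochner_Integration.integrable_bound[OF integrable_inverse_plus_square[OF c]])
    show "AE r in lborel. norm (r ^ (?n - 1) * indicator {0..} r * (1 / sqrt (r\<^sup>2 + c\<^sup>2) ^ (?n + 1))) \<le> norm (indicator {0..} r / (r\<^sup>2 + c\<^sup>2))"
    proof (rule AE_I2)
      fix r :: real
      have pos: "r\<^sup>2 + c\<^sup>2 > 0" using c by (simp add: add_nonneg_pos)
      show "norm (r ^ (?n - 1) * indicator {0..} r * (1 / sqrt (r\<^sup>2 + c\<^sup>2) ^ (?n + 1))) \<le> norm (indicator {0..} r / (r\<^sup>2 + c\<^sup>2))"
      proof (cases "r \<ge> 0")
        case True
        define s where "s = sqrt (r\<^sup>2 + c\<^sup>2)"
        have s: "s > 0" "s\<^sup>2 = r\<^sup>2 + c\<^sup>2" using pos by (auto simp: s_def)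
        have "r \<le> s" unfolding s_def using True by (intro real_le_rsqrt) simp
        then have "r ^ (?n - 1) \<le> s ^ (?n - 1)" using True by (intro power_mono)
        moreover have "?n + 1 = (?n - 1) + 2" using DIM_positive[where 'a='a] by linarith
        then have "s ^ (?n + 1) = s ^ (?n - 1) * s\<^sup>2" by (simp only: power_add)
        ultimately show ?thesis
          using True s(1) unfolding s_def[symmetric] s(2)[symmetric] by (simp add: abs_mult divide_simps)
      qed simp
    qed
  qed measurable
qed

text \<open>The reflection \<open>k \<mapsto> - k - a\<close> exchanges the two terms.\<close>

lemma has_bochner_integral_bubble_shift:
  fixes a :: "'a::euclidean_space"
  assumes c: "c > 0"
  shows "has_bochner_integral lborel
    (\<lambda>k. 1 / sqrt ((norm (k + a))\<^sup>2 + c\<^sup>2) ^ DIM('a) - 1 / sqrt ((norm k)\<^sup>2 + c\<^sup>2) ^ DIM('a)) 0"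
    (is "has_bochner_integral _ ?g 0")
proof -
  let ?n = "DIM('a)"
  let ?s = "\<lambda>k::'a. sqrt ((norm k)\<^sup>2 + c\<^sup>2)"
  have pos: "?s k > 0" for k using c by (simp add: add_nonneg_pos)
  have meas: "(\<lambda>k. 1 / ?s k ^ (?n + 1)) \<in> borel_measurable borel" by measurable
  have I: "integrable lborel (\<lambda>k. 1 / ?s k ^ (?n + 1))"
    by (rule integrable_bubble_Suc[OF c])
  then have I': "integrable lborel (\<lambda>k. 1 / ?s (k + a) ^ (?n + 1))"
    using integrable_lborel_affine_iff[OF meas, of 1 a] by (simp add: add.commute)
  \<comment> \<open>Each term decays only like \<open>norm k ^ (-n)\<close>, which is not
    integrable; their difference gains one power, because \<open>p - q\<close> is bounded by
    \<open>norm a * p * q\<close>.\<close>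
  have int: "integrable lborel ?g"
  proof (rule Bochner_Integration.integrable_bound)
    show "integrable lborel (\<lambda>k. ?n * norm a * (1 / ?s (k + a) ^ (?n + 1) + 1 / ?s k ^ (?n + 1)))"
      using I I' by (intro integrable_mult_right Bochner_Integration.integrable_add)
    show "AE k in lborel. norm (?g k) \<le> norm (?n * norm a * (1 / ?s (k + a) ^ (?n + 1) + 1 / ?s k ^ (?n + 1)))"
    proof (rule AE_I2)
      fix k :: 'a
      define p q where "p = 1 / ?s (k + a)" and "q = 1 / ?s k"
      have inv_diff: "1 / x - 1 / y = (y - x) * (1 / x * (1 / y))" if "x > 0" "y > 0" for x y :: real
        using that by (simp add: field_simps)
      have pq: "p > 0" "q > 0" using pos by (auto simp: p_def q_def)
      define M where "M = max p q"
      have M: "p \<le> M" "q \<le> M" by (auto simp: M_def)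
      \<comment> \<open>The root is the norm of the pair \<open>(k, c)\<close>, hence 1-Lipschitz in
        \<open>k\<close>.\<close>
      have "\<bar>?s (k + a) - ?s k\<bar> \<le> norm a"
        using norm_triangle_ineq3[of "(k + a, c)" "(k, c)"] by (simp add: norm_Pair)
      moreover have "\<bar>p - q\<bar> = \<bar>?s (k + a) - ?s k\<bar> * (p * q)"
      proof -
        have "p - q = (?s k - ?s (k + a)) * (p * q)"
          unfolding p_def q_def by (rule inv_diff[OF pos pos])
        then show ?thesis using pq by (simp add: abs_mult abs_minus_commute)
      qed
      ultimately have d: "\<bar>p - q\<bar> \<le> norm a * (M * M)"
        using pq M by (auto intro!: mult_mono)
      have "norm (?g k) = \<bar>p ^ ?n - q ^ ?n\<bar>" by (simp add: p_def q_def power_one_over)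
      also have "\<dots> \<le> ?n * M ^ (?n - 1) * \<bar>p - q\<bar>"
        using pq M by (intro abs_power_diff_le) auto
      also have "\<dots> \<le> ?n * M ^ (?n - 1) * (norm a * (M * M))"
        using d pq M by (intro mult_left_mono) auto
      also have "\<dots> = ?n * norm a * M ^ (?n + 1)"
      proof -
        have "?n + 1 = (?n - 1) + 2" using DIM_positive[where 'a='a] by linarith
        then have "M ^ (?n + 1) = M ^ (?n - 1) * M\<^sup>2" by (simp only: power_add)
        then show ?thesis by (simp only: power2_eq_square mult_ac)
      qed
      also have "\<dots> \<le> ?n * norm a * (p ^ (?n + 1) + q ^ (?n + 1))"
        using pq by (intro mult_left_mono) (auto simp: M_def max_def)
      finally show "norm (?g k) \<le> norm (?n * norm a * (1 / ?s (k + a) ^ (?n + 1) + 1 / ?s k ^ (?n + 1)))"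
        using pq by (simp add: p_def q_def power_one_over)
    qed
  qed measurable
  have "(\<integral>k. ?g k \<partial>lborel) = \<bar>-1\<bar> ^ ?n * (\<integral>k. ?g (- a + (-1) *\<^sub>R k) \<partial>lborel)"
    by (rule integral_lborel_affine) simp_all
  also have "\<dots> = (\<integral>k. - ?g k \<partial>lborel)"
    by (simp add: norm_minus_commute add.commute norm_minus_cancel[of "k + a" for k, simplified])
  also have "\<dots> = - (\<integral>k. ?g k \<partial>lborel)"
    by (rule Bochner_Integration.integral_minus)
  finally have "(\<integral>k. ?g k \<partial>lborel) = 0" by linarith
  then show ?thesis using int by (simp add: has_bochner_integral_iff)
qed

subsection \<open>The logarithmic Laplacian of the bubble\<close>

text \<open>The factor \<phi>^(N/2) of \<open>iota\<close>, written as a natural power of a square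
  root so that it combines with \<open>norm (x - y) ^ N\<close> by the laws for natural
  powers.\<close>

definition bubble :: "real^'n \<Rightarrow> real" where
  "bubble x = sqrt (conf_factor x) ^ CARD('n)"

lemma conf_factor_pos: "conf_factor x > 0"
  unfolding conf_factor_def by (intro divide_pos_pos norm_sq_pos) simp

lemma conf_factor_le: "conf_factor x \<le> 2"
  unfolding conf_factor_def by (simp add: pos_divide_le_eq[OF norm_sq_pos])

lemma bubble_pos: "bubble x > 0"
  by (simp add: bubble_def conf_factor_pos)

lemma bubble_eq_powr: "bubble (x::real^'n) = conf_factor x powr (real CARD('n) / 2)"
proof -
  have "bubble x = sqrt (conf_factor x) powr CARD('n)"
    unfolding bubble_def by (subst powr_realpow) (auto simp: conf_factor_pos)
  then show ?thesis using conf_factor_pos[of x]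
    by (simp add: powr_half_sqrt[symmetric] powr_powr)
qed

lemma ln_bubble: "ln (bubble (x::real^'n)) = real CARD('n) / 2 * ln (conf_factor x)"
  using conf_factor_pos[of x] by (simp add: bubble_eq_powr ln_powr)

lemma bubble_sq: "(bubble (x::real^'n))\<^sup>2 = conf_factor x ^ CARD('n)"
proof -
  have "(bubble x)\<^sup>2 = ((sqrt (conf_factor x))\<^sup>2) ^ CARD('n)"
    by (simp only: bubble_def power_mult[symmetric] mult.commute)
  then show ?thesis using conf_factor_pos[of x] by simp
qed

lemma borel_measurable_conf_factor [measurable]: "conf_factor \<in> borel_measurable borel"
  unfolding conf_factor_def by measurable

lemma borel_measurable_bubble [measurable]: "bubble \<in> borel_measurable borel"
  unfolding bubble_def by measurable

lemma cN_pos: "N > 0 \<Longrightarrow> cN N > 0"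
  unfolding cN_def by (intro mult_pos_pos Gamma_real_pos) auto

text \<open>\<open>N * unit_ball_vol N\<close> is the area of the unit sphere in
  \<open>N\<close>-dimensional space. The product 2 cancels the one half in the radial
  integral.\<close>

lemma cN_mult_sphere_area:
  assumes "N > 0"
  shows "cN N * (N * unit_ball_vol N) = 2"
proof -
  have g: "Gamma (real N / 2) > 0" using assms by (intro Gamma_real_pos) auto
  have "Gamma (real N / 2 + 1) = real N / 2 * Gamma (real N / 2)"
    using assms by (intro Gamma_plus1) auto
  then have "cN N * (N * unit_ball_vol N) = pi powr - (N / 2) * pi powr (N / 2) * (Gamma (N / 2) * N / (N / 2 * Gamma (N / 2)))"
    by (simp only: cN_def unit_ball_vol_def) simp
  then show ?thesis using assms g by (simp add: powr_minus)
qed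

text \<open>For this \<open>c\<close> one has \<open>c * (1 + (norm x)^2) = 1\<close>. Expanding the
  square with \<open>k = inversion h\<close> therefore gives \<open>(norm (k + c x))^2 + c^2 = c *
  (1 + (norm (x + h))^2) / (norm h)^2\<close>, and the numerator is \<phi>(x) / \<phi>(x +
  h).\<close>

lemma bubble_inversion:
  fixes x h :: "real^'n"
  assumes h: "h \<noteq> 0"
  defines "c \<equiv> conf_factor x / 2"
  shows "norm (inversion h) ^ CARD('n) / sqrt ((norm (inversion h + c *\<^sub>R x))\<^sup>2 + c\<^sup>2) ^ CARD('n)
    = bubble (x + h) / bubble x"
proof -
  define H where "H = (norm h)\<^sup>2"
  have H: "H > 0" using h by (simp add: H_def)
  have c: "c > 0" "c * (1 + (norm x)\<^sup>2) = 1"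
    using conf_factor_pos[of x] norm_sq_pos[of x] by (auto simp: c_def conf_factor_def)
  have n: "norm (inversion h) = 1 / norm h"
    using h by (simp add: inversion_def power2_eq_square)
  have "(norm (inversion h + c *\<^sub>R x))\<^sup>2 + c\<^sup>2
    = (1 / H)\<^sup>2 * H + 2 * c * (1 / H) * (x \<bullet> h) + c\<^sup>2 * (1 + (norm x)\<^sup>2)"
    unfolding inversion_def H_def power2_norm_eq_inner
    by (simp add: inner_add_left inner_add_right inner_commute power2_eq_square algebra_simps)
  also have "\<dots> = (1 + 2 * c * (x \<bullet> h) + c * H) / H"
    using H c by (simp add: field_simps power2_eq_square)
  also have "1 + 2 * c * (x \<bullet> h) + c * H = c * (1 + (norm x)\<^sup>2) + 2 * c * (x \<bullet> h) + c * H"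
    by (simp only: c(2))
  also have "\<dots> = c * (1 + (norm (x + h))\<^sup>2)"
    unfolding H_def power2_norm_eq_inner by (simp add: inner_add_left inner_add_right inner_commute algebra_simps)
  also have "\<dots> = conf_factor x / conf_factor (x + h)"
    using norm_sq_pos[of "x + h"] by (simp add: c_def conf_factor_def[of "x + h"])
  finally have "sqrt ((norm (inversion h + c *\<^sub>R x))\<^sup>2 + c\<^sup>2) = sqrt (conf_factor x) / sqrt (conf_factor (x + h)) / norm h"
    by (simp add: real_sqrt_divide real_sqrt_mult H_def)
  then show ?thesis
    using h conf_factor_pos[of x] conf_factor_pos[of "x + h"] by (simp add: n bubble_def power_divide power_mult_distrib)
qed

text \<open>This is \<open>L\<^sub>\<Delta> b = (A\<^sub>N + 2 ln \<phi>) b\<close> for the standard bubble \<open>b = \<phi>\<^sup>N\<^sup>/\<^sup>2\<close>.\<close>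

lemma has_bochner_integral_bubble_kernel:
  fixes x :: "real^'n"
  shows "has_bochner_integral lborel
    (\<lambda>y. (bubble y / bubble x - indicator (ball x 1) y) / norm (x - y) ^ CARD('n))
    ((rhoN CARD('n) - AN CARD('n) - 2 * ln (conf_factor x)) / cN CARD('n))"
proof -
  let ?n = "CARD('n)"
  define c where "c = conf_factor x / 2"
  define a where "a = c *\<^sub>R x"
  have c: "c > 0" using conf_factor_pos[of x] by (simp add: c_def)
  let ?V = "?n * unit_ball_vol ?n * (- (Digamma (real ?n / 2) + euler_mascheroni) / 2 - ln c)"
  let ?g = "\<lambda>r. 1 / sqrt (r\<^sup>2 + c\<^sup>2) ^ ?n - indicator {1<..} r / r ^ ?n"
  have "has_bochner_integral lborel (\<lambda>r. r ^ (?n - 1) * indicator {0..} r * ?g r)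
    (- (Digamma (real ?n / 2) + euler_mascheroni) / 2 - ln c)"
    by (rule has_bochner_integral_bubble_radial[OF _ c]) (simp add: Suc_leI)
  then have "has_bochner_integral lborel (\<lambda>k::real^'n. ?g (norm k)) ?V"
    using integrable_radial_iff[of ?g, where 'a="real^'n"] integral_radial[of ?g, where 'a="real^'n"]
    by (simp add: has_bochner_integral_iff)
  from has_bochner_integral_add[OF has_bochner_integral_bubble_shift[OF c, of a] this]
  have B: "has_bochner_integral lborel
     (\<lambda>k. 1 / sqrt ((norm (k + a))\<^sup>2 + c\<^sup>2) ^ ?n - indicator {1<..} (norm k) / norm k ^ ?n) ?V"
    by simp
  \<comment> \<open>The inversion-invariant weight \<open>1 / norm k ^ N\<close> is split off. Under
    inversion the set \<open>norm k > 1\<close> becomes the unit ball without its centre, which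
    accounts for the indicator in the claim.\<close>
  define F where "F k = norm k ^ ?n / sqrt ((norm (k + a))\<^sup>2 + c\<^sup>2) ^ ?n - indicator {1<..} (norm k)" for k
  have [measurable]: "F \<in> borel_measurable borel" unfolding F_def by measurable
  have "AE k in lborel. 1 / sqrt ((norm (k + a))\<^sup>2 + c\<^sup>2) ^ ?n - indicator {1<..} (norm k) / norm k ^ ?n = F k / norm k ^ ?n"
    using AE_lborel_singleton[of 0] by eventually_elim (simp add: F_def diff_divide_distrib)
  then have "has_bochner_integral lborel (\<lambda>k. F k / norm k ^ ?n) ?V"
    using B by (subst (asm) has_bochner_integral_cong_AE) auto
  then have "has_bochner_integral lborel (\<lambda>h. F (inversion h) / norm h ^ ?n) ?V"
    using integrable_inversion_iff[of F] integral_inversion[of F] by (simp add: has_bochner_integral_iff)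
  moreover have "AE h in lborel. F (inversion h) / norm h ^ ?n = (bubble (x + h) / bubble x - indicator (ball 0 1) h) / norm h ^ ?n"
    using AE_lborel_singleton[of 0]
  proof eventually_elim
    case (elim h)
    have "norm (inversion h) = 1 / norm h" using elim by (simp add: inversion_def power2_eq_square)
    then have "1 < norm (inversion h) \<longleftrightarrow> norm h < 1" using elim by simp
    then have "indicator {1<..} (norm (inversion h)) = (indicator (ball 0 1) h :: real)"
      by (simp add: indicator_def)
    then show ?case
      using bubble_inversion[OF elim, of x] by (simp add: F_def a_def c_def)
  qed
  moreover have [measurable]: "ball 0 1 \<in> sets (borel :: (real^'n) measure)" by simp
  have "(\<lambda>h. (bubble (x + h) / bubble x - indicator (ball 0 1) h) / norm h ^ ?n) \<in> borel_measurable borel"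
    by measurable
  moreover have "(\<lambda>h. F (inversion h) / norm h ^ ?n) \<in> borel_measurable borel"
    by measurable
  ultimately have C: "has_bochner_integral lborel (\<lambda>h. (bubble (x + h) / bubble x - indicator (ball 0 1) h) / norm h ^ ?n) ?V"
    by (subst (asm) has_bochner_integral_cong_AE) simp_all
  define G where "G y = (bubble y / bubble x - indicator (ball x 1) y) / norm (x - y) ^ ?n" for y
  have [measurable]: "ball x 1 \<in> sets (borel :: (real^'n) measure)" by simp
  have [measurable]: "G \<in> borel_measurable borel" unfolding G_def by measurable
  have "G (x + 1 *\<^sub>R h) = (bubble (x + h) / bubble x - indicator (ball 0 1) h) / norm h ^ ?n" for h
    by (auto simp: G_def indicator_def dist_norm)
  then have "has_bochner_integral lborel G ?V"
    using C integrable_lborel_affine_iff[of G 1 x] integral_lborel_affine[of G 1 x]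
    by (simp add: has_bochner_integral_iff)
  \<comment> \<open>Here rho_N - A_N = 2 ln 2 - \<psi>(N/2) - \<gamma>, and the 2 ln 2 comes from
    the one half in \<open>c\<close>.\<close>
  moreover have "?V = (rhoN ?n - AN ?n - 2 * ln (conf_factor x)) / cN ?n"
  proof -
    have p: "cN ?n > 0" by (rule cN_pos) simp
    have "ln c = ln (conf_factor x) - ln 2" using conf_factor_pos[of x] by (simp add: c_def ln_div)
    then have "rhoN ?n - AN ?n - 2 * ln (conf_factor x) = 2 * (- (Digamma (real ?n / 2) + euler_mascheroni) / 2 - ln c)"
      by (simp add: rhoN_def AN_def)
    also have "\<dots> = cN ?n * ?V"
      by (subst cN_mult_sphere_area[of ?n, symmetric]) simp_all
    finally show ?thesis using p by simp
  qed
  ultimately show ?thesis unfolding G_def by simp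
qed

text \<open>A Lipschitz bound uniform in \<open>x\<close>: the quotient
  \<open>(norm x + norm y) / (1 + (norm y)^2)\<close> stays bounded because
  \<open>norm x \<le> norm y + 1\<close> and \<open>2 * norm y \<le> 1 + (norm y)^2\<close>.\<close>

lemma conf_factor_diff_le:
  assumes "norm (x - y) \<le> 1"
  shows "\<bar>conf_factor y / conf_factor x - 1\<bar> \<le> 3 * norm (x - y)"
proof -
  have py: "1 + (norm y)\<^sup>2 > 0" and px: "1 + (norm x)\<^sup>2 > 0" by (rule norm_sq_pos)+
  have "conf_factor y / conf_factor x - 1 = ((norm x)\<^sup>2 - (norm y)\<^sup>2) / (1 + (norm y)\<^sup>2)"
    using py px by (simp add: conf_factor_def field_simps)
  also have "\<bar>\<dots>\<bar> = \<bar>norm x - norm y\<bar> * (norm x + norm y) / (1 + (norm y)\<^sup>2)"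
  proof -
    have "(norm x)\<^sup>2 - (norm y)\<^sup>2 = (norm x - norm y) * (norm x + norm y)"
      by (simp add: power2_eq_square algebra_simps)
    then show ?thesis using py by (simp add: abs_mult)
  qed
  also have "\<dots> \<le> norm (x - y) * (norm x + norm y) / (1 + (norm y)\<^sup>2)"
    using py by (intro divide_right_mono mult_right_mono norm_triangle_ineq3) auto
  also have "\<dots> = norm (x - y) * ((norm x + norm y) / (1 + (norm y)\<^sup>2))" by simp
  also have "\<dots> \<le> norm (x - y) * 3"
  proof (intro mult_left_mono)
    have "norm x \<le> norm y + 1" using assms norm_triangle_sub[of x y] by simp
    moreover have "2 * norm y \<le> 1 + (norm y)\<^sup>2"
      using zero_le_power2[of "norm y - 1"] by (simp add: power2_eq_square algebra_simps)
    ultimately have "norm x + norm y \<le> 3 * (1 + (norm y)\<^sup>2)" by (smt (verit) zero_le_power2)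
    then show "(norm x + norm y) / (1 + (norm y)\<^sup>2) \<le> 3" using py by (simp add: divide_simps)
  qed simp
  finally show ?thesis by (simp add: mult.commute)
qed

text \<open>Uniformity in \<open>x\<close> is the point: near the diagonal
  \<open>bubble_kernel\<close> is then of order \<open>norm (x - y) ^ (1 - N)\<close>, whose mass
  over a unit ball does not depend on \<open>x\<close>.\<close>

lemma bubble_diff_le:
  fixes x y :: "real^'n"
  assumes "norm (x - y) \<le> 1"
  shows "\<bar>bubble y / bubble x - 1\<bar> \<le> 3 * real CARD('n) * 2 ^ CARD('n) * norm (x - y)"
proof -
  define q where "q = sqrt (conf_factor y / conf_factor x)"
  have t: "conf_factor y / conf_factor x > 0" by (simp add: conf_factor_pos)
  then have q: "q > 0" "q\<^sup>2 = conf_factor y / conf_factor x" by (auto simp: q_def)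
  have d: "\<bar>q\<^sup>2 - 1\<bar> \<le> 3 * norm (x - y)" unfolding q by (rule conf_factor_diff_le[OF assms])
  then have "q\<^sup>2 \<le> 2\<^sup>2" using assms by simp
  then have q2: "q \<le> 2" by (rule power2_le_imp_le) simp
  have "\<bar>q - 1\<bar> * 1 \<le> \<bar>q - 1\<bar> * (q + 1)"
    using q(1) by (intro mult_left_mono) auto
  also have "\<dots> = \<bar>q\<^sup>2 - 1\<bar>"
  proof -
    have "q\<^sup>2 - 1 = (q - 1) * (q + 1)" by (simp add: power2_eq_square algebra_simps)
    then show ?thesis using q(1) by (simp add: abs_mult)
  qed
  finally have d1: "\<bar>q - 1\<bar> \<le> 3 * norm (x - y)" using d by simp
  have "bubble y / bubble x = q ^ CARD('n)"
    by (simp add: bubble_def q_def power_divide real_sqrt_divide)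
  then have "\<bar>bubble y / bubble x - 1\<bar> = \<bar>q ^ CARD('n) - 1 ^ CARD('n)\<bar>" by simp
  also have "\<dots> \<le> real CARD('n) * 2 ^ (CARD('n) - 1) * \<bar>q - 1\<bar>"
    using q q2 by (intro abs_power_diff_le) auto
  also have "\<dots> \<le> real CARD('n) * 2 ^ CARD('n) * (3 * norm (x - y))"
    using d1 by (intro mult_mono mult_nonneg_nonneg power_increasing) auto
  finally show ?thesis by (simp add: mult_ac)
qed

subsection \<open>The volume of the sphere in stereographic coordinates\<close>

lemma norm_stereo_inv [simp]: "norm (stereo_inv x) = 1"
  using stereo_inv_in_sphere[of x] by simp

lemma stereo_inv_alt: "stereo_inv x = (conf_factor x *\<^sub>R x, conf_factor x - 1)"
proof -
  have "(1 - (norm x)\<^sup>2) / (1 + (norm x)\<^sup>2) = 2 / (1 + (norm x)\<^sup>2) - 1"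
    using norm_sq_pos[of x] by (simp add: divide_simps)
  then show ?thesis by (simp add: stereo_inv_def conf_factor_def)
qed

text \<open>Both image points have norm 1, so only their inner product has to be computed, and
  \<open>(norm x)^2 = 2 / \<phi> x - 1\<close> eliminates the norms.\<close>

lemma norm_stereo_inv_diff:
  "norm (stereo_inv x - stereo_inv y) = sqrt (conf_factor x) * sqrt (conf_factor y) * norm (x - y)"
proof -
  let ?a = "conf_factor x" and ?b = "conf_factor y"
  have pos: "?a > 0" "?b > 0" by (rule conf_factor_pos)+
  have nx: "x \<bullet> x = 2 / ?a - 1" "y \<bullet> y = 2 / ?b - 1"
    by (simp_all add: conf_factor_def power2_norm_eq_inner[symmetric] add_divide_distrib)
  have "(norm (stereo_inv x - stereo_inv y))\<^sup>2 = (norm (stereo_inv x))\<^sup>2 + (norm (stereo_inv y))\<^sup>2 - 2 * (stereo_inv x \<bullet> stereo_inv y)"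
    unfolding power2_norm_eq_inner by (simp add: inner_diff_left inner_diff_right inner_commute)
  also have "\<dots> = 2 - 2 * (?a * ?b * (x \<bullet> y) + (?a - 1) * (?b - 1))"
    unfolding norm_stereo_inv by (simp add: stereo_inv_alt)
  also have "\<dots> = ?a * ?b * ((2 / ?a - 1) + (2 / ?b - 1) - 2 * (x \<bullet> y))"
    using pos by (simp add: field_simps)
  also have "(2 / ?a - 1) + (2 / ?b - 1) - 2 * (x \<bullet> y) = (norm (x - y))\<^sup>2"
    unfolding nx[symmetric] power2_norm_eq_inner by (simp add: inner_diff_left inner_diff_right inner_commute)
  finally have "sqrt ((norm (stereo_inv x - stereo_inv y))\<^sup>2) = sqrt (?a * ?b * (norm (x - y))\<^sup>2)"
    by (rule arg_cong)
  then show ?thesis by (simp add: real_sqrt_mult)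
qed

lemma norm_stereo_inv_diff_power:
  fixes x y :: "real^'n"
  shows "norm (stereo_inv x - stereo_inv y) ^ CARD('n) = bubble x * bubble y * norm (x - y) ^ CARD('n)"
  by (simp add: norm_stereo_inv_diff bubble_def power_mult_distrib)

lemma has_derivative_stereo_inv:
  "(stereo_inv has_derivative
     (\<lambda>h. (conf_factor x *\<^sub>R h - ((conf_factor x)\<^sup>2 * (x \<bullet> h)) *\<^sub>R x, - ((conf_factor x)\<^sup>2 * (x \<bullet> h))))) (at x)"
proof -
  have "((\<lambda>x. 2 / (1 + x \<bullet> x)) has_derivative (\<lambda>h. - ((conf_factor x)\<^sup>2 * (x \<bullet> h)))) (at x)"
    using norm_sq_pos[of x] unfolding conf_factor_def power2_norm_eq_inner
    by (auto intro!: derivative_eq_intros simp: inner_commute power2_eq_square)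
  then have c: "(conf_factor has_derivative (\<lambda>h. - ((conf_factor x)\<^sup>2 * (x \<bullet> h)))) (at x)"
    unfolding conf_factor_def[abs_def] power2_norm_eq_inner by simp
  have "((\<lambda>x. (conf_factor x *\<^sub>R x, conf_factor x - 1)) has_derivative
     (\<lambda>h. (conf_factor x *\<^sub>R h + (- ((conf_factor x)\<^sup>2 * (x \<bullet> h))) *\<^sub>R x, - ((conf_factor x)\<^sup>2 * (x \<bullet> h)) - 0))) (at x)"
    by (intro has_derivative_Pair has_derivative_scaleR has_derivative_diff c has_derivative_ident has_derivative_const)
  then show ?thesis by (simp add: stereo_inv_alt[abs_def])
qed

lemma induced_metric_stereo_inv:
  "induced_metric stereo_inv (x::real^'n) = (conf_factor x)\<^sup>2 *\<^sub>R mat 1"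
proof -
  let ?c = "conf_factor x"
  let ?D = "\<lambda>h. (?c *\<^sub>R h - (?c\<^sup>2 * (x \<bullet> h)) *\<^sub>R x, - (?c\<^sup>2 * (x \<bullet> h)))"
  have D: "frechet_derivative stereo_inv (at x) = ?D"
    by (rule frechet_derivative_at[OF has_derivative_stereo_inv, symmetric])
  have "?D h \<bullet> ?D k = ?c\<^sup>2 * (h \<bullet> k)" for h k :: "real^'n"
  proof -
    have x: "?c * (1 + x \<bullet> x) = 2"
      using norm_sq_pos[of x] by (simp add: conf_factor_def power2_norm_eq_inner field_simps)
    \<comment> \<open>Conformality: the mixed terms carry a factor that vanishes by the definition
      of \<phi>.\<close>
    have "?D h \<bullet> ?D k = ?c\<^sup>2 * (h \<bullet> k) + ?c ^ 3 * (x \<bullet> h) * (x \<bullet> k) * (?c * (1 + x \<bullet> x) - 2)"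
      by (simp add: inner_diff_left inner_diff_right inner_commute power2_eq_square power3_eq_cube algebra_simps)
    then show ?thesis unfolding x by simp
  qed
  then show ?thesis
    unfolding induced_metric_def D by (simp add: vec_eq_iff inner_axis_axis mat_def)
qed

lemma sqrt_det_induced_metric:
  "sqrt (det (induced_metric stereo_inv (x::real^'n))) = (bubble x)\<^sup>2"
proof -
  have "det (induced_metric stereo_inv x) = (\<Prod>i\<in>(UNIV::'n set). (conf_factor x)\<^sup>2)"
    unfolding induced_metric_stereo_inv by (subst det_diagonal) (auto simp: mat_def)
  also have "\<dots> = (conf_factor x ^ CARD('n))\<^sup>2" by (simp add: power_mult[symmetric] mult.commute)
  finally show ?thesis using conf_factor_pos[of x] by (simp add: bubble_sq)
qed

lemma borel_measurable_stereo: "stereo \<in> borel_measurable borel"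
proof -
  have [measurable]: "fst \<in> borel_measurable (borel :: ((real^'n) \<times> real) measure)"
    "snd \<in> borel_measurable (borel :: ((real^'n) \<times> real) measure)"
    by (auto intro!: borel_measurable_continuous_onI continuous_intros)
  show ?thesis unfolding stereo_def[abs_def] by measurable
qed

lemma borel_measurable_stereo_inv: "stereo_inv \<in> borel_measurable borel"
  unfolding stereo_inv_def[abs_def] by measurable

lemma measurable_stereo_inv_restrict:
  "stereo_inv \<in> borel \<rightarrow>\<^sub>M restrict_space borel (sphere 0 1)"
  using borel_measurable_stereo_inv by (intro measurable_restrict_space2) auto

section \<open>Transfer of measurability and integrals through the chart\<close>

abbreviation chart_vol :: "(real^'n) measure" where
  "chart_vol \<equiv> density lborel (\<lambda>x. ennreal ((bubble x)\<^sup>2))"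

lemma sphere_vol_alt:
  "sphere_vol = completion (distr chart_vol (restrict_space borel (sphere 0 1)) stereo_inv)"
  unfolding sphere_vol_def sqrt_det_induced_metric ..

lemma space_sphere_vol [simp]: "space sphere_vol = sphere 0 1"
  by (simp add: sphere_vol_def space_restrict_space)

text \<open>A density without zeros has the same null sets as Lebesgue measure, so completing and
  taking the density commute.\<close>

lemma completion_chart_vol:
  "completion chart_vol = density lebesgue (\<lambda>x. ennreal ((bubble x)\<^sup>2))"
  by (rule completion_density_eq) (auto simp: bubble_pos[THEN less_imp_neq, THEN not_sym])

text \<open>The definition completes the image of a Borel measure, while change of variables with
  Lebesgue measurable functions calls for the image of a completed measure. The two agree:
  completing the source does not change the image on Borel sets, and null sets of the image pull
  back to null sets.\<close>

lemma
  shows measurable_stereo_inv: "stereo_inv \<in> lebesgue \<rightarrow>\<^sub>M sphere_vol"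
    and sphere_vol_eq_distr: "distr (density lebesgue (\<lambda>x. ennreal ((bubble x)\<^sup>2))) sphere_vol stereo_inv = sphere_vol"
proof -
  let ?L = "density lebesgue (\<lambda>x::real^'n. ennreal ((bubble x)\<^sup>2))"
  let ?R = "restrict_space borel (sphere (0::(real^'n) \<times> real) 1)"
  let ?N = "distr ?L ?R stereo_inv"
  interpret L: complete_measure ?L
    unfolding completion_chart_vol[symmetric] by (rule completion.complete_measure_axioms)
  have meas: "stereo_inv \<in> ?L \<rightarrow>\<^sub>M ?N"
    using measurable_completion[of stereo_inv "lborel :: (real^'n) measure" ?R] measurable_stereo_inv_restrict
    by (simp add: measurable_def)
  have N: "sphere_vol = completion ?N"
    unfolding sphere_vol_alt completion_chart_vol[symmetric]
    using measurable_stereo_inv_restrict by (subst distr_completion) auto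
  have D: "distr ?L ?N stereo_inv = ?N"
    by (rule distr_cong) auto
  have "stereo_inv \<in> ?L \<rightarrow>\<^sub>M completion ?N"
    by (rule L.measurable_completion2[OF meas]) (simp add: D)
  then show "stereo_inv \<in> lebesgue \<rightarrow>\<^sub>M sphere_vol" unfolding N by (simp add: measurable_def)
  have "completion (distr ?L ?N stereo_inv) = distr ?L (completion ?N) stereo_inv"
    by (rule L.completion_distr_eq[OF meas]) (simp add: D)
  then show "distr ?L sphere_vol stereo_inv = sphere_vol" unfolding N D by (rule sym)
qed

text \<open>A Lebesgue set differs from a Borel set by a subset of a Borel null set. Both Borel sets
  are carried back to the sphere by \<open>stereo\<close>, which is Borel measurable.\<close>

lemma sets_sphere_vol_vimageI:
  assumes A: "A \<subseteq> sphere 0 1" and v: "stereo_inv -` A \<in> sets lebesgue"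
  shows "A \<in> sets sphere_vol"
proof -
  let ?R = "restrict_space borel (sphere (0::(real^'n) \<times> real) 1)"
  let ?D = "distr chart_vol ?R stereo_inv"
  obtain S N N' where S: "stereo_inv -` A = S \<union> N" "N \<subseteq> N'" "N' \<in> null_sets lborel" "S \<in> sets lborel"
    using v by (elim sets_completionE)
  let ?P = "sphere (0::(real^'n) \<times> real) 1 - {(0, -1)}"
  have P: "?P \<in> sets borel" by (intro sets.Diff) auto
  have sub: "X \<in> sets ?R" if "X \<in> sets borel" "X \<subseteq> sphere 0 1" for X
    using that by (auto simp: sets_restrict_space)
  have pre: "stereo -` X \<inter> ?P \<in> sets borel" if "X \<in> sets borel" for X
    using measurable_sets_borel[OF borel_measurable_stereo that] P by auto
  define S1 where "S1 = stereo -` S \<inter> ?P"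
  \<comment> \<open>The hypothesis says nothing about the south pole, which the chart never reaches.
    Adding it to the null set costs nothing, since its preimage is empty.\<close>
  define N1 where "N1 = insert (0, -1) (stereo -` N' \<inter> ?P)"
  have S1: "S1 \<in> sets ?R" unfolding S1_def using S by (intro sub pre) auto
  have "N1 \<in> sets borel" unfolding N1_def using S(3) pre[of N'] by auto
  then have N1: "N1 \<in> sets ?R" by (rule sub) (auto simp: N1_def)
  have "stereo_inv -` N1 = N'"
  proof (rule set_eqI)
    fix x show "x \<in> stereo_inv -` N1 \<longleftrightarrow> x \<in> N'"
      using stereo_inv_in_sphere[of x] unfolding N1_def vimage_eq insert_iff Int_iff stereo_stereo_inv by blast
  qed
  moreover have "N' \<in> null_sets chart_vol"
    using S(3) AE_not_in[OF S(3)] by (auto simp: null_sets_density_iff)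
  ultimately have "N1 \<in> null_sets ?D"
    using N1 measurable_stereo_inv_restrict by (subst null_sets_distr_iff) (simp_all add: measurable_def)
  moreover have "A = S1 \<union> (A - S1)"
  proof -
    have "S1 \<subseteq> A"
      using S(1) stereo_inv_stereo unfolding S1_def by (metis (no_types, lifting) IntE UnI1 subsetI vimageE vimageI)
    then show ?thesis by auto
  qed
  moreover have "A - S1 \<subseteq> N1"
  proof
    fix z assume z: "z \<in> A - S1"
    show "z \<in> N1"
    proof (cases "z = (0, -1)")
      case False
      then have "z \<in> ?P" using z A by auto
      then have "stereo z \<in> S \<union> N" using z S(1) stereo_inv_stereo[of z] by auto
      then show ?thesis using z \<open>z \<in> ?P\<close> S(2) by (auto simp: S1_def N1_def)
    qed (simp add: N1_def)
  qed
  ultimately show ?thesis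
    unfolding sphere_vol_alt using S1 by (intro sets_completionI[of A S1 "A - S1" N1 ?D]) auto
qed

lemma measurable_sphere_vol_iff:
  "u \<in> borel_measurable sphere_vol \<longleftrightarrow> (\<lambda>x. u (stereo_inv x)) \<in> borel_measurable lebesgue"
proof
  assume "u \<in> borel_measurable sphere_vol"
  then show "(\<lambda>x. u (stereo_inv x)) \<in> borel_measurable lebesgue"
    by (rule measurable_compose[OF measurable_stereo_inv])
next
  assume u: "(\<lambda>x. u (stereo_inv x)) \<in> borel_measurable lebesgue"
  show "u \<in> borel_measurable sphere_vol"
  proof (rule measurableI)
    fix B :: "'b set" assume "B \<in> sets borel"
    from measurable_sets[OF u this]
    have "stereo_inv -` (u -` B \<inter> sphere 0 1) \<in> sets lebesgue"
      by (simp add: vimage_def)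
    then show "u -` B \<inter> space sphere_vol \<in> sets sphere_vol"
      unfolding space_sphere_vol by (rule sets_sphere_vol_vimageI[rotated]) auto
  qed simp
qed

context
begin

private lemma measurable_stereo_inv_density:
  "stereo_inv \<in> density lebesgue (\<lambda>x. ennreal ((bubble x)\<^sup>2)) \<rightarrow>\<^sub>M sphere_vol"
  using measurable_stereo_inv by (simp add: measurable_def)

private lemma measurable_bubble_sq: "(\<lambda>x. (bubble x)\<^sup>2) \<in> borel_measurable lebesgue"
  by (intro measurable_completion) simp

lemma nn_integral_sphere_vol:
  assumes f: "f \<in> borel_measurable sphere_vol"
  shows "(\<integral>\<^sup>+z. f z \<partial>sphere_vol) = (\<integral>\<^sup>+x. ennreal ((bubble x)\<^sup>2) * f (stereo_inv x) \<partial>lebesgue)"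
proof -
  have "(\<integral>\<^sup>+z. f z \<partial>sphere_vol) = (\<integral>\<^sup>+x. f (stereo_inv x) \<partial>density lebesgue (\<lambda>x. ennreal ((bubble x)\<^sup>2)))"
    using nn_integral_distr[OF measurable_stereo_inv_density, of f] f by (simp add: sphere_vol_eq_distr)
  then show ?thesis
    using nn_integral_density[OF measurable_compose[OF measurable_bubble_sq measurable_ennreal] measurable_compose[OF measurable_stereo_inv f]]
    by simp
qed

lemma
  fixes f :: "_ \<Rightarrow> real"
  assumes f: "f \<in> borel_measurable sphere_vol"
  shows integrable_sphere_vol_iff: "integrable sphere_vol f \<longleftrightarrow> integrable lebesgue (\<lambda>x. (bubble x)\<^sup>2 * f (stereo_inv x))"
    and integral_sphere_vol: "(\<integral>z. f z \<partial>sphere_vol) = (\<integral>x. (bubble x)\<^sup>2 * f (stereo_inv x) \<partial>lebesgue)"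
proof -
  note m = measurable_compose[OF measurable_stereo_inv f] measurable_bubble_sq
  have nn: "AE x in lebesgue. 0 \<le> (bubble x)\<^sup>2" by simp
  have "integrable sphere_vol f \<longleftrightarrow> integrable (density lebesgue (\<lambda>x. ennreal ((bubble x)\<^sup>2))) (\<lambda>x. f (stereo_inv x))"
    using integrable_distr_eq[OF measurable_stereo_inv_density, of f] f by (simp add: sphere_vol_eq_distr)
  then show "integrable sphere_vol f \<longleftrightarrow> integrable lebesgue (\<lambda>x. (bubble x)\<^sup>2 * f (stereo_inv x))"
    using integrable_density[OF m nn] by simp
  have "(\<integral>z. f z \<partial>sphere_vol) = (\<integral>x. f (stereo_inv x) \<partial>density lebesgue (\<lambda>x. ennreal ((bubble x)\<^sup>2)))"
    using integral_distr[OF measurable_stereo_inv_density, of f] f by (simp add: sphere_vol_eq_distr)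
  then show "(\<integral>z. f z \<partial>sphere_vol) = (\<integral>x. (bubble x)\<^sup>2 * f (stereo_inv x) \<partial>lebesgue)"
    using integral_density[OF m nn] by simp
qed

end

subsection \<open>Kernel estimates\<close>

lemma nn_integral_radial_near:
  "(\<integral>\<^sup>+y. ennreal (indicator (ball (x::'a::euclidean_space) 1) y * norm (x - y) / norm (x - y) ^ DIM('a)) \<partial>lborel)
     \<le> ennreal (DIM('a) * unit_ball_vol DIM('a))"
proof -
  let ?n = "DIM('a)" and ?c = "DIM('a) * unit_ball_vol DIM('a)"
  define g where "g r = indicator {..<1} r * r / r ^ ?n" for r :: real
  have [measurable]: "g \<in> borel_measurable borel" unfolding g_def by measurable
  have "(\<integral>\<^sup>+y. ennreal (indicator (ball x 1) y * norm (x - y) / norm (x - y) ^ ?n) \<partial>lborel) = (\<integral>\<^sup>+y. ennreal (g (norm (x - y))) \<partial>lborel)"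
    by (intro nn_integral_cong) (auto simp: g_def indicator_def dist_norm)
  also have "\<dots> = (\<integral>\<^sup>+h. ennreal (g (norm (h::'a))) \<partial>lborel)"
    by (subst nn_integral_lborel_affine[of _ 1 x]) simp_all
  also have "\<dots> = (\<integral>\<^sup>+r. ennreal (?c * r ^ (?n - 1)) * indicator {0..} r * ennreal (g r) \<partial>lborel)"
    by (rule nn_integral_radial) measurable
  also have "\<dots> \<le> (\<integral>\<^sup>+r. ennreal ?c * indicator {0..1::real} r \<partial>lborel)"
  proof (rule nn_integral_mono)
    fix r :: real
    show "ennreal (?c * r ^ (?n - 1)) * indicator {0..} r * ennreal (g r) \<le> ennreal ?c * indicator {0..1} r"
    proof (cases "0 < r \<and> r < 1")
      case True
      have "r ^ ?n = r ^ (?n - 1) * r" by (rule power_minus_mult[OF DIM_positive, symmetric])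
      then have "?c * r ^ (?n - 1) * g r = ?c" using True by (simp add: g_def)
      then show ?thesis using True
        by (simp add: ennreal_mult''[symmetric] g_def)
    qed (auto simp: g_def indicator_def)
  qed
  also have "\<dots> = ennreal ?c" by (simp add: nn_integral_cmult)
  finally show ?thesis .
qed

lemma nn_integral_radial_far:
  assumes R: "R > 0"
  shows "(\<integral>\<^sup>+x. ennreal (indicator {R..} (norm (x::'a::euclidean_space)) / norm x ^ (2 * DIM('a))) \<partial>lborel)
     = ennreal (unit_ball_vol DIM('a) / R ^ DIM('a))"
proof -
  let ?n = "DIM('a)" and ?c = "DIM('a) * unit_ball_vol DIM('a)"
  have n: "r ^ ?n = r ^ (?n - 1) * r" for r :: real by (rule power_minus_mult[OF DIM_positive, symmetric])
  have "(\<integral>\<^sup>+x. ennreal (indicator {R..} (norm (x::'a)) / norm x ^ (2 * ?n)) \<partial>lborel)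
    = (\<integral>\<^sup>+r. ennreal (?c * r ^ (?n - 1)) * indicator {0..} r * ennreal (indicator {R..} r / r ^ (2 * ?n)) \<partial>lborel)"
    by (rule nn_integral_radial) measurable
  also have "\<dots> = (\<integral>\<^sup>+r. ennreal (?c / r ^ (?n + 1)) * indicator {R..} r \<partial>lborel)"
  proof (rule nn_integral_cong)
    fix r :: real
    show "ennreal (?c * r ^ (?n - 1)) * indicator {0..} r * ennreal (indicator {R..} r / r ^ (2 * ?n)) = ennreal (?c / r ^ (?n + 1)) * indicator {R..} r"
    proof (cases "r \<ge> R")
      case True
      then have r: "r > 0" using R by simp
      have "r ^ (2 * ?n) = r ^ (?n - 1) * r ^ (?n + 1)"
        by (simp add: mult_2 power_add) (simp add: n[of r] mult_ac)
      then have "?c * r ^ (?n - 1) * (1 / r ^ (2 * ?n)) = ?c / r ^ (?n + 1)" using r by simp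
      then show ?thesis using True r by (simp add: ennreal_mult''[symmetric])
    qed (use R in \<open>auto simp: indicator_def\<close>)
  qed
  also have "\<dots> = ennreal (0 - (- (unit_ball_vol ?n / R ^ ?n)))"
  proof (rule nn_integral_FTC_atLeast)
    show "DERIV (\<lambda>r. - (unit_ball_vol ?n / r ^ ?n)) r :> ?c / r ^ (?n + 1)" if "R \<le> r" for r
    proof -
      have r: "r > 0" using R that by simp
      have "DERIV (\<lambda>r. - (unit_ball_vol ?n / r ^ ?n)) r :> - (- (unit_ball_vol ?n * (?n * r ^ (?n - 1))) / (r ^ ?n * r ^ ?n))"
        using r by (auto intro!: derivative_eq_intros)
      moreover have "- (- (unit_ball_vol ?n * (?n * r ^ (?n - 1))) / (r ^ ?n * r ^ ?n)) = ?c / r ^ (?n + 1)"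
        using r by (simp add: n[of r])
      ultimately show ?thesis by simp
    qed
    show "((\<lambda>r. - (unit_ball_vol ?n / r ^ ?n)) \<longlongrightarrow> 0) at_top"
      using tendsto_minus[OF tendsto_divide_0[OF tendsto_const[of "unit_ball_vol ?n"] filterlim_at_top_imp_at_infinity[OF filterlim_pow_at_top[OF DIM_positive[where 'a='a] filterlim_ident]]]]
      by simp
  qed (use R in auto)
  finally show ?thesis by simp
qed

lemma nn_integral_radial_log:
  assumes S: "S \<ge> 1"
  shows "(\<integral>\<^sup>+x. ennreal (indicator {1..S} (norm (x::'a::euclidean_space)) / norm x ^ DIM('a)) \<partial>lborel)
     = ennreal (DIM('a) * unit_ball_vol DIM('a) * ln S)"
proof -
  let ?n = "DIM('a)" and ?c = "DIM('a) * unit_ball_vol DIM('a)"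
  have n: "r ^ ?n = r ^ (?n - 1) * r" for r :: real by (rule power_minus_mult[OF DIM_positive, symmetric])
  have "(\<integral>\<^sup>+x. ennreal (indicator {1..S} (norm (x::'a)) / norm x ^ ?n) \<partial>lborel)
    = (\<integral>\<^sup>+r. ennreal (?c * r ^ (?n - 1)) * indicator {0..} r * ennreal (indicator {1..S} r / r ^ ?n) \<partial>lborel)"
    by (rule nn_integral_radial) measurable
  also have "\<dots> = (\<integral>\<^sup>+r. ennreal (?c / r) * indicator {1..S} r \<partial>lborel)"
  proof (rule nn_integral_cong)
    fix r :: real
    show "ennreal (?c * r ^ (?n - 1)) * indicator {0..} r * ennreal (indicator {1..S} r / r ^ ?n) = ennreal (?c / r) * indicator {1..S} r"
    proof (cases "r \<in> {1..S}")
      case True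
      then have "?c * r ^ (?n - 1) * (1 / r ^ ?n) = ?c / r" by (simp add: n[of r])
      then show ?thesis using True by (simp add: ennreal_mult''[symmetric])
    qed (auto simp: indicator_def)
  qed
  also have "\<dots> = ennreal (?c * ln S - ?c * ln 1)"
    using S by (intro nn_integral_FTC_Icc) (auto intro!: derivative_eq_intros)
  finally show ?thesis by simp
qed

text \<open>The integrand of \<open>K x\<close> without the factor c_N.\<close>

definition bubble_kernel :: "real^'n \<Rightarrow> real^'n \<Rightarrow> real" where
  "bubble_kernel x y = (bubble y / bubble x - indicator (ball x 1) y) / norm (x - y) ^ CARD('n)"

definition log_weight :: "real^'n \<Rightarrow> real" where
  "log_weight x = ln (exp 1 + (norm x)\<^sup>2)"

lemma log_weight_ge_1: "log_weight x \<ge> 1"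
proof -
  have "ln (exp 1) \<le> log_weight x" unfolding log_weight_def
    by (subst ln_le_cancel_iff) (auto simp: add_pos_nonneg)
  then show ?thesis by simp
qed

lemma abs_ln_conf_factor_le: "\<bar>ln (conf_factor x)\<bar> \<le> log_weight x"
proof -
  have "ln (conf_factor x) \<le> ln 2"
    using conf_factor_le[of x] conf_factor_pos[of x] by (subst ln_le_cancel_iff) auto
  also have "\<dots> \<le> 1" using ln_2_less_1 by simp
  finally have 1: "ln (conf_factor x) \<le> log_weight x" using log_weight_ge_1[of x] by simp
  have "- ln (conf_factor x) = ln ((1 + (norm x)\<^sup>2) / 2)"
    using norm_sq_pos[of x] by (simp add: conf_factor_def ln_div)
  also have "\<dots> \<le> log_weight x"
  proof -
    have "(1 + (norm x)\<^sup>2) / 2 \<le> 1 + (norm x)\<^sup>2" using norm_sq_pos[of x] by simp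
    also have "\<dots> \<le> exp 1 + (norm x)\<^sup>2" by simp
    finally show ?thesis
      unfolding log_weight_def using norm_sq_pos[of x] by (intro ln_mono) (auto simp: add_pos_nonneg)
  qed
  finally show ?thesis using 1 by simp
qed

lemma integrable_bubble_kernel: "integrable lborel (bubble_kernel x)"
  and integral_bubble_kernel: "(\<integral>y. bubble_kernel (x::real^'n) y \<partial>lborel) =
    (rhoN CARD('n) - AN CARD('n) - 2 * ln (conf_factor x)) / cN CARD('n)"
  using has_bochner_integral_bubble_kernel[of x]
  unfolding bubble_kernel_def[symmetric] has_bochner_integral_iff by auto

text \<open>The signed integral is known exactly and is logarithmic in \<open>x\<close>. The kernel
  can be negative only inside the unit ball, where \<open>bubble_diff_le\<close> bounds it, so the
  absolute integral exceeds the signed one by at most a constant.\<close>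

lemma nn_integral_abs_bubble_kernel:
  "\<exists>C\<ge>0. \<forall>x::real^'n. (\<integral>\<^sup>+y. ennreal \<bar>bubble_kernel x y\<bar> \<partial>lborel) \<le> ennreal (C * log_weight x)"
proof -
  let ?N = "CARD('n)"
  \<comment> \<open>\<open>A\<close> is the constant of \<open>bubble_diff_le\<close> and
    \<open>B\<close> the area of the unit sphere; \<open>C\<close> adds the signed integral and
    twice the near part.\<close>
  define A where "A = 3 * real ?N * 2 ^ ?N"
  define B where "B = ?N * unit_ball_vol ?N"
  define C where "C = (\<bar>rhoN ?N - AN ?N\<bar> + 2) / cN ?N + 2 * A * B"
  have cN: "cN ?N > 0" by (rule cN_pos) simp
  have A: "A \<ge> 0" and B: "B \<ge> 0" by (simp_all add: A_def B_def)
  have C: "C \<ge> 0" unfolding C_def using cN A B by simp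
  have "(\<integral>\<^sup>+y. ennreal \<bar>bubble_kernel x y\<bar> \<partial>lborel) \<le> ennreal (C * log_weight x)" for x :: "real^'n"
  proof -
    let ?m = "\<lambda>y. indicator (ball x 1) y * norm (x - y) / norm (x - y) ^ ?N"
    have [measurable]: "ball x 1 \<in> sets (borel :: (real^'n) measure)" by simp
    have near: "(\<integral>\<^sup>+y. ennreal (?m y) \<partial>lborel) \<le> ennreal B"
      using nn_integral_radial_near[of x] by (simp add: B_def)
    have m_int: "integrable lborel ?m"
      using near by (intro integrableI_nonneg) (measurable, auto simp: less_top[symmetric] top_unique)
    have "(\<integral>\<^sup>+y. ennreal (?m y) \<partial>lborel) = ennreal (\<integral>y. ?m y \<partial>lborel)"
      by (intro nn_integral_eq_integral m_int) auto
    with near B have m_le: "(\<integral>y. ?m y \<partial>lborel) \<le> B" by simp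
    have le: "\<bar>bubble_kernel x y\<bar> \<le> bubble_kernel x y + 2 * A * ?m y" for y
    proof (cases "norm (x - y) < 1")
      case True
      then have "\<bar>bubble_kernel x y\<bar> = \<bar>bubble y / bubble x - 1\<bar> / norm (x - y) ^ ?N"
        by (simp add: bubble_kernel_def dist_norm abs_divide)
      also have "\<dots> \<le> (A * norm (x - y)) / norm (x - y) ^ ?N"
        using bubble_diff_le[of x y] True by (intro divide_right_mono) (auto simp: A_def)
      also have "\<dots> = A * ?m y" using True by (simp add: dist_norm)
      finally show ?thesis by linarith
    next
      case False
      then have "bubble_kernel x y \<ge> 0"
        using bubble_pos[of x] bubble_pos[of y] by (simp add: bubble_kernel_def dist_norm)
      then show ?thesis using A by simp
    qed
    have "(\<integral>\<^sup>+y. ennreal \<bar>bubble_kernel x y\<bar> \<partial>lborel) \<le> (\<integral>\<^sup>+y. ennreal (bubble_kernel x y + 2 * A * ?m y) \<partial>lborel)"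
      using le by (intro nn_integral_mono ennreal_leI)
    also have "\<dots> = ennreal (\<integral>y. bubble_kernel x y + 2 * A * ?m y \<partial>lborel)"
      using le by (intro nn_integral_eq_integral Bochner_Integration.integrable_add integrable_mult_right integrable_bubble_kernel m_int)
        (auto intro: order_trans[OF abs_ge_zero])
    also have "(\<integral>y. bubble_kernel x y + 2 * A * ?m y \<partial>lborel) = (\<integral>y. bubble_kernel x y \<partial>lborel) + 2 * A * (\<integral>y. ?m y \<partial>lborel)"
      by (subst integral_mult_right_zero[symmetric], rule Bochner_Integration.integral_add)
        (intro integrable_bubble_kernel integrable_mult_right m_int)+
    also have "\<dots> \<le> C * log_weight x"
    proof -
      have "rhoN ?N - AN ?N - 2 * ln (conf_factor x) \<le> \<bar>rhoN ?N - AN ?N\<bar> * 1 + 2 * log_weight x"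
        using abs_ln_conf_factor_le[of x] abs_ge_self[of "rhoN ?N - AN ?N"] unfolding abs_le_iff by simp
      also have "\<dots> \<le> \<bar>rhoN ?N - AN ?N\<bar> * log_weight x + 2 * log_weight x"
        using log_weight_ge_1[of x] by (intro add_right_mono mult_left_mono) auto
      finally have "(\<integral>y. bubble_kernel x y \<partial>lborel) \<le> (\<bar>rhoN ?N - AN ?N\<bar> * log_weight x + 2 * log_weight x) / cN ?N"
        unfolding integral_bubble_kernel using cN by (intro divide_right_mono) auto
      moreover have "2 * A * (\<integral>y. ?m y \<partial>lborel) \<le> 2 * A * B * log_weight x"
      proof -
        have "2 * A * (\<integral>y. ?m y \<partial>lborel) \<le> 2 * A * B * 1" using m_le A by (simp add: mult_left_mono)
        also have "\<dots> \<le> 2 * A * B * log_weight x"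
          using log_weight_ge_1[of x] A B by (intro mult_left_mono) auto
        finally show ?thesis .
      qed
      ultimately show ?thesis by (simp add: C_def algebra_simps add_divide_distrib)
    qed
    finally show ?thesis by (simp add: ennreal_leI)
  qed
  then show ?thesis using C by blast
qed

text \<open>In terms of the sphere, \<open>x\<close> is closer to the south pole than
  \<open>y\<close>. For fixed \<open>x\<close> the points \<open>y\<close> fill the shell from 1 to
  \<open>norm x / 2\<close>, over which \<open>1 / norm y ^ N\<close> integrates to a multiple of
  \<open>ln (norm x / 2)\<close>.\<close>

definition hardy_region :: "((real^'n) \<times> (real^'n)) set" where
  "hardy_region = {(x, y). 1 \<le> norm y \<and> 2 * norm y \<le> norm x}"

text \<open>On this region \<open>norm (x - y)\<close> is comparable to \<open>norm x\<close> and
  the ratio of bubbles to \<open>(norm x / norm y)^N\<close>, so the powers of \<open>norm x\<close>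
  cancel.\<close>

lemma hardy_lower:
  assumes "(x, y) \<in> hardy_region"
  shows "1 / (3 * norm y) ^ CARD('n) \<le> bubble y / bubble (x::real^'n) / norm (x - y) ^ CARD('n)"
proof -
  have y: "norm y \<ge> 1" and xy: "2 * norm y \<le> norm x" using assms by (auto simp: hardy_region_def)
  have n: "norm (x - y) > 0" using y xy norm_triangle_ineq2[of x y] by linarith
  have "norm (x - y) \<le> 3 / 2 * norm x" using norm_triangle_ineq4[of x y] xy by simp
  then have "(norm (x - y))\<^sup>2 \<le> (3 / 2 * norm x)\<^sup>2" by (intro power_mono) auto
  then have 1: "(norm (x - y))\<^sup>2 \<le> 9 / 4 * (norm x)\<^sup>2" by (simp add: power_mult_distrib power2_eq_square)
  have y2: "1 \<le> (norm y)\<^sup>2" using y by simp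
  have "(norm (x - y))\<^sup>2 * (1 + (norm y)\<^sup>2) \<le> 9 / 4 * (norm x)\<^sup>2 * (2 * (norm y)\<^sup>2)"
    using 1 y2 by (intro mult_mono) auto
  also have "\<dots> \<le> 9 * (norm y)\<^sup>2 * (1 + (norm x)\<^sup>2)"
    by (simp add: algebra_simps)
  finally have k: "1 / (9 * (norm y)\<^sup>2) \<le> (1 + (norm x)\<^sup>2) / (1 + (norm y)\<^sup>2) / (norm (x - y))\<^sup>2"
    using y2 n by (simp add: divide_simps mult_ac)
  have "1 / (3 * norm y) = sqrt (1 / (9 * (norm y)\<^sup>2))"
    by (simp add: real_sqrt_divide real_sqrt_mult)
  also have "\<dots> \<le> sqrt ((1 + (norm x)\<^sup>2) / (1 + (norm y)\<^sup>2) / (norm (x - y))\<^sup>2)"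
    by (rule real_sqrt_le_mono[OF k])
  also have "\<dots> = sqrt (conf_factor y) / sqrt (conf_factor x) / norm (x - y)"
    using norm_sq_pos[of x] norm_sq_pos[of y] by (simp add: conf_factor_def real_sqrt_divide real_sqrt_mult)
  finally have "(1 / (3 * norm y)) ^ CARD('n) \<le> (sqrt (conf_factor y) / sqrt (conf_factor x) / norm (x - y)) ^ CARD('n)"
    by (intro power_mono) auto
  then show ?thesis by (simp add: bubble_def power_divide power_mult_distrib)
qed

text \<open>Here the ratio of bubbles is inverted, and the powers of \<open>norm x\<close> add up
  instead of cancelling.\<close>

lemma hardy_upper:
  assumes "(x, y) \<in> hardy_region"
  shows "bubble x / bubble y / norm (x - (y::real^'n)) ^ CARD('n) \<le> (3 * norm y) ^ CARD('n) / norm x ^ (2 * CARD('n))"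
proof -
  have y: "norm y \<ge> 1" and xy: "2 * norm y \<le> norm x" using assms by (auto simp: hardy_region_def)
  have x: "norm x > 0" using y xy by linarith
  have n2: "norm x / 2 \<le> norm (x - y)" using norm_triangle_ineq2[of x y] xy by simp
  then have n: "norm (x - y) > 0" using x by linarith
  have 1: "(norm x)\<^sup>2 \<le> 4 * (norm (x - y))\<^sup>2"
    using power_mono[OF n2, of 2] by (simp add: power_divide)
  have y2: "1 \<le> (norm y)\<^sup>2" using y by simp
  have "(1 + (norm y)\<^sup>2) * ((norm x)\<^sup>2 * (norm x)\<^sup>2) \<le> (2 * (norm y)\<^sup>2) * ((1 + (norm x)\<^sup>2) * (4 * (norm (x - y))\<^sup>2))"
    using 1 y2 by (intro mult_mono) auto
  also have "\<dots> \<le> 9 * (norm y)\<^sup>2 * ((1 + (norm x)\<^sup>2) * (norm (x - y))\<^sup>2)"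
    by (simp add: algebra_simps)
  finally have k: "(1 + (norm y)\<^sup>2) / (1 + (norm x)\<^sup>2) / (norm (x - y))\<^sup>2 \<le> 9 * (norm y)\<^sup>2 / ((norm x)\<^sup>2 * (norm x)\<^sup>2)"
    using x n norm_sq_pos[of x] by (simp add: divide_simps mult_ac)
  have "sqrt (conf_factor x) / sqrt (conf_factor y) / norm (x - y) = sqrt ((1 + (norm y)\<^sup>2) / (1 + (norm x)\<^sup>2) / (norm (x - y))\<^sup>2)"
    using norm_sq_pos[of x] norm_sq_pos[of y] by (simp add: conf_factor_def real_sqrt_divide real_sqrt_mult)
  also have "\<dots> \<le> sqrt (9 * (norm y)\<^sup>2 / ((norm x)\<^sup>2 * (norm x)\<^sup>2))"
    by (rule real_sqrt_le_mono[OF k])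
  also have "\<dots> = 3 * norm y / (norm x)\<^sup>2"
  proof -
    have "9 * (norm y)\<^sup>2 / ((norm x)\<^sup>2 * (norm x)\<^sup>2) = (3 * norm y / (norm x)\<^sup>2)\<^sup>2"
      by (simp add: power_divide power_mult_distrib power2_eq_square)
    then show ?thesis by (simp del: power_divide)
  qed
  finally have "(sqrt (conf_factor x) / sqrt (conf_factor y) / norm (x - y)) ^ CARD('n) \<le> (3 * norm y / (norm x)\<^sup>2) ^ CARD('n)"
    using conf_factor_pos[of x] conf_factor_pos[of y] by (intro power_mono) auto
  then show ?thesis by (simp add: bubble_def power_divide power_mult power_mult_distrib)
qed

text \<open>The bound is scale invariant: the integral of \<open>1 / norm x ^ (2 * N)\<close> over
  \<open>norm x \<ge> 2 * norm y\<close> is a multiple of \<open>1 / norm y ^ N\<close>, which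
  cancels the factor \<open>norm y ^ N\<close> of \<open>hardy_upper\<close>.\<close>

lemma nn_integral_hardy_upper:
  "\<exists>C\<ge>0. \<forall>y::real^'n. (\<integral>\<^sup>+x. ennreal (indicator hardy_region (x, y) * (bubble x / bubble y / norm (x - y) ^ CARD('n))) \<partial>lborel) \<le> ennreal C"
proof (intro exI[of _ "2 ^ CARD('n) * unit_ball_vol CARD('n)"] conjI allI)
  let ?N = "CARD('n)"
  fix y :: "real^'n"
  show "(\<integral>\<^sup>+x. ennreal (indicator hardy_region (x, y) * (bubble x / bubble y / norm (x - y) ^ ?N)) \<partial>lborel) \<le> ennreal (2 ^ ?N * unit_ball_vol ?N)"
  proof (cases "norm y \<ge> 1")
    case True
    have "(\<integral>\<^sup>+x. ennreal (indicator hardy_region (x, y) * (bubble x / bubble y / norm (x - y) ^ ?N)) \<partial>lborel)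
      \<le> (\<integral>\<^sup>+x. ennreal ((3 * norm y) ^ ?N) * ennreal (indicator {2 * norm y..} (norm x) / norm x ^ (2 * ?N)) \<partial>(lborel :: (real^'n) measure))"
    proof (rule nn_integral_mono)
      fix x :: "real^'n"
      show "ennreal (indicator hardy_region (x, y) * (bubble x / bubble y / norm (x - y) ^ ?N)) \<le> ennreal ((3 * norm y) ^ ?N) * ennreal (indicator {2 * norm y..} (norm x) / norm x ^ (2 * ?N))"
      proof (cases "(x, y) \<in> hardy_region")
        case T: True
        then have "2 * norm y \<le> norm x" by (simp add: hardy_region_def)
        then show ?thesis using hardy_upper[OF T] T by (simp add: ennreal_mult''[symmetric] ennreal_leI)
      qed simp
    qed
    also have "\<dots> = ennreal ((3 * norm y) ^ ?N) * ennreal (unit_ball_vol ?N / (2 * norm y) ^ ?N)"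
      using True by (subst nn_integral_cmult) (measurable, subst nn_integral_radial_far[where 'a="real^'n", simplified], auto)
    also have "\<dots> = ennreal ((3 / 2) ^ ?N * unit_ball_vol ?N)"
      using True by (subst ennreal_mult''[symmetric]) (auto simp: power_mult_distrib power_divide)
    also have "\<dots> \<le> ennreal (2 ^ ?N * unit_ball_vol ?N)"
      by (intro ennreal_leI mult_right_mono power_mono) auto
    finally show ?thesis .
  next
    case False
    then have "(x, y) \<notin> hardy_region" for x by (auto simp: hardy_region_def)
    then show ?thesis by simp
  qed
qed simp

text \<open>The shell produces the logarithm of \<open>norm x / 2\<close>; the additive constant
  covers the points with \<open>norm x \<le> 2\<close> and the bounded part of the weight.\<close>

lemma nn_integral_hardy_lower:
  "\<exists>C\<ge>0. \<forall>x::real^'n. ennreal (log_weight x) \<le> ennreal C +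
    ennreal C * (\<integral>\<^sup>+y. ennreal (indicator hardy_region (x, y) * (bubble y / bubble x / norm (x - y) ^ CARD('n))) \<partial>lborel)"
proof -
  let ?N = "CARD('n)"
  let ?J = "\<lambda>x::real^'n. \<integral>\<^sup>+y. ennreal (indicator hardy_region (x, y) * (bubble y / bubble x / norm (x - y) ^ ?N)) \<partial>lborel"
  define B where "B = ?N * unit_ball_vol ?N"
  have B: "B > 0" by (simp add: B_def)
  \<comment> \<open>The 8 bounds the weight on \<open>norm x \<le> 2\<close> as well as
    \<open>ln 8\<close>; the quotient inverts the shell integral \<open>B * ln S / 3 ^ N\<close> and
    doubles it, since the weight grows like \<open>2 * ln S\<close>.\<close>
  define C where "C = 8 + 2 * 3 ^ ?N / B"
  have "ennreal (log_weight x) \<le> ennreal C + ennreal C * ?J x" for x :: "real^'n"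
  proof (cases "norm x \<le> 2")
    case True
    have "(norm x)\<^sup>2 \<le> 2\<^sup>2" using True by (intro power_mono) auto
    moreover have "exp 1 \<le> (3::real)" by (rule exp_le)
    moreover have "exp 1 + (norm x)\<^sup>2 > 0" by (simp add: add_pos_nonneg)
    ultimately have "log_weight x \<le> 8"
      unfolding log_weight_def using ln_le_minus_one[of "exp 1 + (norm x)\<^sup>2"] by simp
    also have "8 \<le> C" using B by (simp add: C_def)
    finally have "ennreal (log_weight x) \<le> ennreal C + 0" by (simp add: ennreal_leI)
    also have "\<dots> \<le> ennreal C + ennreal C * ?J x" by (intro add_left_mono) simp
    finally show ?thesis .
  next
    case False
    define S where "S = norm x / 2"
    have S: "S > 1" using False by (simp add: S_def)
    have "log_weight x \<le> ln (8 * S\<^sup>2)"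
    proof -
      have "exp 1 \<le> (3::real)" by (rule exp_le)
      moreover have "1 \<le> S\<^sup>2" using S by simp
      ultimately have "exp 1 + (norm x)\<^sup>2 \<le> 8 * S\<^sup>2"
        unfolding S_def by (simp add: power_divide)
      then show ?thesis unfolding log_weight_def using S by (subst ln_le_cancel_iff) (auto simp: add_pos_nonneg)
    qed
    also have "\<dots> = ln 8 + 2 * ln S" using S by (simp add: ln_mult ln_realpow)
    also have "\<dots> \<le> 8 + 2 * ln S" using ln_le_minus_one[of "8::real"] by simp
    finally have lw: "log_weight x \<le> 8 + 2 * ln S" .
    have "ennreal (B * ln S / 3 ^ ?N) = ennreal (1 / 3 ^ ?N) * (\<integral>\<^sup>+y. ennreal (indicator {1..S} (norm y) / norm y ^ ?N) \<partial>(lborel :: (real^'n) measure))"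
      using nn_integral_radial_log[of S, where 'a="real^'n"] S B
      by (simp add: B_def ennreal_mult''[symmetric])
    also have "\<dots> = (\<integral>\<^sup>+y. ennreal (1 / 3 ^ ?N) * ennreal (indicator {1..S} (norm y) / norm y ^ ?N) \<partial>(lborel :: (real^'n) measure))"
      by (rule nn_integral_cmult[symmetric]) measurable
    also have "\<dots> \<le> ?J x"
    proof (rule nn_integral_mono)
      fix y :: "real^'n"
      show "ennreal (1 / 3 ^ ?N) * ennreal (indicator {1..S} (norm y) / norm y ^ ?N) \<le> ennreal (indicator hardy_region (x, y) * (bubble y / bubble x / norm (x - y) ^ ?N))"
      proof (cases "norm y \<in> {1..S}")
        case True
        then have "(x, y) \<in> hardy_region" by (auto simp: hardy_region_def S_def)
        then show ?thesis using hardy_lower[of x y] True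
          by (simp add: ennreal_mult''[symmetric] ennreal_leI power_mult_distrib)
      qed simp
    qed
    finally have J: "ennreal (B * ln S / 3 ^ ?N) \<le> ?J x" .
    have "ennreal (log_weight x) \<le> ennreal (8 + 2 * 3 ^ ?N / B * (B * ln S / 3 ^ ?N))"
      using lw B by (intro ennreal_leI) simp
    also have "\<dots> = ennreal 8 + ennreal (2 * 3 ^ ?N / B) * ennreal (B * ln S / 3 ^ ?N)"
      using B S by (simp add: ennreal_mult''[symmetric] del: times_divide_eq_right times_divide_eq_left)
    also have "\<dots> \<le> ennreal C + ennreal C * ?J x"
      using J B by (intro add_mono mult_mono ennreal_leI) (auto simp: C_def)
    finally show ?thesis .
  qed
  moreover have "C \<ge> 0" using B by (simp add: C_def)
  ultimately show ?thesis by blast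
qed

subsection \<open>Quadratic forms and energy spaces\<close>

interpretation lebesgue: sigma_finite_measure "lebesgue :: 'a::euclidean_space measure"
proof
  obtain A :: "'a set set" where A: "countable A" "A \<subseteq> sets lborel" "\<Union>A = space lborel" "\<forall>a\<in>A. emeasure lborel a \<noteq> \<infinity>"
    using lborel.sigma_finite_countable by blast
  then show "\<exists>A. countable A \<and> A \<subseteq> sets (lebesgue :: 'a measure) \<and> \<Union>A = space lebesgue \<and> (\<forall>a\<in>A. emeasure lebesgue a \<noteq> \<infinity>)"
    by (intro exI[of _ A]) (auto simp: subset_eq)
qed

interpretation lebesgue_pair: pair_sigma_finite "lebesgue :: 'a::euclidean_space measure" "lebesgue :: 'b::euclidean_space measure" ..

abbreviation leb2 :: "((real^'n) \<times> (real^'n)) measure" where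
  "leb2 \<equiv> lebesgue \<Otimes>\<^sub>M lebesgue"

section \<open>Decomposition of the conformal form into near, far and diagonal parts\<close>

definition near_form :: "(real^'n \<Rightarrow> real) \<Rightarrow> (real^'n \<Rightarrow> real) \<Rightarrow> (real^'n) \<times> (real^'n) \<Rightarrow> real" where
  "near_form v w p = indicator (ball (fst p) 1) (snd p) *
     ((v (fst p) - v (snd p)) * (w (fst p) - w (snd p)) / norm (fst p - snd p) ^ CARD('n))"

definition far_form :: "(real^'n \<Rightarrow> real) \<Rightarrow> (real^'n \<Rightarrow> real) \<Rightarrow> (real^'n) \<times> (real^'n) \<Rightarrow> real" where
  "far_form v w p = (1 - indicator (ball (fst p) 1) (snd p)) *
     (v (fst p) * w (snd p) / norm (fst p - snd p) ^ CARD('n))"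

definition diag_form :: "(real^'n \<Rightarrow> real) \<Rightarrow> (real^'n \<Rightarrow> real) \<Rightarrow> (real^'n) \<times> (real^'n) \<Rightarrow> real" where
  "diag_form v w p = v (fst p) * w (fst p) * bubble_kernel (fst p) (snd p)"

text \<open>The integrand of the Gagliardo form on the sphere, in stereographic coordinates.\<close>

definition conf_form :: "(real^'n \<Rightarrow> real) \<Rightarrow> (real^'n \<Rightarrow> real) \<Rightarrow> (real^'n) \<times> (real^'n) \<Rightarrow> real" where
  "conf_form v w p =
     (v (fst p) / bubble (fst p) - v (snd p) / bubble (snd p)) *
     (w (fst p) / bubble (fst p) - w (snd p) / bubble (snd p)) *
     (bubble (fst p) * bubble (snd p)) / norm (fst p - snd p) ^ CARD('n)"

lemma indicator_ball_commute: "indicator (ball x r) y = indicator (ball y r) x"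
  by (simp add: indicator_def dist_commute)

text \<open>Multiplying out gives two mixed products and two squares weighted by the ratios of
  bubbles. Inside the unit ball, a 1 taken from each ratio completes the mixed products to the
  product of differences in \<open>near_form\<close>; this is the origin of the indicator in
  \<open>bubble_kernel\<close>.\<close>

lemma conf_form_eq:
  fixes v w :: "real^'n \<Rightarrow> real"
  shows "conf_form v w p = near_form v w p - far_form v w p - far_form v w (prod.swap p)
     + diag_form v w p + diag_form v w (prod.swap p)"
proof -
  obtain x y where p: "p = (x, y)" by (cases p)
  define a b where "a = bubble x" and "b = bubble y"
  have ab: "a > 0" "b > 0" by (simp_all add: a_def b_def bubble_pos)
  define q where "q = 1 / norm (x - y) ^ CARD('n)"
  define i where "i = (indicator (ball x 1) y :: real)"
  have i: "indicator (ball y 1) x = i" by (simp add: i_def indicator_ball_commute)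
  have div: "t / norm (x - y) ^ CARD('n) = t * q" for t by (simp add: q_def)
  have n: "norm (y - x) = norm (x - y)" by (rule norm_minus_commute)
  have "(v x / a - v y / b) * (w x / a - w y / b) * (a * b) =
      v x * w x * (b / a) + v y * w y * (a / b) - v x * w y - v y * w x"
    using ab by (simp add: field_simps)
  then show ?thesis
    unfolding p conf_form_def near_form_def far_form_def diag_form_def bubble_kernel_def
      prod.swap_def fst_conv snd_conv a_def[symmetric] b_def[symmetric] n div i i_def[symmetric]
    by (simp only:) (simp add: algebra_simps)
qed

lemma measurable_lebesgue_id: "(\<lambda>x. x) \<in> lebesgue \<rightarrow>\<^sub>M borel"
  by (rule measurable_completion) simp

lemma measurable_leb2:
  shows "fst \<in> leb2 \<rightarrow>\<^sub>M borel" "snd \<in> leb2 \<rightarrow>\<^sub>M borel"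
  using measurable_compose[OF measurable_fst measurable_lebesgue_id]
    measurable_compose[OF measurable_snd measurable_lebesgue_id] by auto

lemma
  fixes v :: "real^'n \<Rightarrow> real"
  assumes v: "v \<in> borel_measurable lebesgue"
  shows measurable_leb2_fst: "(\<lambda>p. v (fst p)) \<in> borel_measurable leb2"
    and measurable_leb2_snd: "(\<lambda>p. v (snd p)) \<in> borel_measurable leb2"
  using measurable_compose[OF measurable_fst v] measurable_compose[OF measurable_snd v] by auto

lemma measurable_leb2_bubble:
  "(\<lambda>p. bubble (fst p)) \<in> borel_measurable leb2" "(\<lambda>p. bubble (snd p)) \<in> borel_measurable leb2"
  using measurable_compose[OF measurable_leb2(1) borel_measurable_bubble]
    measurable_compose[OF measurable_leb2(2) borel_measurable_bubble] by auto

lemma measurable_leb2_dist: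
  "(\<lambda>p. norm (fst p - snd p)) \<in> borel_measurable leb2"
  by (rule measurable_compose[OF borel_measurable_diff[OF measurable_leb2] borel_measurable_norm])

lemma measurable_leb2_ball:
  "(\<lambda>p. indicator (ball (fst p) 1) (snd p) :: real) \<in> borel_measurable leb2"
proof -
  note [measurable] = measurable_leb2_dist
  have "(\<lambda>p. if norm (fst p - snd p) < 1 then 1 else 0 :: real) \<in> borel_measurable leb2"
    by measurable
  then show ?thesis by (simp add: indicator_def dist_norm)
qed

lemma measurable_leb2_bubble_kernel:
  "(\<lambda>p. bubble_kernel (fst p) (snd p)) \<in> borel_measurable leb2"
proof -
  note [measurable] = measurable_leb2_dist measurable_leb2_ball measurable_leb2_bubble
  show ?thesis unfolding bubble_kernel_def by measurable
qed

lemma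
  fixes v w :: "real^'n \<Rightarrow> real"
  assumes v: "v \<in> borel_measurable lebesgue" and w: "w \<in> borel_measurable lebesgue"
  shows measurable_near_form: "near_form v w \<in> borel_measurable leb2"
    and measurable_far_form: "far_form v w \<in> borel_measurable leb2"
    and measurable_diag_form: "diag_form v w \<in> borel_measurable leb2"
    and measurable_conf_form: "conf_form v w \<in> borel_measurable leb2"
proof -
  note [measurable] = measurable_leb2_fst[OF v] measurable_leb2_snd[OF v] measurable_leb2_fst[OF w]
    measurable_leb2_snd[OF w] measurable_leb2_dist measurable_leb2_ball measurable_leb2_bubble
    measurable_leb2_bubble_kernel
  show "near_form v w \<in> borel_measurable leb2" "far_form v w \<in> borel_measurable leb2"
    "diag_form v w \<in> borel_measurable leb2" "conf_form v w \<in> borel_measurable leb2"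
    unfolding near_form_def[abs_def] far_form_def[abs_def] diag_form_def[abs_def] conf_form_def[abs_def]
    by measurable
qed

lemma
  fixes f :: "(real^'n) \<times> (real^'n) \<Rightarrow> real"
  assumes f: "integrable leb2 f"
  shows integrable_leb2_swap: "integrable leb2 (\<lambda>p. f (prod.swap p))"
    and integral_leb2_swap: "(\<integral>p. f (prod.swap p) \<partial>leb2) = (\<integral>p. f p \<partial>leb2)"
  using lebesgue_pair.integrable_product_swap[OF f] lebesgue_pair.integral_product_swap[of f]
    borel_measurable_integrable[OF f]
  by (simp_all add: prod.swap_def case_prod_beta')

lemma near_form_nonneg: "near_form v v p \<ge> 0"
  by (simp add: near_form_def indicator_def)

lemma conf_form_nonneg: "conf_form v v p \<ge> 0"
  unfolding conf_form_def using bubble_pos[of "fst p"] bubble_pos[of "snd p"]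
  by (intro divide_nonneg_nonneg mult_nonneg_nonneg[OF zero_le_square]) auto

lemma abs_mult_le_sum_squares: "\<bar>a * b\<bar> \<le> a * a + b * (b::real)"
proof -
  have "0 \<le> (\<bar>a\<bar> - \<bar>b\<bar>)\<^sup>2 + (a * a + b * b)" by simp
  then show ?thesis by (simp add: power2_eq_square algebra_simps abs_mult)
qed

lemma abs_near_form_le: "\<bar>near_form v w p\<bar> \<le> near_form v v p + near_form w w p"
  using abs_mult_le_sum_squares[of "v (fst p) - v (snd p)" "w (fst p) - w (snd p)"]
  by (auto simp: near_form_def indicator_def abs_divide add_divide_distrib[symmetric] intro!: divide_right_mono)

text \<open>The far kernel \<open>norm (x - y) ^ (-N)\<close> is not integrable at infinity, so an
  unweighted estimate of the product fails. Weighting the two squares with the ratio of bubbles and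
  its inverse yields exactly the diagonal terms, in which no indicator is subtracted outside the
  ball.\<close>

lemma abs_far_form_le: "\<bar>far_form v w p\<bar> \<le> \<bar>diag_form v v p\<bar> + \<bar>diag_form w w (prod.swap p)\<bar>"
proof -
  obtain x y where p: "p = (x, y)" by (cases p)
  show ?thesis
  proof (cases "y \<in> ball x 1")
    case True
    then show ?thesis by (simp add: p far_form_def)
  next
    case False
    then have i: "indicator (ball x 1) y = (0::real)" "indicator (ball y 1) x = (0::real)"
      by (auto simp: indicator_def dist_commute)
    define a b where "a = bubble x" and "b = bubble y"
    have ab: "a > 0" "b > 0" by (simp_all add: a_def b_def bubble_pos)
    define q where "q = 1 / norm (x - y) ^ CARD('a)"
    have q: "q \<ge> 0" by (simp add: q_def)
    have n: "norm (y - x) = norm (x - y)" by (rule norm_minus_commute)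
    have div: "t / norm (x - y) ^ CARD('a) = t * q" for t by (simp add: q_def)
    have "\<bar>(v x * b) * (w y * a)\<bar> \<le> (v x * b) * (v x * b) + (w y * a) * (w y * a)"
      by (rule abs_mult_le_sum_squares)
    then have "\<bar>(v x * b) * (w y * a)\<bar> / (a * b) \<le> ((v x * b) * (v x * b) + (w y * a) * (w y * a)) / (a * b)"
      using ab by (intro divide_right_mono) auto
    then have "\<bar>v x * w y\<bar> \<le> v x * v x * (b / a) + w y * w y * (a / b)"
      using ab by (simp add: abs_mult add_divide_distrib mult_ac)
    then have "\<bar>v x * w y\<bar> * q \<le> (v x * v x * (b / a) + w y * w y * (a / b)) * q"
      by (rule mult_right_mono[OF _ q])
    moreover have "diag_form v v p = v x * v x * (b / a) * q" "diag_form w w (prod.swap p) = w y * w y * (a / b) * q"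
      unfolding p diag_form_def bubble_kernel_def prod.swap_def fst_conv snd_conv a_def[symmetric] b_def[symmetric] n div i
      by simp_all
    moreover have "\<bar>far_form v w p\<bar> = \<bar>v x * w y\<bar> * q"
      unfolding p far_form_def fst_conv snd_conv div i using q by (simp add: abs_mult)
    ultimately show ?thesis using abs_ge_self[of "diag_form v v p"] abs_ge_self[of "diag_form w w (prod.swap p)"]
      by (simp only: distrib_right) linarith
  qed
qed

lemma integrable_mult_of_squares:
  fixes v w g :: "'a \<Rightarrow> real"
  assumes "v \<in> borel_measurable M" "w \<in> borel_measurable M" "g \<in> borel_measurable M"
    and I: "integrable M (\<lambda>x. (v x)\<^sup>2 * h x)" "integrable M (\<lambda>x. (w x)\<^sup>2 * h x)"
    and g: "\<And>x. \<bar>g x\<bar> \<le> h x"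
  shows "integrable M (\<lambda>x. v x * w x * g x)"
proof (rule Bochner_Integration.integrable_bound[OF Bochner_Integration.integrable_add[OF I]])
  show "AE x in M. norm (v x * w x * g x) \<le> norm ((v x)\<^sup>2 * h x + (w x)\<^sup>2 * h x)"
  proof (rule AE_I2)
    fix x
    have h: "h x \<ge> 0" using g[of x] by linarith
    have "\<bar>v x * w x * g x\<bar> = \<bar>v x * w x\<bar> * \<bar>g x\<bar>" by (rule abs_mult)
    also have "\<dots> \<le> (v x * v x + w x * w x) * h x"
      using h by (intro mult_mono abs_mult_le_sum_squares g) auto
    also have "\<dots> \<le> \<bar>(v x)\<^sup>2 * h x + (w x)\<^sup>2 * h x\<bar>"
      by (simp add: power2_eq_square distrib_right)
    finally show "norm (v x * w x * g x) \<le> norm ((v x)\<^sup>2 * h x + (w x)\<^sup>2 * h x)" by simp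
  qed
qed (use assms in measurable)

lemma measurable_log_weight: "log_weight \<in> borel_measurable lebesgue"
  unfolding log_weight_def[abs_def] by (rule measurable_completion) measurable

lemma borel_measurable_bubble_kernel [measurable]: "bubble_kernel x \<in> borel_measurable borel"
  using integrable_bubble_kernel[of x] by (auto dest: borel_measurable_integrable)

text \<open>Integration in \<open>y\<close> first: the absolute kernel costs a factor
  \<open>log_weight x\<close>, which the hypotheses absorb, and Fubini then replaces the kernel by
  its exact integral.\<close>

lemma
  fixes v w :: "real^'n \<Rightarrow> real"
  assumes v: "v \<in> borel_measurable lebesgue" and w: "w \<in> borel_measurable lebesgue"
    and I: "integrable lebesgue (\<lambda>x. (v x)\<^sup>2 * log_weight x)" "integrable lebesgue (\<lambda>x. (w x)\<^sup>2 * log_weight x)"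
  shows integrable_diag_form: "integrable leb2 (diag_form v w)"
    and integral_diag_form: "(\<integral>p. diag_form v w p \<partial>leb2) =
      (\<integral>x. v x * w x * ((rhoN CARD('n) - AN CARD('n) - 2 * ln (conf_factor x)) / cN CARD('n)) \<partial>lebesgue)"
proof -
  obtain C where C: "C \<ge> 0" "\<And>x::real^'n. (\<integral>\<^sup>+y. ennreal \<bar>bubble_kernel x y\<bar> \<partial>lborel) \<le> ennreal (C * log_weight x)"
    using nn_integral_abs_bubble_kernel by blast
  have vw: "integrable lebesgue (\<lambda>x. v x * w x * log_weight x)"
    by (rule integrable_mult_of_squares[OF v w measurable_log_weight I]) (use log_weight_ge_1 in \<open>smt (verit)\<close>)
  have lw: "log_weight x \<ge> 0" for x :: "real^'n" using log_weight_ge_1[of x] by simp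
  note meas = measurable_diag_form[OF v w]
  show int: "integrable leb2 (diag_form v w)"
  proof (rule integrableI_bounded[OF meas])
    have "(\<integral>\<^sup>+p. ennreal (norm (diag_form v w p)) \<partial>leb2) = (\<integral>\<^sup>+x. \<integral>\<^sup>+y. ennreal (norm (diag_form v w (x, y))) \<partial>lebesgue \<partial>lebesgue)"
      using meas by (subst lebesgue.nn_integral_fst) auto
    also have "\<dots> \<le> (\<integral>\<^sup>+x. ennreal C * ennreal (norm (v x * w x * log_weight x)) \<partial>lebesgue)"
    proof (rule nn_integral_mono)
      fix x :: "real^'n"
      have "(\<integral>\<^sup>+y. ennreal (norm (diag_form v w (x, y))) \<partial>lebesgue) = (\<integral>\<^sup>+y. ennreal \<bar>v x * w x\<bar> * ennreal \<bar>bubble_kernel x y\<bar> \<partial>lborel)"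
        unfolding nn_integral_completion by (simp add: diag_form_def abs_mult ennreal_mult)
      also have "\<dots> = ennreal \<bar>v x * w x\<bar> * (\<integral>\<^sup>+y. ennreal \<bar>bubble_kernel x y\<bar> \<partial>lborel)"
        by (rule nn_integral_cmult) measurable
      also have "\<dots> \<le> ennreal \<bar>v x * w x\<bar> * ennreal (C * log_weight x)"
        by (intro mult_left_mono C) simp
      also have "\<dots> = ennreal C * ennreal (norm (v x * w x * log_weight x))"
        using C(1) lw[of x] by (simp add: ennreal_mult'[symmetric] abs_mult mult_ac)
      finally show "(\<integral>\<^sup>+y. ennreal (norm (diag_form v w (x, y))) \<partial>lebesgue) \<le> ennreal C * ennreal (norm (v x * w x * log_weight x))" .
    qed
    also have "\<dots> = ennreal C * (\<integral>\<^sup>+x. ennreal (norm (v x * w x * log_weight x)) \<partial>lebesgue)"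
      using borel_measurable_integrable[OF vw] by (intro nn_integral_cmult) auto
    also have "\<dots> < \<infinity>" using vw by (simp add: integrable_iff_bounded ennreal_mult_less_top)
    finally show "(\<integral>\<^sup>+p. ennreal (norm (diag_form v w p)) \<partial>leb2) < \<infinity>" .
  qed
  have "(\<integral>p. diag_form v w p \<partial>leb2) = (\<integral>x. \<integral>y. diag_form v w (x, y) \<partial>lebesgue \<partial>lebesgue)"
    by (rule lebesgue_pair.integral_fst'[OF int, symmetric])
  also have "\<dots> = (\<integral>x. v x * w x * ((rhoN CARD('n) - AN CARD('n) - 2 * ln (conf_factor x)) / cN CARD('n)) \<partial>lebesgue)"
    by (simp add: diag_form_def integral_completion integral_bubble_kernel)
  finally show "(\<integral>p. diag_form v w p \<partial>leb2) =
      (\<integral>x. v x * w x * ((rhoN CARD('n) - AN CARD('n) - 2 * ln (conf_factor x)) / cN CARD('n)) \<partial>lebesgue)" .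
qed

definition log_energy :: "(real^'n \<Rightarrow> real) \<Rightarrow> bool" where
  "log_energy v \<longleftrightarrow> v \<in> borel_measurable lebesgue \<and> integrable lebesgue (\<lambda>x. (v x)\<^sup>2) \<and>
     integrable leb2 (near_form v v) \<and> integrable lebesgue (\<lambda>x. (v x)\<^sup>2 * log_weight x)"

text \<open>What \<open>u \<in> H_sphere \<kappa>\<close> says about \<open>iota u\<close>; no
  logarithmic weight appears.\<close>

definition conf_energy :: "(real^'n \<Rightarrow> real) \<Rightarrow> bool" where
  "conf_energy v \<longleftrightarrow> v \<in> borel_measurable lebesgue \<and> integrable lebesgue (\<lambda>x. (v x)\<^sup>2) \<and>
     integrable leb2 (conf_form v v)"

lemma integrable_far_form:
  fixes v w :: "real^'n \<Rightarrow> real"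
  assumes v: "v \<in> borel_measurable lebesgue" and w: "w \<in> borel_measurable lebesgue"
    and I: "integrable lebesgue (\<lambda>x. (v x)\<^sup>2 * log_weight x)" "integrable lebesgue (\<lambda>x. (w x)\<^sup>2 * log_weight x)"
  shows "integrable leb2 (far_form v w)"
proof (rule Bochner_Integration.integrable_bound)
  show "integrable leb2 (\<lambda>p. \<bar>diag_form v v p\<bar> + \<bar>diag_form w w (prod.swap p)\<bar>)"
    by (intro Bochner_Integration.integrable_add integrable_abs integrable_leb2_swap[of "diag_form w w"]
      integrable_diag_form v w I)
  show "AE p in leb2. norm (far_form v w p) \<le> norm (\<bar>diag_form v v p\<bar> + \<bar>diag_form w w (prod.swap p)\<bar>)"
    using abs_far_form_le[of v w] by (intro AE_I2) (simp add: abs_of_nonneg)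
qed (rule measurable_far_form[OF v w])

lemma integrable_near_form:
  assumes "log_energy v" "log_energy w"
  shows "integrable leb2 (near_form v w)"
proof (rule Bochner_Integration.integrable_bound)
  show "integrable leb2 (\<lambda>p. near_form v v p + near_form w w p)"
    using assms by (intro Bochner_Integration.integrable_add) (auto simp: log_energy_def)
  show "AE p in leb2. norm (near_form v w p) \<le> norm (near_form v v p + near_form w w p)"
    using abs_near_form_le[of v w] by (intro AE_I2) (simp add: near_form_nonneg abs_of_nonneg)
qed (use assms in \<open>auto simp: log_energy_def intro: measurable_near_form\<close>)

lemma
  fixes v w :: "real^'n \<Rightarrow> real"
  assumes v: "log_energy v" and w: "log_energy w"
  shows integrable_conf_form: "integrable leb2 (conf_form v w)"
    and integral_conf_form: "(\<integral>p. conf_form v w p \<partial>leb2) =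
      (\<integral>p. near_form v w p \<partial>leb2) - 2 * (\<integral>p. far_form v w p \<partial>leb2) + 2 * (\<integral>p. diag_form v w p \<partial>leb2)"
proof -
  have N: "integrable leb2 (near_form v w)" by (rule integrable_near_form[OF v w])
  have F: "integrable leb2 (far_form v w)" and D: "integrable leb2 (diag_form v w)"
    using v w by (auto simp: log_energy_def intro: integrable_far_form integrable_diag_form)
  note F' = integrable_leb2_swap[OF F] and D' = integrable_leb2_swap[OF D]
  show "integrable leb2 (conf_form v w)"
    unfolding conf_form_eq[abs_def]
    by (intro Bochner_Integration.integrable_add Bochner_Integration.integrable_diff N F D F' D')
  have "has_bochner_integral leb2 (\<lambda>p. near_form v w p - far_form v w p - far_form v w (prod.swap p)
       + diag_form v w p + diag_form v w (prod.swap p))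
     ((\<integral>p. near_form v w p \<partial>leb2) - (\<integral>p. far_form v w p \<partial>leb2) - (\<integral>p. far_form v w (prod.swap p) \<partial>leb2)
       + (\<integral>p. diag_form v w p \<partial>leb2) + (\<integral>p. diag_form v w (prod.swap p) \<partial>leb2))"
    by (intro has_bochner_integral_add has_bochner_integral_diff has_bochner_integral_integrable N F D F' D')
  then show "(\<integral>p. conf_form v w p \<partial>leb2) =
      (\<integral>p. near_form v w p \<partial>leb2) - 2 * (\<integral>p. far_form v w p \<partial>leb2) + 2 * (\<integral>p. diag_form v w p \<partial>leb2)"
    unfolding conf_form_eq[symmetric] integral_leb2_swap[OF F] integral_leb2_swap[OF D]
    by (simp add: has_bochner_integral_iff)
qed

text \<open>A logarithmic Hardy inequality at the point at infinity, i.e. at the south pole. On the region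
  where \<open>x\<close> is much closer to the pole than \<open>y\<close>, the value at \<open>x\<close> is compared with the one at \<open>y\<close>.\<close>

lemma hardy_pointwise:
  "indicator hardy_region p * ((v (fst p))\<^sup>2 * (bubble (snd p) / bubble (fst p) / norm (fst p - snd p) ^ CARD('n)))
    \<le> 2 * conf_form v v (p :: (real^'n) \<times> (real^'n)) +
      2 * ((v (snd p))\<^sup>2 * (indicator hardy_region p * (bubble (fst p) / bubble (snd p) / norm (fst p - snd p) ^ CARD('n))))"
proof (cases "p \<in> hardy_region")
  case True
  obtain x y where p: "p = (x, y)" by (cases p)
  define a b where "a = bubble x" and "b = bubble y"
  have ab: "a > 0" "b > 0" by (simp_all add: a_def b_def bubble_pos)
  define q where "q = 1 / norm (x - y) ^ CARD('n)"
  have q: "q \<ge> 0" by (simp add: q_def)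
  have div: "t / norm (x - y) ^ CARD('n) = t * q" for t by (simp add: q_def)
  \<comment> \<open>With \<open>s = v x / a\<close> and \<open>t = v y / b\<close> this is
    \<open>a * b * (s - 2 * t)^2\<close>, the gap in
    \<open>s^2 \<le> 2 * (s - t)^2 + 2 * t^2\<close>.\<close>
  have "0 \<le> (v x * b - 2 * v y * a)\<^sup>2 / (a * b)" using ab by simp
  also have "\<dots> = 2 * ((v x / a - v y / b) * (v x / a - v y / b) * (a * b)) + 2 * ((v y)\<^sup>2 * (a / b)) - (v x)\<^sup>2 * (b / a)"
    using ab by (simp add: field_simps power2_eq_square)
  finally have "(v x)\<^sup>2 * (b / a) * q \<le> (2 * ((v x / a - v y / b) * (v x / a - v y / b) * (a * b)) + 2 * ((v y)\<^sup>2 * (a / b))) * q"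
    using q by (intro mult_right_mono) auto
  then show ?thesis
    using True unfolding p conf_form_def fst_conv snd_conv a_def[symmetric] b_def[symmetric] div
    by (simp add: algebra_simps)
qed (simp add: conf_form_nonneg)

lemma measurable_leb2_hardy_region:
  "(\<lambda>p. indicator hardy_region p :: real) \<in> borel_measurable leb2"
proof -
  have [measurable]: "(\<lambda>p. norm (fst p)) \<in> borel_measurable leb2" "(\<lambda>p. norm (snd p)) \<in> borel_measurable leb2"
    by (rule measurable_compose[OF measurable_leb2(1) borel_measurable_norm]
        measurable_compose[OF measurable_leb2(2) borel_measurable_norm])+
  have "(\<lambda>p. if 1 \<le> norm (snd p) \<and> 2 * norm (snd p) \<le> norm (fst p) then 1 else 0 :: real) \<in> borel_measurable leb2"
    by measurable
  then show ?thesis by (simp add: indicator_def hardy_region_def case_prod_beta')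
qed

text \<open>In \<open>hardy_pointwise\<close> the left side, integrated in \<open>y\<close>,
  controls the weight at \<open>x\<close> up to a constant, and the term with \<open>v y\<close>,
  integrated in \<open>x\<close>, is at most a multiple of \<open>(v y)^2\<close>. Nothing has to be
  absorbed into the left side, so the argument runs in \<open>ennreal\<close> with no a priori
  finiteness of the weighted integral.\<close>

lemma log_hardy:
  fixes v :: "real^'n \<Rightarrow> real"
  assumes v: "conf_energy v"
  shows "integrable lebesgue (\<lambda>x. (v x)\<^sup>2 * log_weight x)"
proof -
  let ?N = "CARD('n)"
  have vm: "v \<in> borel_measurable lebesgue" and v2: "integrable lebesgue (\<lambda>x. (v x)\<^sup>2)"
    and Q: "integrable leb2 (conf_form v v)" using v by (auto simp: conf_energy_def)
  note [measurable] = vm measurable_leb2_fst[OF vm] measurable_leb2_snd[OF vm] measurable_leb2_dist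
    measurable_leb2_bubble measurable_leb2_hardy_region measurable_conf_form[OF vm vm] measurable_log_weight
  let ?K = "\<lambda>p::(real^'n) \<times> (real^'n). indicator hardy_region p * (bubble (snd p) / bubble (fst p) / norm (fst p - snd p) ^ ?N)"
  let ?L = "\<lambda>p::(real^'n) \<times> (real^'n). indicator hardy_region p * (bubble (fst p) / bubble (snd p) / norm (fst p - snd p) ^ ?N)"
  have Kn: "?K p \<ge> 0" and Ln: "?L p \<ge> 0" for p
    using bubble_pos[of "fst p"] bubble_pos[of "snd p"] by (simp_all add: less_imp_le)
  have Km [measurable]: "?K \<in> borel_measurable leb2" and Lm [measurable]: "?L \<in> borel_measurable leb2" by measurable
  have mK: "(\<lambda>p. ennreal ((v (fst p))\<^sup>2 * ?K p)) \<in> borel_measurable leb2"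
    and mL: "(\<lambda>p. ennreal ((v (snd p))\<^sup>2 * ?L p)) \<in> borel_measurable leb2"
    by (intro measurable_compose[OF _ measurable_ennreal] borel_measurable_times borel_measurable_power
      measurable_leb2_fst measurable_leb2_snd vm Km Lm)+
  obtain C where C: "C \<ge> 0" "\<And>x::real^'n. ennreal (log_weight x) \<le> ennreal C + ennreal C * (\<integral>\<^sup>+y. ennreal (?K (x, y)) \<partial>lborel)"
    using nn_integral_hardy_lower[where 'n='n] by auto
  obtain D where D: "D \<ge> 0" "\<And>y::real^'n. (\<integral>\<^sup>+x. ennreal (?L (x, y)) \<partial>lborel) \<le> ennreal D"
    using nn_integral_hardy_upper[where 'n='n] by auto
  have fin: "(\<integral>\<^sup>+x. ennreal ((v x)\<^sup>2) \<partial>lebesgue) < \<infinity>" using v2 by (simp add: integrable_iff_bounded)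
  \<comment> \<open>The integral in \<open>x\<close> is the inner one here, since the bound
    \<open>D\<close> holds for each fixed \<open>y\<close>.\<close>
  have "(\<integral>\<^sup>+p. ennreal ((v (snd p))\<^sup>2 * ?L p) \<partial>leb2) = (\<integral>\<^sup>+y. \<integral>\<^sup>+x. ennreal ((v y)\<^sup>2 * ?L (x, y)) \<partial>lebesgue \<partial>lebesgue)"
    using lebesgue_pair.nn_integral_snd[OF mL] by simp
  also have "\<dots> \<le> (\<integral>\<^sup>+y. ennreal ((v y)\<^sup>2) * ennreal D \<partial>lebesgue)"
  proof (rule nn_integral_mono)
    fix y :: "real^'n"
    have "(\<integral>\<^sup>+x. ennreal ((v y)\<^sup>2 * ?L (x, y)) \<partial>lebesgue) = (\<integral>\<^sup>+x. ennreal ((v y)\<^sup>2) * ennreal (?L (x, y)) \<partial>lebesgue)"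
      using Ln by (intro nn_integral_cong ennreal_mult) auto
    also have "\<dots> = ennreal ((v y)\<^sup>2) * (\<integral>\<^sup>+x. ennreal (?L (x, y)) \<partial>lebesgue)"
      by (intro nn_integral_cmult measurable_compose[OF measurable_compose[OF measurable_Pair2' Lm] measurable_ennreal]) simp
    also have "\<dots> \<le> ennreal ((v y)\<^sup>2) * ennreal D"
      unfolding nn_integral_completion by (intro mult_left_mono D) simp
    finally show "(\<integral>\<^sup>+x. ennreal ((v y)\<^sup>2 * ?L (x, y)) \<partial>lebesgue) \<le> ennreal ((v y)\<^sup>2) * ennreal D" .
  qed
  also have "\<dots> = (\<integral>\<^sup>+y. ennreal ((v y)\<^sup>2) \<partial>lebesgue) * ennreal D"
    by (rule nn_integral_multc) measurable
  also have "\<dots> < \<infinity>" using fin by (simp add: ennreal_mult_less_top)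
  finally have B: "(\<integral>\<^sup>+p. ennreal ((v (snd p))\<^sup>2 * ?L p) \<partial>leb2) < \<infinity>" .
  have "(\<integral>\<^sup>+p. ennreal ((v (fst p))\<^sup>2 * ?K p) \<partial>leb2) \<le> (\<integral>\<^sup>+p. ennreal 2 * ennreal (conf_form v v p) + ennreal 2 * ennreal ((v (snd p))\<^sup>2 * ?L p) \<partial>leb2)"
  proof (rule nn_integral_mono)
    fix p :: "(real^'n) \<times> (real^'n)"
    have "ennreal ((v (fst p))\<^sup>2 * ?K p) \<le> ennreal (2 * conf_form v v p + 2 * ((v (snd p))\<^sup>2 * ?L p))"
      using hardy_pointwise[of p v] by (intro ennreal_leI) (simp add: mult_ac)
    also have "\<dots> = ennreal 2 * ennreal (conf_form v v p) + ennreal 2 * ennreal ((v (snd p))\<^sup>2 * ?L p)"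
      using conf_form_nonneg[of v p] mult_nonneg_nonneg[OF zero_le_power2[of "v (snd p)"] Ln[of p]]
      by (simp only: ennreal_plus ennreal_mult mult_nonneg_nonneg zero_le_numeral)
    finally show "ennreal ((v (fst p))\<^sup>2 * ?K p) \<le> \<dots>" .
  qed
  also have "\<dots> = ennreal 2 * (\<integral>\<^sup>+p. ennreal (conf_form v v p) \<partial>leb2) + ennreal 2 * (\<integral>\<^sup>+p. ennreal ((v (snd p))\<^sup>2 * ?L p) \<partial>leb2)"
    using mL measurable_compose[OF measurable_conf_form[OF vm vm] measurable_ennreal]
    by (subst nn_integral_add) (simp_all only: nn_integral_cmult borel_measurable_times_ennreal borel_measurable_const)
  also have "\<dots> < \<infinity>"
    using B Q by (simp add: integrable_iff_bounded conf_form_nonneg abs_of_nonneg ennreal_mult_less_top)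
  finally have A: "(\<integral>\<^sup>+p. ennreal ((v (fst p))\<^sup>2 * ?K p) \<partial>leb2) < \<infinity>" .
  have Kx: "(\<lambda>y. ennreal (?K (x, y))) \<in> borel_measurable lebesgue" for x
    by (intro measurable_compose[OF measurable_compose[OF measurable_Pair1' Km] measurable_ennreal]) simp
  have "(\<integral>\<^sup>+x. ennreal ((v x)\<^sup>2 * log_weight x) \<partial>lebesgue)
    \<le> (\<integral>\<^sup>+x. ennreal C * ennreal ((v x)\<^sup>2) + ennreal C * (\<integral>\<^sup>+y. ennreal ((v x)\<^sup>2 * ?K (x, y)) \<partial>lebesgue) \<partial>lebesgue)"
  proof (rule nn_integral_mono)
    fix x :: "real^'n"
    have "ennreal ((v x)\<^sup>2 * log_weight x) = ennreal ((v x)\<^sup>2) * ennreal (log_weight x)"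
      by (rule ennreal_mult'') (use log_weight_ge_1[of x] in simp)
    also have "\<dots> \<le> ennreal ((v x)\<^sup>2) * (ennreal C + ennreal C * (\<integral>\<^sup>+y. ennreal (?K (x, y)) \<partial>lebesgue))"
      unfolding nn_integral_completion by (intro mult_left_mono C) simp
    also have "\<dots> = ennreal C * ennreal ((v x)\<^sup>2) + ennreal C * (ennreal ((v x)\<^sup>2) * (\<integral>\<^sup>+y. ennreal (?K (x, y)) \<partial>lebesgue))"
      by (simp add: distrib_left mult_ac)
    also have "ennreal ((v x)\<^sup>2) * (\<integral>\<^sup>+y. ennreal (?K (x, y)) \<partial>lebesgue) = (\<integral>\<^sup>+y. ennreal ((v x)\<^sup>2) * ennreal (?K (x, y)) \<partial>lebesgue)"
      by (rule nn_integral_cmult[OF Kx, symmetric])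
    also have "\<dots> = (\<integral>\<^sup>+y. ennreal ((v x)\<^sup>2 * ?K (x, y)) \<partial>lebesgue)"
      using Kn by (intro nn_integral_cong ennreal_mult[symmetric]) auto
    finally show "ennreal ((v x)\<^sup>2 * log_weight x) \<le> ennreal C * ennreal ((v x)\<^sup>2) + ennreal C * (\<integral>\<^sup>+y. ennreal ((v x)\<^sup>2 * ?K (x, y)) \<partial>lebesgue)" .
  qed
  also have "\<dots> = ennreal C * (\<integral>\<^sup>+x. ennreal ((v x)\<^sup>2) \<partial>lebesgue) + ennreal C * (\<integral>\<^sup>+x. \<integral>\<^sup>+y. ennreal ((v x)\<^sup>2 * ?K (x, y)) \<partial>lebesgue \<partial>lebesgue)"
  proof -
    have m: "(\<lambda>x. \<integral>\<^sup>+y. ennreal ((v x)\<^sup>2 * ?K (x, y)) \<partial>lebesgue) \<in> borel_measurable lebesgue"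
      using lebesgue.borel_measurable_nn_integral_fst[OF mK] by simp
    have m2: "(\<lambda>x. ennreal ((v x)\<^sup>2)) \<in> borel_measurable lebesgue" by measurable
    show ?thesis
      by (subst nn_integral_add) (use m m2 in \<open>simp_all add: nn_integral_cmult\<close>)
  qed
  also have "(\<integral>\<^sup>+x. \<integral>\<^sup>+y. ennreal ((v x)\<^sup>2 * ?K (x, y)) \<partial>lebesgue \<partial>lebesgue) = (\<integral>\<^sup>+p. ennreal ((v (fst p))\<^sup>2 * ?K p) \<partial>leb2)"
    using lebesgue.nn_integral_fst[OF mK] by simp
  also have "ennreal C * (\<integral>\<^sup>+x. ennreal ((v x)\<^sup>2) \<partial>lebesgue) + ennreal C * (\<integral>\<^sup>+p. ennreal ((v (fst p))\<^sup>2 * ?K p) \<partial>leb2) < \<infinity>"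
    using fin A by (simp add: ennreal_mult_less_top)
  finally show ?thesis
  proof (intro integrableI_nonneg AE_I2 mult_nonneg_nonneg)
    show "(\<lambda>x. (v x)\<^sup>2 * log_weight x) \<in> borel_measurable lebesgue" by measurable
    show "0 \<le> log_weight x" for x :: "real^'n" using log_weight_ge_1[of x] by simp
  qed simp_all
qed

text \<open>Once the weighted square is integrable, the far and diagonal parts are integrable, and
  \<open>conf_form\<close> and \<open>near_form\<close> differ by these parts only.\<close>

lemma conf_energy_iff_log_energy: "conf_energy v \<longleftrightarrow> log_energy v"
proof
  assume "log_energy v"
  then show "conf_energy v" using integrable_conf_form[of v v] by (simp add: conf_energy_def log_energy_def)
next
  assume v: "conf_energy v"
  then have vm: "v \<in> borel_measurable lebesgue" and Q: "integrable leb2 (conf_form v v)"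
    by (auto simp: conf_energy_def)
  note L = log_hardy[OF v]
  have F: "integrable leb2 (far_form v v)" and D: "integrable leb2 (diag_form v v)"
    using vm L by (auto intro: integrable_far_form integrable_diag_form)
  have "integrable leb2 (\<lambda>p. conf_form v v p + far_form v v p + far_form v v (prod.swap p) - diag_form v v p - diag_form v v (prod.swap p))"
    by (intro Bochner_Integration.integrable_add Bochner_Integration.integrable_diff Q F D integrable_leb2_swap[OF F] integrable_leb2_swap[OF D])
  then have "integrable leb2 (near_form v v)" by (simp add: conf_form_eq)
  then show "log_energy v" using v L by (simp add: conf_energy_def log_energy_def)
qed

subsection \<open>Weak solutions\<close>

lemma bubble_nonzero [simp]: "bubble x \<noteq> 0"
  using bubble_pos[of x] by simp

lemma iota_eq: "iota u x = bubble x * u (stereo_inv x)"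
  by (simp add: iota_def bubble_eq_powr)

lemma u_stereo_inv: "u (stereo_inv x) = iota u x / bubble x"
  using bubble_pos[of x] by (simp add: iota_eq)

lemma measurable_lebesgue_bubble: "bubble \<in> borel_measurable lebesgue"
  by (rule measurable_completion) simp

lemma measurable_sphere_vol_iff_iota:
  fixes u :: "(real^'n) \<times> real \<Rightarrow> real"
  shows "u \<in> borel_measurable sphere_vol \<longleftrightarrow> iota u \<in> borel_measurable lebesgue"
proof -
  note [measurable] = measurable_lebesgue_bubble
  have "(\<lambda>x. u (stereo_inv x)) \<in> borel_measurable lebesgue \<longleftrightarrow> iota u \<in> borel_measurable lebesgue"
  proof
    assume [measurable]: "(\<lambda>x. u (stereo_inv x)) \<in> borel_measurable lebesgue"
    show "iota u \<in> borel_measurable lebesgue" unfolding iota_eq[abs_def] by measurable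
  next
    assume [measurable]: "iota u \<in> borel_measurable lebesgue"
    show "(\<lambda>x. u (stereo_inv x)) \<in> borel_measurable lebesgue" unfolding u_stereo_inv[of u] by measurable
  qed
  then show ?thesis by (simp add: measurable_sphere_vol_iff)
qed

text \<open>The factor \<open>(bubble y)^2\<close> is the density of the inner volume element; the
  remaining \<open>1 / (bubble x)^2\<close> will be cancelled by that of the outer one.\<close>

lemma sphere_kernel_eq:
  fixes u w :: "(real^'n) \<times> real \<Rightarrow> real"
  shows "(bubble y)\<^sup>2 * ((u (stereo_inv x) - u (stereo_inv y)) * (w (stereo_inv x) - w (stereo_inv y))
      / norm (stereo_inv x - stereo_inv y) ^ CARD('n))
    = 1 / (bubble x)\<^sup>2 * conf_form (iota u) (iota w) (x, y)"
proof -
  define a b where "a = bubble x" and "b = bubble y"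
  have ab: "a > 0" "b > 0" by (simp_all add: a_def b_def bubble_pos)
  have "b\<^sup>2 * (s / (a * b * n)) = 1 / a\<^sup>2 * (s * (a * b) / n)" for s n :: real
    using ab by (simp add: power2_eq_square)
  then show ?thesis
    unfolding norm_stereo_inv_diff_power conf_form_def fst_conv snd_conv u_stereo_inv[of u] u_stereo_inv[of w] a_def[symmetric] b_def[symmetric] .
qed

lemma measurable_sphere_kernel:
  fixes u w :: "(real^'n) \<times> real \<Rightarrow> real"
  assumes u: "u \<in> borel_measurable sphere_vol" and w: "w \<in> borel_measurable sphere_vol"
  shows "(\<lambda>\<zeta>. (u z - u \<zeta>) * (w z - w \<zeta>) / norm (z - \<zeta>) ^ CARD('n)) \<in> borel_measurable sphere_vol"
proof -
  have "(\<lambda>x::real^'n. norm (z - stereo_inv x)) \<in> borel_measurable lebesgue"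
    by (rule measurable_completion)
      (use borel_measurable_stereo_inv in \<open>auto intro!: borel_measurable_diff measurable_compose[OF _ borel_measurable_norm]\<close>)
  then have [measurable]: "(\<lambda>\<zeta>::(real^'n) \<times> real. norm (z - \<zeta>)) \<in> borel_measurable sphere_vol"
    by (simp add: measurable_sphere_vol_iff)
  note [measurable] = u w
  show ?thesis by measurable
qed

lemma nn_integral_iota_sq:
  fixes u :: "(real^'n) \<times> real \<Rightarrow> real"
  assumes u: "u \<in> borel_measurable sphere_vol"
  shows "(\<integral>\<^sup>+z. ennreal ((u z)\<^sup>2) \<partial>sphere_vol) = (\<integral>\<^sup>+x. ennreal ((iota u x)\<^sup>2) \<partial>lebesgue)"
proof -
  have "(\<lambda>z. ennreal ((u z)\<^sup>2)) \<in> borel_measurable sphere_vol" using u by measurable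
  from nn_integral_sphere_vol[OF this] show ?thesis
    by (simp add: ennreal_mult[symmetric] iota_eq power_mult_distrib)
qed

lemma nn_integral_sphere_kernel:
  fixes u :: "(real^'n) \<times> real \<Rightarrow> real"
  assumes u: "u \<in> borel_measurable sphere_vol"
  shows "(\<integral>\<^sup>+z. \<integral>\<^sup>+\<zeta>. ennreal ((u z - u \<zeta>)\<^sup>2 / norm (z - \<zeta>) ^ CARD('n)) \<partial>sphere_vol \<partial>sphere_vol)
    = (\<integral>\<^sup>+p. ennreal (conf_form (iota u) (iota u) p) \<partial>leb2)"
proof -
  let ?v = "iota u"
  let ?G = "\<lambda>z. \<integral>\<^sup>+\<zeta>. ennreal ((u z - u \<zeta>)\<^sup>2 / norm (z - \<zeta>) ^ CARD('n)) \<partial>sphere_vol"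
  let ?I = "\<lambda>x. \<integral>\<^sup>+y. ennreal (conf_form ?v ?v (x, y)) \<partial>lebesgue"
  have v: "?v \<in> borel_measurable lebesgue" using u by (simp add: measurable_sphere_vol_iff_iota)
  note m = measurable_compose[OF measurable_conf_form[OF v v] measurable_ennreal]
  have G: "?G (stereo_inv x) = ennreal (1 / (bubble x)\<^sup>2) * ?I x" for x
  proof -
    have "(\<lambda>\<zeta>. ennreal ((u (stereo_inv x) - u \<zeta>)\<^sup>2 / norm (stereo_inv x - \<zeta>) ^ CARD('n))) \<in> borel_measurable sphere_vol"
      using measurable_compose[OF measurable_sphere_kernel[OF u u] measurable_ennreal] by (simp add: power2_eq_square)
    from nn_integral_sphere_vol[OF this]
    have "?G (stereo_inv x) = (\<integral>\<^sup>+y. ennreal ((bubble y)\<^sup>2 * ((u (stereo_inv x) - u (stereo_inv y)) * (u (stereo_inv x) - u (stereo_inv y))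
      / norm (stereo_inv x - stereo_inv y) ^ CARD('n))) \<partial>lebesgue)"
      by (simp add: ennreal_mult'[symmetric] power2_eq_square)
    also have "\<dots> = (\<integral>\<^sup>+y. ennreal (1 / (bubble x)\<^sup>2) * ennreal (conf_form ?v ?v (x, y)) \<partial>lebesgue)"
      unfolding sphere_kernel_eq by (intro nn_integral_cong ennreal_mult conf_form_nonneg) simp
    also have "\<dots> = ennreal (1 / (bubble x)\<^sup>2) * ?I x"
      by (rule nn_integral_cmult[OF measurable_compose[OF measurable_Pair1' m]]) simp
    finally show ?thesis .
  qed
  have Im: "?I \<in> borel_measurable lebesgue"
    by (rule lebesgue.borel_measurable_nn_integral_fst[OF m])
  have bm: "(\<lambda>x. ennreal (1 / (bubble x)\<^sup>2)) \<in> borel_measurable lebesgue"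
    using measurable_lebesgue_bubble by measurable
  have "?G \<in> borel_measurable sphere_vol"
    unfolding measurable_sphere_vol_iff G by (rule borel_measurable_times_ennreal[OF bm Im])
  from nn_integral_sphere_vol[OF this]
  have "(\<integral>\<^sup>+z. ?G z \<partial>sphere_vol) = (\<integral>\<^sup>+x. ennreal ((bubble x)\<^sup>2) * (ennreal (1 / (bubble x)\<^sup>2) * ?I x) \<partial>lebesgue)"
    unfolding G .
  also have "\<dots> = (\<integral>\<^sup>+x. ?I x \<partial>lebesgue)"
  proof (rule nn_integral_cong)
    fix x :: "real^'n"
    have "ennreal ((bubble x)\<^sup>2) * ennreal (1 / (bubble x)\<^sup>2) = 1"
      using bubble_pos[of x] by (subst ennreal_mult[symmetric]) auto
    then show "ennreal ((bubble x)\<^sup>2) * (ennreal (1 / (bubble x)\<^sup>2) * ?I x) = ?I x"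
      by (simp only: mult.assoc[symmetric] mult_1)
  qed
  also have "\<dots> = (\<integral>\<^sup>+p. ennreal (conf_form ?v ?v p) \<partial>leb2)"
    by (rule lebesgue.nn_integral_fst[OF m])
  finally show ?thesis .
qed

section \<open>The two energy spaces as conditions on functions on Euclidean space\<close>

lemma ennreal_mult_less_top_iff:
  assumes "c > 0"
  shows "ennreal c * X < \<infinity> \<longleftrightarrow> X < \<infinity>"
  using assms by (auto simp: ennreal_mult_less_top)

lemma integrable_iff_nn_integral_nonneg:
  fixes f :: "'a \<Rightarrow> real"
  assumes "f \<in> borel_measurable M" "\<And>x. f x \<ge> 0"
  shows "integrable M f \<longleftrightarrow> (\<integral>\<^sup>+x. ennreal (f x) \<partial>M) < \<infinity>"
  using assms by (simp add: integrable_iff_bounded)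

lemma H_sphere_iff:
  fixes u :: "(real^'n) \<times> real \<Rightarrow> real"
  shows "u \<in> H_sphere \<kappa> \<longleftrightarrow> log_energy (iota u)"
proof (cases "u \<in> borel_measurable sphere_vol")
  case True
  let ?v = "iota u"
  have v: "?v \<in> borel_measurable lebesgue" using True by (simp add: measurable_sphere_vol_iff_iota)
  note [measurable] = v
  have c: "ennreal (cN CARD('n) / 2) \<noteq> 0" using cN_pos[of "CARD('n)"] by simp
  have 1: "(\<integral>\<^sup>+x. ennreal ((?v x)\<^sup>2) \<partial>lebesgue) < \<infinity> \<longleftrightarrow> integrable lebesgue (\<lambda>x. (?v x)\<^sup>2)"
    by (subst integrable_iff_nn_integral_nonneg) auto
  have 2: "(\<integral>\<^sup>+p. ennreal (conf_form ?v ?v p) \<partial>leb2) < \<infinity> \<longleftrightarrow> integrable leb2 (conf_form ?v ?v)"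
    by (rule integrable_iff_nn_integral_nonneg[OF measurable_conf_form[OF v v] conf_form_nonneg, symmetric])
  have "u \<in> H_sphere \<kappa> \<longleftrightarrow> integrable lebesgue (\<lambda>x. (?v x)\<^sup>2) \<and> integrable leb2 (conf_form ?v ?v)"
    unfolding H_sphere_def H_norm_sq_def mem_Collect_eq nn_integral_iota_sq[OF True] nn_integral_sphere_kernel[OF True]
    using True by (auto simp: ennreal_add_less_top 1[symmetric] 2[symmetric] ennreal_mult_less_top c)
  then show ?thesis
    unfolding conf_energy_iff_log_energy[symmetric] conf_energy_def using v by simp
next
  case False
  then show ?thesis by (simp add: H_sphere_def log_energy_def measurable_sphere_vol_iff_iota)
qed

lemma D_log_iff: "(v :: real^'n \<Rightarrow> real) \<in> D_log \<longleftrightarrow> log_energy v"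
proof (cases "v \<in> borel_measurable lebesgue")
  case True
  note [measurable] = True measurable_log_weight
  have c: "cN CARD('n) / 2 > 0" using cN_pos[of "CARD('n)"] by simp
  have 1: "(\<integral>\<^sup>+x. ennreal ((v x)\<^sup>2) \<partial>lebesgue) < \<infinity> \<longleftrightarrow> integrable lebesgue (\<lambda>x. (v x)\<^sup>2)"
    by (subst integrable_iff_nn_integral_nonneg) auto
  have lw: "log_weight x \<ge> 0" for x :: "real^'n" using log_weight_ge_1[of x] by simp
  have 2: "(\<integral>\<^sup>+x. ennreal ((v x)\<^sup>2 * log_weight x) \<partial>lebesgue) < \<infinity> \<longleftrightarrow> integrable lebesgue (\<lambda>x. (v x)\<^sup>2 * log_weight x)"
    using lw by (subst integrable_iff_nn_integral_nonneg) auto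
  note m = measurable_compose[OF measurable_near_form[OF True True] measurable_ennreal]
  have "(\<integral>\<^sup>+x. (\<integral>\<^sup>+y\<in>ball x 1. ennreal ((v x - v y)\<^sup>2 / norm (x - y) ^ CARD('n)) \<partial>lebesgue) \<partial>lebesgue)
    = (\<integral>\<^sup>+x. \<integral>\<^sup>+y. ennreal (near_form v v (x, y)) \<partial>lebesgue \<partial>lebesgue)"
    by (intro nn_integral_cong) (simp add: near_form_def indicator_def power2_eq_square)
  also have "\<dots> = (\<integral>\<^sup>+p. ennreal (near_form v v p) \<partial>leb2)"
    by (rule lebesgue.nn_integral_fst[OF m])
  finally have 3: "(\<integral>\<^sup>+x. (\<integral>\<^sup>+y\<in>ball x 1. ennreal ((v x - v y)\<^sup>2 / norm (x - y) ^ CARD('n)) \<partial>lebesgue) \<partial>lebesgue) < \<infinity>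
      \<longleftrightarrow> integrable leb2 (near_form v v)"
    by (simp only: integrable_iff_nn_integral_nonneg[OF measurable_near_form[OF True True] near_form_nonneg])
  show ?thesis
    unfolding D_log_def D_norm_sq_def mem_Collect_eq log_weight_def[symmetric] ennreal_add_less_top infinity_ennreal_def
    unfolding infinity_ennreal_def[symmetric] ennreal_mult_less_top_iff[OF c] 1 2 3 log_energy_def
    by (auto simp: True)
next
  case False
  then show ?thesis by (simp add: D_log_def log_energy_def)
qed

section \<open>Comparison of the bilinear forms and of the right-hand sides\<close>

lemma integrable_log_energy_mult:
  assumes v: "log_energy v" and w: "log_energy w"
    and g: "g \<in> borel_measurable lebesgue" "\<And>x. \<bar>g x\<bar> \<le> log_weight x"
  shows "integrable lebesgue (\<lambda>x. v x * w x * g x)"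
proof (rule integrable_mult_of_squares)
  show "v \<in> borel_measurable lebesgue" "w \<in> borel_measurable lebesgue"
    "integrable lebesgue (\<lambda>x. (v x)\<^sup>2 * log_weight x)" "integrable lebesgue (\<lambda>x. (w x)\<^sup>2 * log_weight x)"
    using v w unfolding log_energy_def by blast+
qed (rule g)+

lemma
  assumes v: "log_energy v" and w: "log_energy w"
  shows integrable_log_energy_mult_const: "integrable lebesgue (\<lambda>x. v x * w x)"
    and integrable_log_energy_ln: "integrable lebesgue (\<lambda>x. v x * w x * ln (conf_factor x))"
proof -
  show "integrable lebesgue (\<lambda>x. v x * w x)"
    using integrable_log_energy_mult[OF v w borel_measurable_const, of 1] by (simp add: log_weight_ge_1)
  show "integrable lebesgue (\<lambda>x. v x * w x * ln (conf_factor x))"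
    by (intro integrable_log_energy_mult[OF v w] measurable_completion abs_ln_conf_factor_le) measurable
qed

text \<open>For Bochner integrals, passing from the iterated integral to the product measure needs
  joint integrability, which \<open>integrable_conf_form\<close> supplies for functions of
  logarithmic energy.\<close>

lemma P_form_eq:
  fixes u w :: "(real^'n) \<times> real \<Rightarrow> real"
  assumes v: "log_energy (iota u)" and v': "log_energy (iota w)"
  shows "P_form u w = cN CARD('n) / 2 * (\<integral>p. conf_form (iota u) (iota w) p \<partial>leb2)
     + AN CARD('n) * (\<integral>x. iota u x * iota w x \<partial>lebesgue)"
proof -
  let ?v = "iota u" and ?w = "iota w"
  have vm: "?v \<in> borel_measurable lebesgue" and wm: "?w \<in> borel_measurable lebesgue"
    using v v' by (auto simp: log_energy_def)
  then have u: "u \<in> borel_measurable sphere_vol" and w: "w \<in> borel_measurable sphere_vol"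
    by (auto simp: measurable_sphere_vol_iff_iota)
  let ?G = "\<lambda>z. \<integral>\<zeta>. (u z - u \<zeta>) * (w z - w \<zeta>) / norm (z - \<zeta>) ^ CARD('n) \<partial>sphere_vol"
  let ?I = "\<lambda>x. \<integral>y. conf_form ?v ?w (x, y) \<partial>lebesgue"
  have G: "?G (stereo_inv x) = 1 / (bubble x)\<^sup>2 * ?I x" for x
    unfolding integral_sphere_vol[OF measurable_sphere_kernel[OF u w]] sphere_kernel_eq
    by (rule integral_mult_right_zero)
  have I: "integrable leb2 (conf_form ?v ?w)" by (rule integrable_conf_form[OF v v'])
  have Im: "?I \<in> borel_measurable lebesgue"
    by (rule borel_measurable_integrable[OF lebesgue_pair.integrable_fst'[OF I]])
  have bm: "(\<lambda>x. 1 / (bubble x)\<^sup>2) \<in> borel_measurable lebesgue"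
    using measurable_lebesgue_bubble by measurable
  have "?G \<in> borel_measurable sphere_vol"
    unfolding measurable_sphere_vol_iff G by (rule borel_measurable_times[OF bm Im])
  from integral_sphere_vol[OF this]
  have "(\<integral>z. ?G z \<partial>sphere_vol) = (\<integral>x. (bubble x)\<^sup>2 * (1 / (bubble x)\<^sup>2 * ?I x) \<partial>lebesgue)"
    unfolding G .
  also have "\<dots> = (\<integral>x. ?I x \<partial>lebesgue)"
    by simp
  also have "\<dots> = (\<integral>p. conf_form ?v ?w p \<partial>leb2)"
    by (rule lebesgue_pair.integral_fst'[OF I])
  finally have 1: "(\<integral>z. ?G z \<partial>sphere_vol) = \<dots>" .
  have "(\<lambda>z. u z * w z) \<in> borel_measurable sphere_vol" using u w by measurable
  from integral_sphere_vol[OF this]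
  have "(\<integral>z. u z * w z \<partial>sphere_vol) = (\<integral>x. ?v x * ?w x \<partial>lebesgue)"
    by (simp add: iota_eq power2_eq_square mult_ac)
  with 1 show ?thesis unfolding P_form_def by simp
qed

lemma EL_form_eq:
  fixes v w :: "real^'n \<Rightarrow> real"
  assumes v: "log_energy v" and w: "log_energy w"
  shows "EL_form v w = cN CARD('n) / 2 * (\<integral>p. near_form v w p \<partial>leb2) - cN CARD('n) * (\<integral>p. far_form v w p \<partial>leb2)
    + rhoN CARD('n) * (\<integral>x. v x * w x \<partial>lebesgue)"
proof -
  have "(\<integral>x. (\<integral>y\<in>ball x 1. (v x - v y) * (w x - w y) / norm (x - y) ^ CARD('n) \<partial>lebesgue) \<partial>lebesgue)
    = (\<integral>x. \<integral>y. near_form v w (x, y) \<partial>lebesgue \<partial>lebesgue)"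
    by (simp add: set_lebesgue_integral_def near_form_def)
  also have "\<dots> = (\<integral>p. near_form v w p \<partial>leb2)"
    by (rule lebesgue_pair.integral_fst'[OF integrable_near_form[OF v w]])
  finally have 1: "(\<integral>x. (\<integral>y\<in>ball x 1. (v x - v y) * (w x - w y) / norm (x - y) ^ CARD('n) \<partial>lebesgue) \<partial>lebesgue) = \<dots>" .
  have "(\<integral>(x, y)\<in>{(x, y). norm (x - y) \<ge> 1}. v x * w y / norm (x - y) ^ CARD('n) \<partial>leb2)
    = (\<integral>p. far_form v w p \<partial>leb2)"
    unfolding set_lebesgue_integral_def
    by (intro Bochner_Integration.integral_cong) (auto simp: far_form_def indicator_def dist_norm)
  with 1 show ?thesis unfolding EL_form_def E_form_def by simp
qed

text \<open>The diagonal part exchanges the constant A_N for rho_N, so that only the term with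
  \<open>ln \<phi>\<close> is left over.\<close>

lemma EL_form_iota:
  fixes u w :: "(real^'n) \<times> real \<Rightarrow> real"
  assumes v: "log_energy (iota u)" and w: "log_energy (iota w)"
  shows "EL_form (iota u) (iota w) = P_form u w + 2 * (\<integral>x. iota u x * iota w x * ln (conf_factor x) \<partial>lebesgue)"
proof -
  let ?v = "iota u" and ?w = "iota w" and ?N = "CARD('n)"
  have c: "cN ?N > 0" by (rule cN_pos) simp
  note I = integrable_log_energy_mult_const[OF v w] integrable_log_energy_ln[OF v w]
  have "(\<integral>p. diag_form ?v ?w p \<partial>leb2) = (\<integral>x. ?v x * ?w x * ((rhoN ?N - AN ?N - 2 * ln (conf_factor x)) / cN ?N) \<partial>lebesgue)"
    using v w by (intro integral_diag_form) (auto simp: log_energy_def)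
  also have "\<dots> = (\<integral>x. (rhoN ?N - AN ?N) / cN ?N * (?v x * ?w x) - 2 / cN ?N * (?v x * ?w x * ln (conf_factor x)) \<partial>lebesgue)"
    by (intro Bochner_Integration.integral_cong) (simp_all add: algebra_simps diff_divide_distrib add_divide_distrib)
  also have "\<dots> = (rhoN ?N - AN ?N) / cN ?N * (\<integral>x. ?v x * ?w x \<partial>lebesgue) - 2 / cN ?N * (\<integral>x. ?v x * ?w x * ln (conf_factor x) \<partial>lebesgue)"
    by (subst integral_mult_right_zero[symmetric], subst integral_mult_right_zero[symmetric],
        rule Bochner_Integration.integral_diff) (intro integrable_mult_right I)+
  finally have "cN ?N * (\<integral>p. diag_form ?v ?w p \<partial>leb2) =
      (rhoN ?N - AN ?N) * (\<integral>x. ?v x * ?w x \<partial>lebesgue) - 2 * (\<integral>x. ?v x * ?w x * ln (conf_factor x) \<partial>lebesgue)"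
    using c by (simp add: right_diff_distrib)
  then show ?thesis
    unfolding EL_form_eq[OF v w] P_form_eq[OF v w] integral_conf_form[OF v w] by (simp add: algebra_simps)
qed

text \<open>The factor 2 is 4/N times the N/2 in \<open>ln_bubble\<close>. It equals the one in
  \<open>EL_form_iota\<close>, so the two leftover terms cancel.\<close>

lemma sphere_rhs_eq:
  fixes u w :: "(real^'n) \<times> real \<Rightarrow> real"
  shows "(bubble x)\<^sup>2 * ((4 / real CARD('n) * u (stereo_inv x) * ln \<bar>u (stereo_inv x)\<bar> + \<mu> * u (stereo_inv x)) * w (stereo_inv x))
    = (4 / real CARD('n) * ln \<bar>iota u x\<bar> + \<mu>) * iota u x * iota w x - 2 * (iota u x * iota w x * ln (conf_factor x))"
\<comment> \<open>The logarithm of the quotient splits only for a nonzero numerator; at zeros of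
  \<open>iota u\<close> both sides vanish.\<close>
proof (cases "iota u x = 0")
  case True
  then show ?thesis by (simp add: u_stereo_inv[of u])
next
  case False
  have b: "bubble x > 0" by (rule bubble_pos)
  have ln_eq: "ln \<bar>iota u x / bubble x\<bar> = ln \<bar>iota u x\<bar> - real CARD('n) / 2 * ln (conf_factor x)"
    using False b by (simp add: abs_divide ln_div ln_bubble)
  have expand: "b\<^sup>2 * ((c * (s / b) * l + \<mu> * (s / b)) * (t / b)) = c * l * s * t + \<mu> * s * t"
    if "b > 0" for b c s t l :: real
    using that by (simp add: power2_eq_square field_simps)
  show ?thesis
    unfolding u_stereo_inv[of u] u_stereo_inv[of w] expand[OF b] ln_eq by (simp add: algebra_simps)
qed

text \<open>The integrand on the sphere, pulled back, differs from \<open>g\<close> by a term that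
  is integrable because \<open>|ln \<phi>|\<close> is bounded by \<open>log_weight\<close>.\<close>

lemma
  fixes u w :: "(real^'n) \<times> real \<Rightarrow> real" and \<mu> :: real
  assumes v: "log_energy (iota u)" and w: "log_energy (iota w)"
  defines "f \<equiv> \<lambda>z. (4 / real CARD('n) * u z * ln \<bar>u z\<bar> + \<mu> * u z) * w z"
    and "g \<equiv> \<lambda>x. (4 / real CARD('n) * ln \<bar>iota u x\<bar> + \<mu>) * iota u x * iota w x"
  shows integrable_rhs_iff: "integrable sphere_vol f \<longleftrightarrow> integrable lebesgue g"
    and integral_rhs: "integrable lebesgue g \<Longrightarrow>
      (\<integral>x. g x \<partial>lebesgue) = (\<integral>z. f z \<partial>sphere_vol) + 2 * (\<integral>x. iota u x * iota w x * ln (conf_factor x) \<partial>lebesgue)"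
proof -
  let ?h = "\<lambda>x. 2 * (iota u x * iota w x * ln (conf_factor x))"
  have um: "u \<in> borel_measurable sphere_vol" and wm: "w \<in> borel_measurable sphere_vol"
    using v w by (auto simp: log_energy_def measurable_sphere_vol_iff_iota)
  note [measurable] = um wm
  have fm: "f \<in> borel_measurable sphere_vol" unfolding f_def by measurable
  have h: "integrable lebesgue ?h" by (intro integrable_mult_right integrable_log_energy_ln v w)
  have fg: "(bubble x)\<^sup>2 * f (stereo_inv x) = g x - ?h x" for x
    unfolding f_def g_def by (rule sphere_rhs_eq)
  have "integrable lebesgue (\<lambda>x. g x - ?h x) \<longleftrightarrow> integrable lebesgue g"
  proof
    assume "integrable lebesgue (\<lambda>x. g x - ?h x)"
    from Bochner_Integration.integrable_add[OF this h] show "integrable lebesgue g" by (simp only: diff_add_cancel)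
  next
    assume "integrable lebesgue g"
    then show "integrable lebesgue (\<lambda>x. g x - ?h x)" by (rule Bochner_Integration.integrable_diff[OF _ h])
  qed
  then show "integrable sphere_vol f \<longleftrightarrow> integrable lebesgue g"
    unfolding integrable_sphere_vol_iff[OF fm] fg .
  assume g: "integrable lebesgue g"
  show "(\<integral>x. g x \<partial>lebesgue) = (\<integral>z. f z \<partial>sphere_vol) + 2 * (\<integral>x. iota u x * iota w x * ln (conf_factor x) \<partial>lebesgue)"
    unfolding integral_sphere_vol[OF fm] fg Bochner_Integration.integral_diff[OF g h] by simp
qed

text \<open>This lets the test functions on the sphere exhaust those on Euclidean space. The value
  of the witness at the south pole is immaterial, as \<open>iota\<close> never evaluates it
  there.\<close>

lemma iota_surj: "\<exists>u. iota u = (w :: real^'n \<Rightarrow> real)"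
proof
  show "iota (\<lambda>z. w (stereo z) / bubble (stereo z)) = w"
    by (simp add: iota_eq fun_eq_iff stereo_stereo_inv)
qed

theorem theorem1p7:
  fixes u :: "(real^'n) \<times> real \<Rightarrow> real" and v :: "real^'n \<Rightarrow> real" and \<mu> \<kappa> :: real
  assumes kappa: "\<kappa> > Max {2 * (Digamma (real CARD('n) / 2) - Digamma (real CARD('n) / 4)),
                            AN CARD('n), 1}"
    and v: "v = iota u"
  shows "weak_solution_sphere \<kappa> \<mu> u \<longleftrightarrow> weak_solution_Rn \<mu> v"
proof (cases "log_energy (iota u)")
  case u: True
  define S where "S w \<longleftrightarrow>
      integrable sphere_vol (\<lambda>z. (4 / real CARD('n) * u z * ln \<bar>u z\<bar> + \<mu> * u z) * w z) \<and>
      P_form u w = (\<integral>z. (4 / real CARD('n) * u z * ln \<bar>u z\<bar> + \<mu> * u z) * w z \<partial>sphere_vol)" for w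
  define T where "T w \<longleftrightarrow>
      integrable lebesgue (\<lambda>x. (4 / real CARD('n) * ln \<bar>iota u x\<bar> + \<mu>) * iota u x * w x) \<and>
      EL_form (iota u) w = (\<integral>x. (4 / real CARD('n) * ln \<bar>iota u x\<bar> + \<mu>) * iota u x * w x \<partial>lebesgue)"
    for w :: "real^'n \<Rightarrow> real"
  \<comment> \<open>Both the form and the right-hand side on Euclidean space exceed their
    counterparts on the sphere by the same term with \<open>ln \<phi>\<close>.\<close>
  have "S w \<longleftrightarrow> T (iota w)" if w: "log_energy (iota w)" for w
    unfolding S_def T_def integrable_rhs_iff[OF u w] EL_form_iota[OF u w] using integral_rhs[OF u w, of \<mu>] by auto
  then have "(\<forall>w. log_energy (iota w) \<longrightarrow> S w) \<longleftrightarrow> (\<forall>w. log_energy (iota w) \<longrightarrow> T (iota w))"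
    by blast
  also have "\<dots> \<longleftrightarrow> (\<forall>w. log_energy w \<longrightarrow> T w)"
  proof (intro iffI allI impI)
    \<comment> \<open>A test function on Euclidean space is written as \<open>iota w'\<close>; the
      energy condition then holds for \<open>w'\<close> by substitution.\<close>
    fix w :: "real^'n \<Rightarrow> real" assume A: "\<forall>w. log_energy (iota w) \<longrightarrow> T (iota w)" and w: "log_energy w"
    obtain w' where "iota w' = w" using iota_surj[of w] by blast
    with A w show "T w" by blast
  qed blast
  finally have "(\<forall>w. log_energy (iota w) \<longrightarrow> S w) \<longleftrightarrow> (\<forall>w. log_energy w \<longrightarrow> T w)" .
  then show ?thesis
    unfolding weak_solution_sphere_def weak_solution_Rn_def v H_sphere_iff D_log_iff Ball_def S_def T_def
    using u by simp
next
  \<comment> \<open>Outside the common energy space both sides of the equivalence are false.\<close>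
  case False
  then show ?thesis
    unfolding weak_solution_sphere_def weak_solution_Rn_def v H_sphere_iff D_log_iff by simp
qed

end
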